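(* Let $n,k\ge 1$ be integers, not both equal to $1$, let $\varLambda\subset\mathbb R^n$ be a lattice with $|\det(\varLambda)|=1$, let $V=V(\varLambda,k)$ be the set of $k$-free points of $\varLambda$, let $\mathbb X(V)=\overline{\{t+V\mid t\in\varLambda\}}\subset\{0,1\}^{\varLambda}$ be its discrete hull with the translation action of $\varLambda$, and let $\nu$ be the $\varLambda$-invariant Borel probability measure on $\mathbb X(V)$ determined by the patch frequencies of $V$. Then $(\mathbb X(V),\varLambda,\nu)$ has the following properties. (a) The $\varLambda$-orbit of $V$ in $\mathbb X(V)$ is $\nu$-equidistributed, i.e., for any function $f\in C(\mathbb X(V))$, one has $$\lim_{R\to\infty}\frac{1}{v_nR^n}\sum_{x\in\varLambda\cap B_R(0)}f(V+x)=\int_{\mathbb X(V)}f(X)\,\mathrm d\nu(X).$$ In other words, $V$ is $\nu$-generic. (b) $(\mathbb X(V),\varLambda,\nu)$ is ergodic, deterministic (i.e., it is of zero measure entropy) and has pure-point dynamical spectrum, given by the set of all points $y\in\mathbb Q\varLambda^*$ whose denominator $\operatorname{den}(y)$ is $(k+1)$-free (the Fourier–Bohr spectrum of the natural autocorrelation of $V$). (c) Let $X_K$ be the compact Abelian group $\prod_p(\varLambda/p^k\varLambda)$ (product over all primes $p$), on which $\varLambda$ acts via addition on the diagonal, $g\mapsto g+(\bar x,\bar x,\dots)$ for $g\in X_K$ and $x\in\varLambda$, and let $\mu$ be the normalised Haar measure on $X_K$. Then the Kronecker system $(X_K,\varLambda,\mu)$ is metrically isomorphic to $(\mathbb X(V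),\varLambda,\nu)$.
   Context: $k$-free points: $V(\varLambda,k)$ is the set of points of $\varLambda$ for which the greatest common divisor of the coordinates in any lattice basis of $\varLambda$ is not divisible by any non-trivial $k$th power of an integer; equivalently $V=\varLambda\setminus\bigcup_p p^k\varLambda$, with $p$ running through all primes. Hull: the power set of $\varLambda$ is identified with $\{0,1\}^{\varLambda}$, with the product topology of the discrete topology on $\{0,1\}$, and $\varLambda$ acts continuously by translation $X\mapsto X+t$. The hull $\mathbb X(V)$ is the closure of the $\varLambda$-orbit of $V$. $B_R(0)$ is the open ball of radius $R$ about $0$ in $\mathbb R^n$, and $v_n=\operatorname{vol}(B_1(0))$. For $Y\subset\varLambda$, $\operatorname{dens}(Y)=\lim_{R\to\infty}|Y\cap B_R(0)|/(v_nR^n)$ when the limit exists. Frequency measure: for $\rho>0$ and $t\in\varLambda$ the $\rho$-patch of $V$ at $t$ is $(V-t)\cap B_\rho(0)$. The frequency of a $\rho$-patch $\mathcal P$ of $V$ is $\nu(\mathcal P)=\operatorname{dens}(\{t\in\varLambda\mid (V-t)\cap B_\rho(0)=\mathcal P\})$; this density exists, is positive, and equals $$\nu(\mathcal P)=\sum_{\mathcal F\subset(B_\rho(0)\cap\varLambda)\setminus\mathcal P}(-1)^{|\mathcal F|}\prod_p\Big(1-\frac{|(\mathcal P\cup\mathcal F)/p^k\varLambda|}{p^{nk}}\Big),$$ where $p$ runs through all primes and $A/p^k\varLambda$ denotes the set of cosets of $p^k\varLambda$ in $\varLambda$ represented in $A$. For a $\rho$-patch $\mathcal P$ of $V$, the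 cylinder set is $C_{\mathcal P}=\{X\in\mathbb X(V)\mid X\cap B_\rho(0)=\mathcal P\}$. The measure $\nu$ is the unique Borel probability measure on $\mathbb X(V)$ with $\nu(C_{\mathcal P})=\nu(\mathcal P)$ for all $\rho>0$ and all $\rho$-patches $\mathcal P$ of $V$; it is $\varLambda$-invariant. Dual lattice: $\varLambda^*=\{y\in\mathbb R^n\mid y\cdot x\in\mathbb Z\text{ for all }x\in\varLambda\}$; $\mathbb Q\varLambda^*$ is its $\mathbb Q$-span; the denominator of $y\in\mathbb Q\varLambda^*$ is $\operatorname{den}(y)=\min\{m\in\mathbb N\mid my\in\varLambda^*\}$. A positive integer is $(k+1)$-free if it is not divisible by $p^{k+1}$ for any prime $p$. Pure-point dynamical spectrum: $L^2(\mathbb X(V),\nu)$ has an orthonormal basis of eigenfunctions of the $\varLambda$-action. A point $y\in\mathbb R^n$ belongs to the dynamical spectrum if there is a non-zero $f\in L^2(\mathbb X(V),\nu)$ such that, for every $t\in\varLambda$, $f(X+t)=e^{2\pi i\,y\cdot t}f(X)$ for $\nu$-almost every $X$ (so the spectrum is a $\varLambda^*$-periodic subset of $\mathbb R^n$). Measure entropy is the Kolmogorov–Sinai entropy of the measure-preserving action of $\varLambda\cong\mathbb Z^n$. Metrically isomorphic means isomorphic as measure-preserving $\varLambda$-systems (modulo null sets). *)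

theory Defs
  imports
    "HOL-Probability.Probability"
    "HOL-Algebra.Product_Groups"
begin

section \<open>Lattices and k-free points\<close>

text \<open>The rows of \<^term>\<open>B\<close> form the basis, so \<open>\<bar>det B\<bar>\<close> is the covolume of the lattice.\<close>

definition lattice_basis :: "(real ^ 'n) set \<Rightarrow> real ^ 'n ^ 'n \<Rightarrow> bool" where
  "lattice_basis L B \<longleftrightarrow>
     det B \<noteq> 0 \<and> L = range (\<lambda>c :: 'n \<Rightarrow> int. \<Sum>i\<in>UNIV. of_int (c i) *\<^sub>R B $ i)"

definition multiples :: "nat \<Rightarrow> (real ^ 'n) set \<Rightarrow> (real ^ 'n) set" where
  "multiples m L = (\<lambda>x. real m *\<^sub>R x) ` L"

definition kfree_points :: "(real ^ 'n) set \<Rightarrow> nat \<Rightarrow> (real ^ 'n) set" where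
  "kfree_points L k = L - (\<Union>p\<in>{p. prime p}. multiples (p ^ k) L)"

definition dual_lattice :: "(real ^ 'n) set \<Rightarrow> (real ^ 'n) set" where
  "dual_lattice L = {y. \<forall>x\<in>L. y \<bullet> x \<in> \<int>}"

definition rational_span :: "(real ^ 'n) set \<Rightarrow> (real ^ 'n) set" where
  "rational_span S = {\<Sum>y\<in>A. of_rat (q y) *\<^sub>R y | A q. finite A \<and> A \<subseteq> S}"

definition den :: "(real ^ 'n) set \<Rightarrow> real ^ 'n \<Rightarrow> nat" where
  "den L y = (LEAST m. m > 0 \<and> real m *\<^sub>R y \<in> dual_lattice L)"

definition power_free :: "nat \<Rightarrow> nat \<Rightarrow> bool" where
  "power_free j m \<longleftrightarrow> m > 0 \<and> (\<forall>p. prime p \<longrightarrow> \<not> p ^ j dvd m)"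

text \<open>\<open>v\<^sub>n R\<^sup>n\<close>, and natural density along centred open balls.\<close>

definition ball_vol :: "'n::finite itself \<Rightarrow> real \<Rightarrow> real" where
  "ball_vol _ R = measure lborel (ball (0 :: real ^ 'n) 1) * R ^ CARD('n)"

definition has_density :: "(real ^ 'n) set \<Rightarrow> real \<Rightarrow> bool" where
  "has_density Y d \<longleftrightarrow>
     ((\<lambda>R. real (card (Y \<inter> ball 0 R)) / ball_vol TYPE('n) R) \<longlongrightarrow> d) at_top"


section \<open>The hull and the frequency measure\<close>

definition translate :: "real ^ 'n \<Rightarrow> (real ^ 'n) set \<Rightarrow> (real ^ 'n) set" where
  "translate t X = (\<lambda>x. x + t) ` X"

definition power_set_topology :: "'a set \<Rightarrow> 'a set topology" where
  "power_set_topology L =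
     pullback_topology (Pow L) (\<lambda>X. \<lambda>x\<in>L. x \<in> X)
       (product_topology (\<lambda>_. discrete_topology (UNIV :: bool set)) L)"

definition discrete_hull :: "(real ^ 'n) set \<Rightarrow> (real ^ 'n) set \<Rightarrow> (real ^ 'n) set set" where
  "discrete_hull L V = power_set_topology L closure_of {translate t V | t. t \<in> L}"

definition hull_topology :: "(real ^ 'n) set \<Rightarrow> (real ^ 'n) set \<Rightarrow> (real ^ 'n) set topology" where
  "hull_topology L V = subtopology (power_set_topology L) (discrete_hull L V)"

definition borel_algebra :: "'a topology \<Rightarrow> 'a measure" where
  "borel_algebra T = sigma (topspace T) {U. openin T U}"

definition patch_at :: "(real ^ 'n) set \<Rightarrow> real \<Rightarrow> real ^ 'n \<Rightarrow> (real ^ 'n) set" where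
  "patch_at V \<rho> t = translate (- t) V \<inter> ball 0 \<rho>"

definition cylinder ::
  "(real ^ 'n) set \<Rightarrow> (real ^ 'n) set \<Rightarrow> real \<Rightarrow> (real ^ 'n) set \<Rightarrow> (real ^ 'n) set set" where
  "cylinder L V \<rho> P = {X \<in> discrete_hull L V. X \<inter> ball 0 \<rho> = P}"

definition is_frequency_measure ::
  "(real ^ 'n) set \<Rightarrow> (real ^ 'n) set \<Rightarrow> (real ^ 'n) set measure \<Rightarrow> bool" where
  "is_frequency_measure L V \<nu> \<longleftrightarrow>
     prob_space \<nu> \<and>
     space \<nu> = discrete_hull L V \<and>
     sets \<nu> = sets (borel_algebra (hull_topology L V)) \<and>
     (\<forall>\<rho>>0. \<forall>P\<in>patch_at V \<rho> ` L.
        has_density {t \<in> L. patch_at V \<rho> t = P} (measure \<nu> (cylinder L V \<rho> P)))"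

definition frequency_measure ::
  "(real ^ 'n) set \<Rightarrow> (real ^ 'n) set \<Rightarrow> (real ^ 'n) set measure" where
  "frequency_measure L V = (THE \<nu>. is_frequency_measure L V \<nu>)"


section \<open>Measure-preserving actions\<close>

text \<open>An action of a subgroup \<^term>\<open>G\<close> of an additive group is a map \<^term>\<open>T\<close> taking
  \<open>t \<in> G\<close> to a transformation of the space of \<^term>\<open>M\<close>.\<close>

definition pmp_action :: "'g::group_add set \<Rightarrow> ('g \<Rightarrow> 'a \<Rightarrow> 'a) \<Rightarrow> 'a measure \<Rightarrow> bool" where
  "pmp_action G T M \<longleftrightarrow>
     prob_space M \<and>
     (\<forall>t\<in>G. T t \<in> measurable M M \<and> distr M M (T t) = M) \<and>
     (\<forall>x\<in>space M. T 0 x = x) \<and>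
     (\<forall>s\<in>G. \<forall>t\<in>G. \<forall>x\<in>space M. T (s + t) x = T s (T t x))"

definition ergodic_action :: "'g::group_add set \<Rightarrow> ('g \<Rightarrow> 'a \<Rightarrow> 'a) \<Rightarrow> 'a measure \<Rightarrow> bool" where
  "ergodic_action G T M \<longleftrightarrow>
     pmp_action G T M \<and>
     (\<forall>A\<in>sets M. (\<forall>t\<in>G. T t -` A \<inter> space M = A) \<longrightarrow> measure M A = 0 \<or> measure M A = 1)"

text \<open>A finite measurable partition is given by its labelling function \<^term>\<open>\<xi>\<close>, a simple
  function. The function \<open>x \<mapsto> (\<xi> (T t x))\<^sub>t\<close> with \<open>t\<close> in a finite set \<open>F\<close> labels the common
  refinement of the pulled back partitions. The intersections of \<^term>\<open>G\<close> with centred balls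
  serve as averaging (Foelner) sequence.\<close>

definition refined_entropy ::
  "('g \<Rightarrow> 'a \<Rightarrow> 'a) \<Rightarrow> 'a measure \<Rightarrow> ('a \<Rightarrow> nat) \<Rightarrow> 'g set \<Rightarrow> real" where
  "refined_entropy T M \<xi> F =
     (let J = (\<lambda>x. \<lambda>t\<in>F. \<xi> (T t x))
      in prob_space.entropy M (exp 1) (count_space (J ` space M)) J)"

definition measure_entropy ::
  "'g::real_normed_vector set \<Rightarrow> ('g \<Rightarrow> 'a \<Rightarrow> 'a) \<Rightarrow> 'a measure \<Rightarrow> ereal" where
  "measure_entropy G T M =
     (SUP \<xi>\<in>{\<xi>. simple_function M \<xi>}.
        Limsup at_top (\<lambda>R. ereal (refined_entropy T M \<xi> (G \<inter> ball 0 R) / card (G \<inter> ball 0 R))))"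

definition L2 :: "'a measure \<Rightarrow> ('a \<Rightarrow> complex) set" where
  "L2 M = {f \<in> borel_measurable M. integrable M (\<lambda>x. (cmod (f x))\<^sup>2)}"

definition L2_inner :: "'a measure \<Rightarrow> ('a \<Rightarrow> complex) \<Rightarrow> ('a \<Rightarrow> complex) \<Rightarrow> complex" where
  "L2_inner M f g = (\<integral>x. f x * cnj (g x) \<partial>M)"

text \<open>Elements of \<^term>\<open>L2 M\<close> are functions rather than classes modulo null sets; the condition on
  inner products forces distinct members of \<^term>\<open>E\<close> to represent distinct classes.\<close>

definition orthonormal_basis :: "'a measure \<Rightarrow> ('a \<Rightarrow> complex) set \<Rightarrow> bool" where
  "orthonormal_basis M E \<longleftrightarrow>
     E \<subseteq> L2 M \<and>
     (\<forall>e\<in>E. \<forall>e'\<in>E. L2_inner M e e' = (if e = e' then 1 else 0)) \<and>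
     (\<forall>f\<in>L2 M. \<forall>\<epsilon>>0. \<exists>A c. finite A \<and> A \<subseteq> E \<and>
        (\<integral>x. (cmod (f x - (\<Sum>e\<in>A. c e * e x)))\<^sup>2 \<partial>M) < \<epsilon>)"

definition is_eigenfunction ::
  "'g::real_inner set \<Rightarrow> ('g \<Rightarrow> 'a \<Rightarrow> 'a) \<Rightarrow> 'a measure \<Rightarrow> 'g \<Rightarrow> ('a \<Rightarrow> complex) \<Rightarrow> bool" where
  "is_eigenfunction G T M y f \<longleftrightarrow>
     f \<in> L2 M \<and> \<not> (AE x in M. f x = 0) \<and>
     (\<forall>t\<in>G. AE x in M. f (T t x) = cis (2 * pi * (y \<bullet> t)) * f x)"

definition dynamical_spectrum ::
  "'g::real_inner set \<Rightarrow> ('g \<Rightarrow> 'a \<Rightarrow> 'a) \<Rightarrow> 'a measure \<Rightarrow> 'g set" where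
  "dynamical_spectrum G T M = {y. \<exists>f. is_eigenfunction G T M y f}"

definition pure_point_spectrum ::
  "'g::real_inner set \<Rightarrow> ('g \<Rightarrow> 'a \<Rightarrow> 'a) \<Rightarrow> 'a measure \<Rightarrow> bool" where
  "pure_point_spectrum G T M \<longleftrightarrow>
     (\<exists>E. orthonormal_basis M E \<and> (\<forall>e\<in>E. \<exists>y. is_eigenfunction G T M y e))"

definition metrically_isomorphic ::
  "'g set \<Rightarrow> ('g \<Rightarrow> 'a \<Rightarrow> 'a) \<Rightarrow> 'a measure \<Rightarrow> ('g \<Rightarrow> 'b \<Rightarrow> 'b) \<Rightarrow> 'b measure \<Rightarrow> bool" where
  "metrically_isomorphic G T M S N \<longleftrightarrow>
     (\<exists>A B \<phi> \<psi>.
        A \<in> sets M \<and> emeasure M (space M - A) = 0 \<and> (\<forall>t\<in>G. T t ` A \<subseteq> A) \<and>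
        B \<in> sets N \<and> emeasure N (space N - B) = 0 \<and> (\<forall>t\<in>G. S t ` B \<subseteq> B) \<and>
        \<phi> \<in> measurable (restrict_space M A) (restrict_space N B) \<and>
        \<psi> \<in> measurable (restrict_space N B) (restrict_space M A) \<and>
        (\<forall>x\<in>A. \<psi> (\<phi> x) = x) \<and> (\<forall>z\<in>B. \<phi> (\<psi> z) = z) \<and>
        distr (restrict_space M A) (restrict_space N B) \<phi> = restrict_space N B \<and>
        (\<forall>t\<in>G. \<forall>x\<in>A. \<phi> (T t x) = S t (\<phi> x)))"


section \<open>Autocorrelation and Fourier-Bohr spectrum\<close>

text \<open>For a subset \<^term>\<open>V\<close> of a lattice \<open>L\<close>, the natural autocorrelation is the measure
  \<open>\<Sum>z\<in>L. autocorrelation V z \<cdot> \<delta>\<^sub>z\<close>; a measure \<open>\<Sum>z\<in>L. \<eta> z \<cdot> \<delta>\<^sub>z\<close> is given by its coefficient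
  function \<open>\<eta>\<close>.\<close>

definition autocorrelation :: "(real ^ 'n) set \<Rightarrow> real ^ 'n \<Rightarrow> real" where
  "autocorrelation V z =
     Lim at_top (\<lambda>R. real (card {(u, v). u \<in> V \<inter> ball 0 R \<and> v \<in> V \<inter> ball 0 R \<and> u - v = z})
                       / ball_vol TYPE('n) R)"

definition fourier_bohr_spectrum :: "(real ^ 'n) set \<Rightarrow> (real ^ 'n \<Rightarrow> real) \<Rightarrow> (real ^ 'n) set" where
  "fourier_bohr_spectrum L \<eta> =
     {y. \<exists>a. a \<noteq> 0 \<and>
        ((\<lambda>R. (\<Sum>z\<in>L \<inter> ball 0 R. of_real (\<eta> z) * cis (- 2 * pi * (y \<bullet> z)))
                / of_real (ball_vol TYPE('n) R)) \<longlongrightarrow> a) at_top}"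


section \<open>The Kronecker system\<close>

definition haar_measure :: "('a, 'b) monoid_scheme \<Rightarrow> 'a topology \<Rightarrow> 'a measure" where
  "haar_measure G T =
     (THE \<mu>. prob_space \<mu> \<and> space \<mu> = topspace T \<and> sets \<mu> = sets (borel_algebra T) \<and>
        (\<forall>g\<in>carrier G. \<forall>A\<in>sets \<mu>. emeasure \<mu> ((\<lambda>h. h \<otimes>\<^bsub>G\<^esub> g) ` A) = emeasure \<mu> A))"

definition lattice_group :: "(real ^ 'n) set \<Rightarrow> (real ^ 'n) monoid" where
  "lattice_group L = \<lparr>carrier = L, monoid.mult = (+), one = 0\<rparr>"

definition kronecker_group :: "(real ^ 'n) set \<Rightarrow> nat \<Rightarrow> (nat \<Rightarrow> (real ^ 'n) set) monoid" where
  "kronecker_group L k =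
     product_group {p. prime p} (\<lambda>p. lattice_group L Mod multiples (p ^ k) L)"

definition kronecker_topology :: "(real ^ 'n) set \<Rightarrow> nat \<Rightarrow> (nat \<Rightarrow> (real ^ 'n) set) topology" where
  "kronecker_topology L k =
     product_topology
       (\<lambda>p. discrete_topology (carrier (lattice_group L Mod multiples (p ^ k) L))) {p. prime p}"

definition kronecker_measure :: "(real ^ 'n) set \<Rightarrow> nat \<Rightarrow> (nat \<Rightarrow> (real ^ 'n) set) measure" where
  "kronecker_measure L k = haar_measure (kronecker_group L k) (kronecker_topology L k)"

definition kronecker_action ::
  "(real ^ 'n) set \<Rightarrow> nat \<Rightarrow> real ^ 'n \<Rightarrow> (nat \<Rightarrow> (real ^ 'n) set) \<Rightarrow> nat \<Rightarrow> (real ^ 'n) set" where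
  "kronecker_action L k x g =
     g \<otimes>\<^bsub>kronecker_group L k\<^esub>
       (\<lambda>p\<in>{p. prime p}. multiples (p ^ k) L #>\<^bsub>lattice_group L\<^esub> x)"

end

theory Submission
  imports Defs
begin

text \<open>
  A point \<open>g\<close> of the Kronecker group is a choice of one coset \<open>g p\<close> of \<open>p\<^sup>k \<Lambda>\<close> for every prime \<open>p\<close>, and
  removing all these cosets from \<open>\<Lambda>\<close> leaves a set \<open>sifted g\<close>; this map commutes with the
  translations and sends \<open>0\<close> to \<open>V\<close>. The primes \<open>p \<ge> N\<close> strike a given point with density at most the
  tail of the series of \<open>p\<^sup>-\<^sup>n\<^sup>k\<close>, which converges because \<open>n k \<ge> 2\<close>. Hence patterns of \<open>V\<close> are
  approximated in density by periodic ones, and the image of Haar measure is the frequency measure.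
  For almost every \<open>g\<close> the sifted set meets all cosets of \<open>p\<^sup>k \<Lambda>\<close> other than \<open>g p\<close>, so \<open>g\<close> can be read
  off from it and the two systems are isomorphic. Ergodicity, zero entropy and the eigenfunctions are
  then those of a group rotation. The characters of the Kronecker group have frequencies in the
  points of \<open>\<rat> \<Lambda>\<^sup>*\<close> with \<open>(k + 1)\<close>-free denominator, and expanding the Euler product of the periodic
  approximants shows that these are exactly the points with non-zero Fourier--Bohr coefficient.
\<close>

section \<open>Linear images of measurable sets\<close>

text \<open>Fixing residues at finitely many primes never stops a larger prime from striking a given
  point, so \<open>sifted\<close> is not continuous, and truncating to the primes below
  \<open>N\<close> is correct only off exceptional sets. These have to be bounded twice: in Haar
  measure, where independence of the coordinates and a union bound suffice
  (\<open>measure_late\<close>), and in density along growing balls (\<open>sieve\<close>). The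
  second bound is the delicate one, because for each radius all but finitely many moduli exceed it;
  a bounded counting error per modulus would already be fatal, so the error must be a multiple of
  \<open>weight q\<close> itself. Both topological spaces are treated as a
  \<open>cell_system\<close>: a finite window labels a point of the hull, finitely many residues
  label a point of the group. Measures, integrals and square-integrable functions are then compared
  on finite label sets, which also gives the uniqueness that the two measures require, being
  definite descriptions. Entropy vanishes because a word read along any finite set of translations
  is determined, up to a small mean proportion of errors, by one of a number of labels that does not
  depend on that set.\<close>

text \<open>The library has this only for a well-ordered index type, where shears are triangular; here
  the determinant of a shear comes from row operations instead.\<close>

lemma linear_image_cart:
  fixes f :: "real ^ 'n \<Rightarrow> real ^ 'n"
  assumes "linear f"
  shows "\<forall>S\<in>lmeasurable. f ` S \<in> lmeasurable \<and> measure lebesgue (f ` S) = \<bar>det (matrix f)\<bar> * measure lebesgue S"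
    (is "\<forall>S\<in>_. ?P f S")
proof (rule induct_linear_elementary[OF assms]; intro ballI)
  fix f g :: "real ^ 'n \<Rightarrow> real ^ 'n" and S :: "(real ^ 'n) set"
  assume fg: "linear f" "linear g" and f: "\<forall>S\<in>lmeasurable. ?P f S" and g: "\<forall>S\<in>lmeasurable. ?P g S"
    and S: "S \<in> lmeasurable"
  have "g ` S \<in> lmeasurable" using g S by blast
  with f g S have "f ` g ` S \<in> lmeasurable"
    "measure lebesgue (f ` g ` S) = \<bar>det (matrix f)\<bar> * (\<bar>det (matrix g)\<bar> * measure lebesgue S)" by simp_all
  then show "?P (f \<circ> g) S" using matrix_compose[OF fg(2,1)]
    by (metis (no_types, lifting) abs_mult det_mul image_comp mult.assoc)
next
  fix f :: "real ^ 'n \<Rightarrow> real ^ 'n" and i and S :: "(real ^ 'n) set"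
  assume f: "linear f" "\<And>x. f x $ i = 0" and S: "S \<in> lmeasurable"
  have "negligible {x :: real ^ 'n. x $ i = 0}" by (rule negligible_standard_hyperplane_cart)
  then have "negligible (f ` S)" by (rule negligible_subset) (use f in auto)
  moreover have "\<not> surj f" using f(2) by (metis surjD vec_component zero_neq_one)
  then have "det (matrix f) = 0" using det_nz_iff_inj[OF f(1)] linear_injective_imp_surjective[OF f(1)] by auto
  ultimately show "?P f S" by (auto simp: negligible_iff_measure)
next
  fix c :: "'n \<Rightarrow> real" and S :: "(real ^ 'n) set" assume S: "S \<in> lmeasurable"
  have "matrix (\<lambda>x. \<chi> i. c i * x $ i) = (\<chi> i j. if i = j then c i else 0)"
    by (auto simp: matrix_def axis_def vec_eq_iff)
  then have "det (matrix (\<lambda>x. \<chi> i. c i * x $ i)) = prod c UNIV"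
    by (subst det_diagonal) auto
  then show "?P (\<lambda>x. \<chi> i. c i * x $ i) S" using measurable_stretch[OF S, of c] measure_stretch[OF S, of c] by simp
next
  fix m n :: 'n and S :: "(real ^ 'n) set" assume mn: "m \<noteq> n" and S: "S \<in> lmeasurable"
  define s where "s = Transposition.transpose m n"
  define h :: "real ^ 'n \<Rightarrow> real ^ 'n" where "h = (\<lambda>x. \<chi> i. x $ s i)"
  have s: "s permutes UNIV" "s \<circ> s = id" by (auto simp: s_def permutes_swap_id)
  have hh: "h (h x) = x" for x using s(2) by (simp add: h_def vec_eq_iff fun_eq_iff)
  have lin: "linear h" by (rule linearI) (simp_all add: h_def vec_eq_iff)
  have "h ` cbox a b = cbox (h a) (h b)" for a b
  proof -
    have "x \<in> cbox a b \<longleftrightarrow> h x \<in> cbox (h a) (h b)" for x a b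
      using permutes_univ[THEN iffD1, OF s(1)] by (auto simp: h_def mem_box_cart) metis+
    then show ?thesis using hh by (metis (no_types, lifting) equalityI image_eqI image_subsetI subsetI)
  qed
  moreover have "measure lebesgue (cbox (h a) (h b)) = measure lebesgue (cbox a b)" for a b
  proof (cases "cbox a b = {}")
    case True
    then show ?thesis using calculation[of a b] by (metis image_empty)
  next
    case False
    then have "cbox (h a) (h b) \<noteq> {}" using calculation[of a b] by (metis image_is_empty)
    then show ?thesis using False prod.permute[OF s(1), of "\<lambda>i. b $ i - a $ i"]
      by (simp add: content_cbox_cart h_def o_def)
  qed
  ultimately have meq: "measure lebesgue (h ` cbox a b) = 1 * measure lebesgue (cbox a b)" for a b by simp
  have "matrix h = (\<chi> i. mat 1 $ s i)"
    using s by (auto simp: matrix_def h_def axis_def mat_def vec_eq_iff)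
  then have "\<bar>det (matrix h)\<bar> = 1"
    using det_permute_rows[OF s(1), of "mat 1 :: real ^ 'n ^ 'n"] mn by (simp add: s_def sign_swap_id)
  then show "?P (\<lambda>x. \<chi> i. x $ Transposition.transpose m n i) S"
    using measure_linear_sufficient[OF lin S meq] by (simp add: h_def s_def)
next
  fix m n :: 'n and S :: "(real ^ 'n) set" assume mn: "m \<noteq> n" and S: "S \<in> lmeasurable"
  define h :: "real ^ 'n \<Rightarrow> real ^ 'n" where "h = (\<lambda>x. \<chi> i. if i = m then x $ m + x $ n else x $ i)"
  have lin: "linear h" by (rule linearI) (auto simp: h_def vec_eq_iff algebra_simps)
  have meq: "measure lebesgue (h ` cbox a b) = 1 * measure lebesgue (cbox a b)" for a b
  proof (cases "cbox a b = {}")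
    case False
    \<comment> \<open>The shear formula for boxes asks for a lower corner with nonnegative
      \<open>n\<close>-th coordinate. Subtracting \<open>w\<close> makes that coordinate zero, and
      translation invariance restores the original box.\<close>
    define w :: "real ^ 'n" where "w = axis n (a $ n)"
    have eq: "cbox a b = (+) w ` cbox (a - w) (b - w)" by (simp add: cbox_translation[symmetric])
    then have ne: "cbox (a - w) (b - w) \<noteq> {}" using False by (metis image_empty)
    have "h ` cbox a b = (+) (h w) ` h ` cbox (a - w) (b - w)"
      unfolding eq by (simp add: image_image linear_add[OF lin])
    then have "measure lebesgue (h ` cbox a b) = measure lebesgue (h ` cbox (a - w) (b - w))"
      by (simp add: measure_translation)
    also have "\<dots> = measure lebesgue (cbox (a - w) (b - w))"
      unfolding h_def by (rule measure_shear_interval[OF mn ne]) (simp add: w_def)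
    also have "\<dots> = measure lebesgue (cbox a b)" unfolding eq by (rule measure_translation[symmetric])
    finally show ?thesis by simp
  qed simp
  have "matrix h = (\<chi> k. if k = m then row m (mat 1) + 1 *s row n (mat 1) else row k (mat 1))"
    by (auto simp: matrix_def h_def axis_def mat_def row_def vec_eq_iff)
  then have "det (matrix h) = 1" by (simp add: det_row_operation mn)
  then show "?P (\<lambda>x. \<chi> i. if i = m then x $ m + x $ n else x $ i) S"
    using measure_linear_sufficient[OF lin S meq] by (simp add: h_def)
qed

lemma measurable_linear_image_cart:
  fixes f :: "real ^ 'n \<Rightarrow> real ^ 'n"
  shows "linear f \<Longrightarrow> S \<in> lmeasurable \<Longrightarrow> f ` S \<in> lmeasurable"
  using linear_image_cart by blast

lemma measure_linear_image_cart:
  fixes f :: "real ^ 'n \<Rightarrow> real ^ 'n"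
  shows "linear f \<Longrightarrow> S \<in> lmeasurable \<Longrightarrow> measure lebesgue (f ` S) = \<bar>det (matrix f)\<bar> * measure lebesgue S"
  using linear_image_cart by blast


section \<open>Counting lattice points\<close>

definition combination :: "real ^ 'n ^ 'n \<Rightarrow> real ^ 'n \<Rightarrow> real ^ 'n" where
  "combination B c = (\<Sum>i\<in>UNIV. c $ i *\<^sub>R B $ i)"

lemma combination_eq: "combination B c = transpose B *v c"
  by (simp add: combination_def matrix_vector_mult_def transpose_def vec_eq_iff mult.commute)

lemma linear_combination: "linear (combination B)"
  unfolding combination_eq by (rule matrix_vector_mul_linear)

lemma det_combination: "det (matrix (combination B)) = det B"
  unfolding combination_eq by (simp add: det_transpose)

lemma content_unit_cubes: "measure lborel (cbox (0 :: real ^ 'n) 1) = 1" "measure lborel (box (0 :: real ^ 'n) 1) = 1"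
proof -
  have "(1 :: real ^ 'n) \<bullet> i = 1" if "i \<in> Basis" for i
    using that by (auto simp: Basis_vec_def inner_axis)
  then show "measure lborel (cbox (0 :: real ^ 'n) 1) = 1" "measure lborel (box (0 :: real ^ 'n) 1) = 1"
    by (simp_all add: measure_lborel_box_eq measure_lborel_cbox_eq)
qed

lemma unit_ball_pos: "measure lborel (ball (0 :: real ^ 'n) 1) > 0"
  by (rule content_ball_pos) simp

lemma cis_2pi_int: "r \<in> \<int> \<Longrightarrow> cis (2 * pi * r) = 1"
  by (auto elim!: Ints_cases simp: cis_multiple_2pi)

lemma cis_2pi_eq_1_iff: "cis (2 * pi * r) = 1 \<longleftrightarrow> r \<in> \<int>"
proof
  assume "cis (2 * pi * r) = 1"
  then have "cos (2 * pi * r) = 1" by (simp add: complex_eq_iff)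
  then obtain n where "2 * pi * r = real_of_int n * 2 * pi" by (auto simp: cos_one_2pi_int)
  then show "r \<in> \<int>" by simp
qed (rule cis_2pi_int)

lemma has_density_unique: "has_density Y c \<Longrightarrow> has_density Y d \<Longrightarrow> c = (d :: real)"
  unfolding has_density_def by (rule tendsto_unique[OF trivial_limit_at_top_linorder])

locale unimodular_lattice =
  fixes L :: "(real ^ 'n) set" and B :: "real ^ 'n ^ 'n"
  assumes basis: "lattice_basis L B" and unimodular: "\<bar>det B\<bar> = 1"
begin

lemma vol_pos: "R > 0 \<Longrightarrow> ball_vol TYPE('n) R > 0"
  unfolding ball_vol_def using unit_ball_pos by simp

lemma vol_nonneg: "R \<ge> 0 \<Longrightarrow> ball_vol TYPE('n) R \<ge> 0"
  unfolding ball_vol_def by simp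

lemma vol_eq: "R \<ge> 0 \<Longrightarrow> measure lebesgue (ball (c :: real ^ 'n) R) = ball_vol TYPE('n) R"
  using content_ball_conv_unit_ball[of R c] by (simp add: ball_vol_def mult.commute)

text \<open>A bounded change of the radius disappears in the limit; this absorbs the errors
  \<open>cell_diam\<close> in the point counts.\<close>

lemma vol_scale_limit:
  assumes "m > 0"
  shows "((\<lambda>R. ball_vol TYPE('n) (R / m + s) / ball_vol TYPE('n) R) \<longlongrightarrow> 1 / m ^ CARD('n)) at_top"
proof -
  have "((\<lambda>R. 1 / m + s / R) \<longlongrightarrow> 1 / m + 0) at_top"
    by (intro tendsto_intros tendsto_divide_0[OF tendsto_const] filterlim_at_top_imp_at_infinity filterlim_ident)
  then have "((\<lambda>R. (1 / m + s / R) ^ CARD('n)) \<longlongrightarrow> (1 / m + 0) ^ CARD('n)) at_top"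
    by (rule tendsto_power)
  moreover have "\<forall>\<^sub>F R in at_top. (1 / m + s / R) ^ CARD('n) = ball_vol TYPE('n) (R / m + s) / ball_vol TYPE('n) R"
    using eventually_gt_at_top[of 0]
  proof eventually_elim
    case (elim R)
    have "ball_vol TYPE('n) (R / m + s) / ball_vol TYPE('n) R = ((R / m + s) / R) ^ CARD('n)"
      using unit_ball_pos elim by (simp add: ball_vol_def power_divide)
    also have "(R / m + s) / R = 1 / m + s / R" using elim assms by (simp add: field_simps)
    finally show ?case by simp
  qed
  ultimately show ?thesis using assms by (auto simp: power_one_over intro: Lim_transform_eventually)
qed

lemma L_eq: "L = combination B ` {c. \<forall>i. c $ i \<in> \<int>}"
proof -
  have "L = range (\<lambda>c :: 'n \<Rightarrow> int. \<Sum>i\<in>UNIV. of_int (c i) *\<^sub>R B $ i)"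
    using basis by (simp add: lattice_basis_def)
  also have "\<dots> = combination B ` range (\<lambda>c :: 'n \<Rightarrow> int. \<chi> i. of_int (c i))"
    by (simp add: image_image combination_def)
  also have "range (\<lambda>c :: 'n \<Rightarrow> int. (\<chi> i. of_int (c i)) :: real ^ 'n) = {c. \<forall>i. c $ i \<in> \<int>}"
  proof (intro equalityI subsetI)
    fix c :: "real ^ 'n" assume "c \<in> {c. \<forall>i. c $ i \<in> \<int>}"
    then have "c = (\<chi> i. of_int \<lfloor>c $ i\<rfloor>)" by (auto simp: vec_eq_iff)
    then show "c \<in> range (\<lambda>c :: 'n \<Rightarrow> int. \<chi> i. of_int (c i))"
      by (intro image_eqI[where x = "\<lambda>i. \<lfloor>c $ i\<rfloor>"]) auto
  qed (auto intro: Ints_of_int)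
  finally show ?thesis .
qed

lemma inj_combination: "inj (combination B)"
  using det_nz_iff_inj[OF linear_combination, of B] unimodular by (auto simp: det_combination)

lemma surj_combination: "surj (combination B)"
  using linear_injective_imp_surjective[OF linear_combination inj_combination] by simp

lemma zero_in: "0 \<in> L"
  unfolding L_eq by (rule image_eqI[where x = 0]) (auto simp: combination_def)

lemma add_in: "x \<in> L \<Longrightarrow> y \<in> L \<Longrightarrow> x + y \<in> L"
  unfolding L_eq by (auto simp: linear_add[OF linear_combination, symmetric])

lemma minus_in: "x \<in> L \<Longrightarrow> - x \<in> L"
  unfolding L_eq by (auto simp: linear_neg[OF linear_combination, symmetric])

lemma diff_in: "x \<in> L \<Longrightarrow> y \<in> L \<Longrightarrow> x - y \<in> L"
  using add_in[of x "- y"] minus_in[of y] by simp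

lemma diff_in_iff: "t \<in> L \<Longrightarrow> x - t \<in> L \<longleftrightarrow> x \<in> L"
  using add_in[of "x - t" t] diff_in[of x t] by auto

lemma scaleR_in: "x \<in> L \<Longrightarrow> real m *\<^sub>R x \<in> L"
  by (induction m) (auto simp: zero_in scaleR_left_distrib intro: add_in)

lemma scaleR_int_in: "x \<in> L \<Longrightarrow> of_int m *\<^sub>R x \<in> L"
  using scaleR_in[of x "nat \<bar>m\<bar>"] minus_in[of "real (nat \<bar>m\<bar>) *\<^sub>R x"]
  by (cases "m \<ge> 0") auto

text \<open>The summand 1 makes the estimate of the points of a cell strict, so that cells fit into
  open balls.\<close>

definition cell_diam :: real where
  "cell_diam = 1 + (\<Sum>i\<in>UNIV. norm (B $ i))"

lemma cell_diam_ge_1: "cell_diam \<ge> 1"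
  by (simp add: cell_diam_def sum_nonneg)

lemma norm_combination_less:
  assumes "\<And>i. 0 \<le> c $ i \<and> c $ i \<le> 1"
  shows "norm (combination B c) < cell_diam"
proof -
  have "norm (combination B c) \<le> (\<Sum>i\<in>UNIV. norm (c $ i *\<^sub>R B $ i))"
    unfolding combination_def by (rule norm_sum)
  also have "\<dots> \<le> (\<Sum>i\<in>UNIV. norm (B $ i))"
    using assms by (intro sum_mono) (auto simp: mult_left_le_one_le)
  finally show ?thesis by (simp add: cell_diam_def)
qed

text \<open>Open cells are pairwise disjoint and bound the number of lattice points from above;
  closed cells cover the space and bound it from below. With both at hand nothing has to be said
  about the boundary.\<close>

definition open_cell :: "(real ^ 'n) \<Rightarrow> (real ^ 'n) set" where
  "open_cell x = (+) x ` combination B ` box 0 1"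

definition closed_cell :: "(real ^ 'n) \<Rightarrow> (real ^ 'n) set" where
  "closed_cell x = (+) x ` combination B ` cbox 0 1"

lemma open_cell_lmeasurable: "open_cell x \<in> lmeasurable"
  unfolding open_cell_def
  by (intro measurable_translation measurable_linear_image_cart[OF linear_combination] lmeasurable_box)

lemma measure_open_cell: "measure lebesgue (open_cell x) = 1"
  using measure_linear_image_cart[OF linear_combination lmeasurable_box, of B 0 1] unimodular
  by (simp add: open_cell_def measure_translation det_combination content_unit_cubes)

lemma closed_cell_lmeasurable: "closed_cell x \<in> lmeasurable"
  unfolding closed_cell_def
  by (intro measurable_translation measurable_linear_image_cart[OF linear_combination] lmeasurable_cbox)

lemma measure_closed_cell: "measure lebesgue (closed_cell x) = 1"
  using measure_linear_image_cart[OF linear_combination lmeasurable_cbox, of B 0 1] unimodular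
  by (simp add: closed_cell_def measure_translation det_combination content_unit_cubes)

lemma open_cell_subset: "open_cell x \<subseteq> ball x cell_diam"
  using norm_combination_less by (fastforce simp: open_cell_def mem_box_cart dist_norm less_imp_le)

lemma closed_cell_subset: "closed_cell x \<subseteq> ball x cell_diam"
  using norm_combination_less by (fastforce simp: closed_cell_def mem_box_cart dist_norm)

lemma open_cells_disjoint:
  assumes "x \<in> L" "y \<in> L" "x \<noteq> y"
  shows "disjnt (open_cell x) (open_cell y)"
proof (rule ccontr)
  assume "\<not> ?thesis"
  then obtain a b where ab: "a \<in> box 0 1" "b \<in> box 0 1" "x + combination B a = y + combination B b"
    by (auto simp: disjnt_def open_cell_def)
  obtain u v where uv: "x = combination B u" "y = combination B v" "\<forall>i. u $ i \<in> \<int>" "\<forall>i. v $ i \<in> \<int>"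
    using assms by (auto simp: L_eq)
  have "combination B (u + a) = combination B (v + b)"
    using ab uv by (simp add: linear_add[OF linear_combination])
  then have eq: "u + a = v + b" using inj_combination by (simp add: inj_eq)
  have "u $ i = v $ i" for i
  proof -
    have "u $ i + a $ i = v $ i + b $ i" using eq by (metis vector_add_component)
    moreover have "0 < a $ i" "a $ i < 1" "0 < b $ i" "b $ i < 1" using ab by (auto simp: mem_box_cart)
    moreover obtain m n where "u $ i = of_int m" "v $ i = of_int n" using uv by (meson Ints_cases)
    ultimately have "real_of_int m < of_int n + 1" "real_of_int n < of_int m + 1" by linarith+
    then show ?thesis using \<open>u $ i = of_int m\<close> \<open>v $ i = of_int n\<close> by simp
  qed
  then have "u = v" by (simp add: vec_eq_iff)
  then show False using uv assms by simp
qed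

lemma closed_cells_cover:
  obtains x where "x \<in> L" "z \<in> closed_cell x"
proof -
  obtain c where c: "z = combination B c" using surj_combination by (metis surjD)
  define f :: "real ^ 'n" where "f = (\<chi> i. of_int \<lfloor>c $ i\<rfloor>)"
  have "combination B f \<in> L" by (auto simp: L_eq f_def)
  moreover have "z = combination B f + combination B (c - f)"
    by (simp add: c linear_add[OF linear_combination, symmetric])
  moreover have "c - f \<in> cbox 0 1"
    by (auto simp: mem_box_cart f_def) linarith
  ultimately show ?thesis using that by (auto simp: closed_cell_def)
qed


text \<open>Packing: disjoint cells of volume one attached to the points of a ball lie in a ball
  enlarged by \<open>cell_diam\<close>. The count runs over finite subsets \<open>G\<close>, since
  finiteness is itself a consequence of the uniform bound on their sizes.\<close>

lemma finite_ball: "finite (L \<inter> ball c R)"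
  and card_ball_le: "R \<ge> 0 \<Longrightarrow> real (card (L \<inter> ball c R)) \<le> ball_vol TYPE('n) (R + cell_diam)"
proof -
  have *: "finite (L \<inter> ball c R) \<and> real (card (L \<inter> ball c R)) \<le> ball_vol TYPE('n) (R + cell_diam)" if "R \<ge> 0" for R
  proof -
    have "card G \<le> nat \<lfloor>ball_vol TYPE('n) (R + cell_diam)\<rfloor>" if G: "G \<subseteq> L \<inter> ball c R" "finite G" for G
    proof -
      have "real (card G) = (\<Sum>x\<in>G. measure lebesgue (open_cell x))" by (simp add: measure_open_cell)
      also have "\<dots> = measure lebesgue (\<Union>x\<in>G. open_cell x)"
        using G open_cells_disjoint open_cell_lmeasurable
        by (intro measure_UNION'[symmetric]) (auto simp: pairwise_def)
      also have "\<dots> \<le> measure lebesgue (ball c (R + cell_diam))"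
      proof (rule measure_mono_fmeasurable)
        show "(\<Union>x\<in>G. open_cell x) \<subseteq> ball c (R + cell_diam)"
        proof (safe)
          fix x z assume "x \<in> G" "z \<in> open_cell x"
          then have "dist c x < R" "dist x z < cell_diam" using G open_cell_subset[of x] by auto
          then show "z \<in> ball c (R + cell_diam)" using dist_triangle[of c z x] by simp
        qed
        show "(\<Union>x\<in>G. open_cell x) \<in> sets lebesgue"
          using G open_cell_lmeasurable by (intro sets.finite_UN) auto
      qed auto
      also have "\<dots> = ball_vol TYPE('n) (R + cell_diam)" using \<open>R \<ge> 0\<close> cell_diam_ge_1 by (intro vol_eq) simp
      finally show ?thesis by linarith
    qed
    then have "finite (L \<inter> ball c R) \<and> card (L \<inter> ball c R) \<le> nat \<lfloor>ball_vol TYPE('n) (R + cell_diam)\<rfloor>"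
      by (rule finite_if_finite_subsets_card_bdd)
    moreover have "ball_vol TYPE('n) (R + cell_diam) \<ge> 0" using \<open>R \<ge> 0\<close> cell_diam_ge_1 by (intro vol_nonneg) simp
    ultimately show ?thesis by linarith
  qed
  then show "R \<ge> 0 \<Longrightarrow> real (card (L \<inter> ball c R)) \<le> ball_vol TYPE('n) (R + cell_diam)" by simp
  show "finite (L \<inter> ball c R)" using *[of R] by (cases "R \<ge> 0") (simp_all add: ball_empty)
qed

text \<open>Covering: a point of the smaller ball lies in a closed cell whose base point is less
  than \<open>cell_diam\<close> away, hence inside the larger ball.\<close>

lemma card_ball_ge:
  assumes "R \<ge> cell_diam"
  shows "real (card (L \<inter> ball c R)) \<ge> ball_vol TYPE('n) (R - cell_diam)"
proof -
  have "ball_vol TYPE('n) (R - cell_diam) = measure lebesgue (ball c (R - cell_diam))"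
    using assms by (intro vol_eq[symmetric]) simp
  also have "\<dots> \<le> measure lebesgue (\<Union>x\<in>L \<inter> ball c R. closed_cell x)"
  proof (rule measure_mono_fmeasurable)
    show "ball c (R - cell_diam) \<subseteq> (\<Union>x\<in>L \<inter> ball c R. closed_cell x)"
    proof
      fix z assume z: "z \<in> ball c (R - cell_diam)"
      obtain x where x: "x \<in> L" "z \<in> closed_cell x" by (rule closed_cells_cover)
      then have "dist x z < cell_diam" using closed_cell_subset[of x] by auto
      then have "x \<in> ball c R" using z dist_triangle2[of c x z] by (simp add: dist_commute)
      then show "z \<in> (\<Union>x\<in>L \<inter> ball c R. closed_cell x)" using x by auto
    qed
    show "(\<Union>x\<in>L \<inter> ball c R. closed_cell x) \<in> lmeasurable"
      using finite_ball closed_cell_lmeasurable by (intro fmeasurable.finite_UN) auto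
  qed auto
  also have "\<dots> \<le> (\<Sum>x\<in>L \<inter> ball c R. measure lebesgue (closed_cell x))"
    using finite_ball closed_cell_lmeasurable by (intro measure_UNION_le) auto
  finally show ?thesis by (simp add: measure_closed_cell)
qed

text \<open>The three parameters serve different uses: \<open>m\<close> counts points of a
  sublattice, \<open>c\<close> accommodates a coset of it, and \<open>s\<close> measures boundary
  shells.\<close>

lemma card_ball_limit:
  assumes "m > 0"
  shows "((\<lambda>R. card (L \<inter> ball c (R / m + s)) / ball_vol TYPE('n) R) \<longlongrightarrow> 1 / m ^ CARD('n)) at_top"
proof (rule tendsto_sandwich)
  have large: "\<forall>\<^sub>F R in at_top. R > 0 \<and> R / m + s \<ge> cell_diam"
    using eventually_gt_at_top[of 0] eventually_ge_at_top[of "m * (cell_diam - s)"]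
    by eventually_elim (use assms in \<open>auto simp: field_simps\<close>)
  show "\<forall>\<^sub>F R in at_top. ball_vol TYPE('n) (R / m + (s - cell_diam)) / ball_vol TYPE('n) R \<le> card (L \<inter> ball c (R / m + s)) / ball_vol TYPE('n) R"
    using large
  proof eventually_elim
    case (elim R)
    then show ?case using card_ball_ge[of "R / m + s" c] vol_pos[of R]
      by (auto intro!: divide_right_mono simp: algebra_simps)
  qed
  show "\<forall>\<^sub>F R in at_top. card (L \<inter> ball c (R / m + s)) / ball_vol TYPE('n) R \<le> ball_vol TYPE('n) (R / m + (s + cell_diam)) / ball_vol TYPE('n) R"
    using large
  proof eventually_elim
    case (elim R)
    then show ?case using card_ball_le[of "R / m + s" c] vol_pos[of R] cell_diam_ge_1
      by (auto intro!: divide_right_mono simp: algebra_simps)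
  qed
qed (rule vol_scale_limit[OF assms])+

text \<open>Below the length \<open>r0\<close> there is no nonzero lattice point to count, and
  beyond it the additive error \<open>cell_diam\<close> is at most \<open>cell_diam / r0\<close>
  times the radius. A pure power of the radius results, valid also for small radii, which is what
  makes the counts summable over infinitely many moduli.\<close>

lemma card_punctured_ball_le:
  obtains K where "K > 0" "\<And>r :: real. r \<ge> 0 \<Longrightarrow> real (card (L \<inter> ball 0 r - {0})) \<le> K * r ^ CARD('n)"
proof -
  have fin: "finite (norm ` (L \<inter> ball 0 1 - {0}))" using finite_ball by auto
  \<comment> \<open>The inserted 1 provides a minimum when no nonzero lattice point is shorter than
    1.\<close>
  define r0 where "r0 = Min (insert 1 (norm ` (L \<inter> ball 0 1 - {0})))"
  have r0: "r0 > 0" unfolding r0_def using fin by (subst Min_gr_iff) auto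
  have r0_le: "r0 \<le> norm x" if "x \<in> L" "x \<noteq> 0" for x
  proof (cases "norm x < 1")
    case True then show ?thesis unfolding r0_def using fin that by (intro Min_le) auto
  next
    case False
    moreover have "r0 \<le> 1" unfolding r0_def using fin by (intro Min_le) auto
    ultimately show ?thesis by simp
  qed
  define K where "K = ball_vol TYPE('n) (1 + cell_diam / r0)"
  have K: "K > 0" unfolding K_def using r0 cell_diam_ge_1 by (intro vol_pos) (simp add: add_pos_nonneg)
  have "real (card (L \<inter> ball 0 r - {0})) \<le> K * r ^ CARD('n)" if "r \<ge> 0" for r
  proof (cases "r \<le> r0")
    case True
    then have "L \<inter> ball 0 r - {0} = {}" using r0_le by force
    then have "card (L \<inter> ball 0 r - {0}) = 0" by (metis card.empty)
    then show ?thesis using K that by simp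
  next
    case False
    have "real (card (L \<inter> ball 0 r - {0})) \<le> card (L \<inter> ball 0 r)"
      using finite_ball by (intro of_nat_mono card_mono) auto
    also have "\<dots> \<le> ball_vol TYPE('n) (r + cell_diam)" using card_ball_le that by simp
    also have "\<dots> \<le> ball_vol TYPE('n) ((1 + cell_diam / r0) * r)"
    proof -
      have "cell_diam * r0 \<le> cell_diam * r" using False cell_diam_ge_1 by (intro mult_left_mono) auto
      then have "r + cell_diam \<le> (1 + cell_diam / r0) * r" using r0 by (simp add: field_simps)
      then show ?thesis unfolding ball_vol_def using that cell_diam_ge_1 unit_ball_pos
        by (intro mult_left_mono power_mono) auto
    qed
    also have "\<dots> = K * r ^ CARD('n)" by (simp add: K_def ball_vol_def power_mult_distrib)
    finally show ?thesis .
  qed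
  then show ?thesis using that[OF K] by blast
qed

lemma countable_L: "countable L"
proof -
  have "L = (\<Union>N :: nat. L \<inter> ball 0 (real N))"
    using reals_Archimedean2 by fastforce
  then show ?thesis by (metis countable_UN countable_finite finite_ball uncountable_def countableI_type)
qed

subsection \<open>Means over balls\<close>

text \<open>Complex values let densities and Fourier coefficients be treated together. Division is
  by the volume rather than by the number of points, which is harmless at covolume one.\<close>

definition has_mean :: "(real ^ 'n \<Rightarrow> complex) \<Rightarrow> complex \<Rightarrow> bool" where
  "has_mean a c \<longleftrightarrow> ((\<lambda>R. (\<Sum>x\<in>L \<inter> ball 0 R. a x) / of_real (ball_vol TYPE('n) R)) \<longlongrightarrow> c) at_top"

lemma has_mean_unique: "has_mean a c \<Longrightarrow> has_mean a d \<Longrightarrow> c = d"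
  unfolding has_mean_def by (rule tendsto_unique[OF trivial_limit_at_top_linorder])

lemma has_mean_cong: "(\<And>x. x \<in> L \<Longrightarrow> a x = b x) \<Longrightarrow> has_mean a c \<longleftrightarrow> has_mean b c"
  unfolding has_mean_def by (intro tendsto_cong always_eventually allI) (auto intro!: arg_cong2[where f = "(/)"] sum.cong)

lemma has_mean_add: "has_mean a c \<Longrightarrow> has_mean b d \<Longrightarrow> has_mean (\<lambda>x. a x + b x) (c + d)"
  unfolding has_mean_def by (simp add: sum.distrib add_divide_distrib tendsto_add)

lemma has_mean_cmult: "has_mean a c \<Longrightarrow> has_mean (\<lambda>x. b * a x) (b * c)"
  unfolding has_mean_def
  by (simp add: sum_distrib_left[symmetric] tendsto_mult_left times_divide_eq_right[symmetric] del: times_divide_eq_right)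

lemma has_mean_0: "has_mean (\<lambda>_. 0) 0"
  by (simp add: has_mean_def)

lemma has_mean_sum:
  "finite I \<Longrightarrow> (\<And>i. i \<in> I \<Longrightarrow> has_mean (a i) (c i)) \<Longrightarrow> has_mean (\<lambda>x. \<Sum>i\<in>I. a i x) (\<Sum>i\<in>I. c i)"
  by (induction I rule: finite_induct) (auto simp: has_mean_0 intro!: has_mean_add)

lemma has_density_iff:
  assumes "Y \<subseteq> L"
  shows "has_density Y d \<longleftrightarrow> has_mean (\<lambda>x. of_bool (x \<in> Y)) (of_real d)"
proof -
  have "(\<Sum>x\<in>L \<inter> ball 0 R. of_bool (x \<in> Y) :: complex) = of_real (card (Y \<inter> ball 0 R))" for R
  proof -
    have "(\<Sum>x\<in>L \<inter> ball 0 R. of_bool (x \<in> Y) :: complex) = (\<Sum>x\<in>Y \<inter> ball 0 R. 1)"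
      using assms finite_ball by (intro sum.mono_neutral_cong_right) auto
    then show ?thesis by simp
  qed
  then have "has_mean (\<lambda>x. of_bool (x \<in> Y)) (of_real d) \<longleftrightarrow>
      ((\<lambda>R. of_real (card (Y \<inter> ball 0 R) / ball_vol TYPE('n) R) :: complex) \<longlongrightarrow> of_real d) at_top"
    by (simp add: has_mean_def)
  then show ?thesis by (simp only: has_density_def tendsto_of_real_iff)
qed

lemma has_mean_1: "has_mean (\<lambda>_. 1) 1"
proof -
  have "has_density L 1"
    unfolding has_density_def using card_ball_limit[of 1 0 0] by simp
  then have "has_mean (\<lambda>x. of_bool (x \<in> L)) 1" by (simp add: has_density_iff)
  then show ?thesis by (subst has_mean_cong[where b = "\<lambda>x. of_bool (x \<in> L)"]) auto
qed

text \<open>An exchange of limits by three epsilons. The error bound \<open>e N\<close> need only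
  hold for radii beyond a threshold depending on \<open>N\<close>; this is the form in which the
  sieve supplies it.\<close>

lemma has_mean_approximation:
  assumes "\<And>N. has_mean (a N) (c N)" "c \<longlonglongrightarrow> d"
    and err: "\<And>N. \<forall>\<^sub>F R in at_top. (\<Sum>x\<in>L \<inter> ball 0 R. cmod (b x - a N x)) / ball_vol TYPE('n) R \<le> e N"
    and e: "e \<longlonglongrightarrow> 0"
  shows "has_mean b d"
  unfolding has_mean_def
proof (rule tendstoI)
  fix \<epsilon> :: real assume "\<epsilon> > 0"
  have "\<forall>\<^sub>F N in sequentially. dist (e N) 0 < \<epsilon> / 3"
    by (rule tendstoD[OF e]) (use \<open>\<epsilon> > 0\<close> in simp)
  moreover have "\<forall>\<^sub>F N in sequentially. dist (c N) d < \<epsilon> / 3"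
    by (rule tendstoD[OF assms(2)]) (use \<open>\<epsilon> > 0\<close> in simp)
  ultimately have "\<forall>\<^sub>F N in sequentially. dist (e N) 0 < \<epsilon> / 3 \<and> dist (c N) d < \<epsilon> / 3"
    by (rule eventually_conj)
  then obtain N where N: "dist (e N) 0 < \<epsilon> / 3" "dist (c N) d < \<epsilon> / 3"
    by (auto dest: eventually_happens)
  then have N': "e N < \<epsilon> / 3" by (simp add: dist_real_def)
  have "\<forall>\<^sub>F R in at_top. dist ((\<Sum>x\<in>L \<inter> ball 0 R. a N x) / of_real (ball_vol TYPE('n) R)) (c N) < \<epsilon> / 3"
    using assms(1)[of N] \<open>\<epsilon> > 0\<close> unfolding has_mean_def by (intro tendstoD) auto
  then show "\<forall>\<^sub>F R in at_top. dist ((\<Sum>x\<in>L \<inter> ball 0 R. b x) / of_real (ball_vol TYPE('n) R)) d < \<epsilon>"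
    using err[of N] eventually_gt_at_top[of 0]
  proof eventually_elim
    case (elim R)
    have "dist ((\<Sum>x\<in>L \<inter> ball 0 R. b x) / of_real (ball_vol TYPE('n) R)) ((\<Sum>x\<in>L \<inter> ball 0 R. a N x) / of_real (ball_vol TYPE('n) R))
        = cmod (\<Sum>x\<in>L \<inter> ball 0 R. b x - a N x) / ball_vol TYPE('n) R"
      using vol_pos[OF elim(3)]
      by (simp add: dist_norm sum_subtractf diff_divide_distrib[symmetric] norm_divide)
    also have "\<dots> \<le> (\<Sum>x\<in>L \<inter> ball 0 R. cmod (b x - a N x)) / ball_vol TYPE('n) R"
      using vol_pos[OF elim(3)] by (intro divide_right_mono norm_sum) auto
    also have "\<dots> < \<epsilon> / 3" using elim N' by linarith
    finally have "dist ((\<Sum>x\<in>L \<inter> ball 0 R. b x) / of_real (ball_vol TYPE('n) R)) ((\<Sum>x\<in>L \<inter> ball 0 R. a N x) / of_real (ball_vol TYPE('n) R)) < \<epsilon> / 3" .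
    then show ?case using elim(1) N(2)
        dist_triangle[of "(\<Sum>x\<in>L \<inter> ball 0 R. b x) / of_real (ball_vol TYPE('n) R)" d "(\<Sum>x\<in>L \<inter> ball 0 R. a N x) / of_real (ball_vol TYPE('n) R)"]
        dist_triangle[of "(\<Sum>x\<in>L \<inter> ball 0 R. a N x) / of_real (ball_vol TYPE('n) R)" d "c N"] by linarith
  qed
qed

lemma boundary_limit:
  assumes "s \<ge> 0"
  shows "((\<lambda>R. (real (card (L \<inter> ball 0 (R + s))) - card (L \<inter> ball 0 (R - s))) / ball_vol TYPE('n) R) \<longlongrightarrow> 0) at_top"
  using tendsto_diff[OF card_ball_limit[of 1 0 s] card_ball_limit[of 1 0 "- s"]] by (simp add: diff_divide_distrib)

text \<open>Shifting the summand amounts to summing over a shifted ball, and the two balls differ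
  only in a spherical shell of half-width \<open>norm s\<close>.\<close>

lemma sum_shift_le:
  assumes "s \<in> L" "\<And>x. x \<in> L \<Longrightarrow> cmod (a x) \<le> 1" "S = L \<inter> ball 0 R"
  shows "cmod ((\<Sum>x\<in>S. a (x + s)) - (\<Sum>x\<in>S. a x)) \<le> real (card (L \<inter> ball 0 (R + norm s))) - card (L \<inter> ball 0 (R - norm s))"
proof -
  define T where "T = L \<inter> ball s R"
  have T: "T = (\<lambda>x. x + s) ` S"
  proof (intro equalityI subsetI)
    fix x assume "x \<in> T"
    then show "x \<in> (\<lambda>x. x + s) ` S"
      using assms(1) by (intro image_eqI[where x = "x - s"]) (auto simp: T_def assms(3) dist_norm norm_minus_commute intro: diff_in)
  qed (use assms(1) in \<open>auto simp: T_def assms(3) dist_norm intro: add_in\<close>)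
  have fin: "finite S" "finite T" using finite_ball by (auto simp: T_def assms(3))
  have eq: "(\<Sum>x\<in>S. a (x + s)) = sum a T" unfolding T by (subst sum.reindex) (auto simp: inj_on_def)
  have "sum a T - sum a S = sum a (T - S) - sum a (S - T)"
    using sum.Int_Diff[OF fin(1), of a T] sum.Int_Diff[OF fin(2), of a S] by (simp add: Int_commute)
  also have "cmod \<dots> \<le> cmod (sum a (T - S)) + cmod (sum a (S - T))" by (rule norm_triangle_ineq4)
  also have "\<dots> \<le> (\<Sum>x\<in>T - S. 1) + (\<Sum>x\<in>S - T. 1)"
    by (intro add_mono sum_norm_le) (use assms(2) in \<open>auto simp: T_def assms(3)\<close>)
  also have "\<dots> = real (card ((T - S) \<union> (S - T)))" using fin by (subst card_Un_disjoint) auto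
  also have "\<dots> \<le> card (L \<inter> ball 0 (R + norm s) - L \<inter> ball 0 (R - norm s))"
  proof (intro of_nat_mono card_mono)
    have "norm x < R + norm s" if "norm (s - x) < R" for x using that norm_triangle_ineq2[of x s] by (simp add: norm_minus_commute)
    moreover have "norm (s - x) < R" if "norm x < R - norm s" for x using that norm_triangle_ineq4[of s x] by simp
    ultimately show "(T - S) \<union> (S - T) \<subseteq> L \<inter> ball 0 (R + norm s) - L \<inter> ball 0 (R - norm s)"
      by (fastforce simp: T_def assms(3) dist_norm intro: order_less_le_trans)
  qed (use finite_ball in auto)
  also have "\<dots> = real (card (L \<inter> ball 0 (R + norm s)) - card (L \<inter> ball 0 (R - norm s)))"
    using finite_ball subset_ball[of "R - norm s" "R + norm s" 0] by (subst card_Diff_subset) auto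
  also have "\<dots> = real (card (L \<inter> ball 0 (R + norm s))) - card (L \<inter> ball 0 (R - norm s))"
    using finite_ball subset_ball[of "R - norm s" "R + norm s" 0]
    by (intro of_nat_diff card_mono) auto
  finally show ?thesis by (simp add: eq)
qed

lemma shift_limit:
  assumes "s \<in> L" "\<And>x. x \<in> L \<Longrightarrow> cmod (a x) \<le> 1"
  shows "((\<lambda>R. ((\<Sum>x\<in>L \<inter> ball 0 R. a (x + s)) - (\<Sum>x\<in>L \<inter> ball 0 R. a x)) / of_real (ball_vol TYPE('n) R)) \<longlongrightarrow> 0) at_top"
proof (rule Lim_null_comparison[OF _ boundary_limit[of "norm s"]])
  show "\<forall>\<^sub>F R in at_top. norm (((\<Sum>x\<in>L \<inter> ball 0 R. a (x + s)) - (\<Sum>x\<in>L \<inter> ball 0 R. a x)) / of_real (ball_vol TYPE('n) R))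
    \<le> (real (card (L \<inter> ball 0 (R + norm s))) - card (L \<inter> ball 0 (R - norm s))) / ball_vol TYPE('n) R"
    using eventually_gt_at_top[of 0]
  proof eventually_elim
    case (elim R)
    show ?case using sum_shift_le[where R = R and a = a, OF assms refl] vol_pos[OF elim]
      by (auto simp: norm_divide intro!: divide_right_mono)
  qed
qed simp

text \<open>If \<open>y\<close> is not in the dual lattice, some shift \<open>s\<close> multiplies
  the exponential by a number \<open>w\<close> different from 1. Since shifting does not affect
  means asymptotically, \<open>w - 1\<close> times the averages tends to zero.\<close>

lemma has_mean_exponential:
  "has_mean (\<lambda>x. cis (2 * pi * (y \<bullet> x))) (if y \<in> dual_lattice L then 1 else 0)"
proof (cases "y \<in> dual_lattice L")
  case True
  then show ?thesis using has_mean_1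
    by (subst has_mean_cong[where b = "\<lambda>_. 1"]) (auto simp: dual_lattice_def cis_2pi_int)
next
  case False
  then obtain s where s: "s \<in> L" "y \<bullet> s \<notin> \<int>" by (auto simp: dual_lattice_def)
  define w where "w = cis (2 * pi * (y \<bullet> s))"
  have w: "w \<noteq> 1" using s by (simp add: w_def cis_2pi_eq_1_iff)
  have "((\<lambda>R. (w - 1) * ((\<Sum>x\<in>L \<inter> ball 0 R. cis (2 * pi * (y \<bullet> x))) / of_real (ball_vol TYPE('n) R))) \<longlongrightarrow> 0) at_top"
  proof -
    have "cis (2 * pi * (y \<bullet> (x + s))) = w * cis (2 * pi * (y \<bullet> x))" for x
      by (simp add: w_def cis_mult inner_add_right distrib_left add.commute)
    then show ?thesis using shift_limit[OF s(1), of "\<lambda>x. cis (2 * pi * (y \<bullet> x))"]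
      by (simp add: sum_distrib_left[symmetric] left_diff_distrib)
  qed
  from tendsto_mult_left[OF this, of "1 / (w - 1)"] show ?thesis
    using w False by (simp add: has_mean_def)
qed

end

section \<open>Cosets of multiples of the lattice\<close>

lemma coprime_prod_insert:
  assumes "finite P" "q \<notin> P" "pairwise (\<lambda>p q. coprime (f p) (f q)) (insert q P)"
  shows "coprime (\<Prod>p\<in>P. f p) (f q :: nat)"
  using assms by (intro prod_coprime_left) (auto simp: pairwise_def)

context unimodular_lattice
begin

definition coset :: "nat \<Rightarrow> real ^ 'n \<Rightarrow> (real ^ 'n) set" where
  "coset m x = (\<lambda>h. h + x) ` multiples m L"

lemma multiples_subset: "multiples m L \<subseteq> L"
  by (auto simp: multiples_def intro: scaleR_in)

lemma zero_multiples: "0 \<in> multiples m L"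
  using zero_in by (force simp: multiples_def)

lemma multiples_add: "x \<in> multiples m L \<Longrightarrow> y \<in> multiples m L \<Longrightarrow> x + y \<in> multiples m L"
  by (auto simp: multiples_def scaleR_add_right[symmetric] intro: add_in)

lemma multiples_minus: "x \<in> multiples m L \<Longrightarrow> - x \<in> multiples m L"
  by (auto simp: multiples_def scaleR_minus_right[symmetric] simp del: scaleR_minus_right intro: minus_in)

lemma multiples_diff: "x \<in> multiples m L \<Longrightarrow> y \<in> multiples m L \<Longrightarrow> x - y \<in> multiples m L"
  using multiples_add[of x m "- y"] multiples_minus[of y m] by simp

lemma scaleR_int_multiples:
  assumes "x \<in> L" "int m dvd j"
  shows "of_int j *\<^sub>R x \<in> multiples m L"
proof -
  obtain i where "j = int m * i" using assms(2) by (auto elim: dvdE)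
  then have "of_int j *\<^sub>R x = real m *\<^sub>R (of_int i *\<^sub>R x)" by simp
  then show ?thesis using scaleR_int_in[OF assms(1), of i] by (metis image_eqI multiples_def)
qed

lemma multiples_dvd: "m dvd m' \<Longrightarrow> multiples m' L \<subseteq> multiples m L"
  using scaleR_int_multiples[of _ m "int m'"] by (auto simp: multiples_def[of m'])

lemma mem_coset: "y \<in> coset m x \<longleftrightarrow> y - x \<in> multiples m L"
  unfolding coset_def by (force simp: image_iff)

lemma self_mem_coset: "x \<in> coset m x"
  by (simp add: mem_coset zero_multiples)

lemma coset_eq_iff: "coset m x = coset m y \<longleftrightarrow> x - y \<in> multiples m L"
proof
  assume "coset m x = coset m y"
  then show "x - y \<in> multiples m L" using self_mem_coset[of x m] by (simp add: mem_coset)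
next
  assume xy: "x - y \<in> multiples m L"
  have "z - x \<in> multiples m L \<longleftrightarrow> z - y \<in> multiples m L" for z
    using multiples_add[OF _ xy, of "z - x"] multiples_diff[OF _ xy, of "z - y"] by auto
  then show "coset m x = coset m y" by (auto simp: mem_coset)
qed

lemma mem_coset_iff: "y \<in> coset m x \<longleftrightarrow> coset m y = coset m x"
  by (simp add: coset_eq_iff mem_coset)

lemma coset_subset: "x \<in> L \<Longrightarrow> coset m x \<subseteq> L"
  using multiples_subset by (auto simp: coset_def intro: add_in)

lemma translate_coset: "translate t (coset m x) = coset m (x + t)"
  by (auto simp: translate_def coset_def image_image add.assoc)

definition cosets :: "nat \<Rightarrow> (real ^ 'n) set set" where
  "cosets m = coset m ` L"

lemma coset_in_cosets: "x \<in> L \<Longrightarrow> coset m x \<in> cosets m"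
  by (simp add: cosets_def)

lemma cosets_subset: "C \<in> cosets m \<Longrightarrow> C \<subseteq> L"
  using coset_subset by (auto simp: cosets_def)

lemma cosetsE:
  assumes "C \<in> cosets m" obtains x where "x \<in> L" "x \<in> C" "C = coset m x"
  using assms self_mem_coset by (auto simp: cosets_def)

lemma mem_cosets_iff: "C \<in> cosets m \<Longrightarrow> x \<in> C \<longleftrightarrow> coset m x = C"
  by (elim cosetsE) (simp add: mem_coset_iff)

text \<open>With the Bezout identity \<open>u Q + v q = 1\<close>, the combination \<open>z\<close>
  of \<open>u Q\<close> times \<open>y\<close> and \<open>v q\<close> times \<open>x\<close> agrees
  with \<open>x\<close> modulo \<open>Q\<close> and with \<open>y\<close> modulo
  \<open>q\<close>.\<close>

lemma chinese_remainder_step: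
  assumes "coprime Q q" "x \<in> L" "y \<in> L"
  obtains z where "z \<in> L" "z - x \<in> multiples Q L" "z - y \<in> multiples q L"
proof -
  obtain u v where uv: "u * int Q + v * int q = 1"
    using bezout_int[of "int Q" "int q"] assms(1) by auto
  define z where "z = of_int (u * int Q) *\<^sub>R y + of_int (v * int q) *\<^sub>R x"
  have split: "w = of_int (u * int Q) *\<^sub>R w + of_int (v * int q) *\<^sub>R w" for w :: "real ^ 'n"
    using uv by (simp only: scaleR_left_distrib[symmetric] of_int_add[symmetric]) simp
  have "z - x = of_int (u * int Q) *\<^sub>R (y - x)" 
    using split[of x] unfolding z_def scaleR_diff_right by (simp add: algebra_simps)
  moreover have "z - y = of_int (v * int q) *\<^sub>R (x - y)"
    using split[of y] unfolding z_def scaleR_diff_right by (simp add: algebra_simps)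
  moreover have "z \<in> L" unfolding z_def by (intro add_in scaleR_int_in assms)
  ultimately show ?thesis
    using that[of z] scaleR_int_multiples[OF diff_in[OF assms(3,2)], of Q "u * int Q"]
      scaleR_int_multiples[OF diff_in[OF assms(2,3)], of q "v * int q"] by simp
qed

text \<open>Write \<open>x\<close> as \<open>u Q x + v q x\<close> with Bezout coefficients.
  Inserting \<open>x = q a\<close> into the first summand and \<open>x = Q b\<close> into the second
  exhibits both as multiples of \<open>q Q\<close>.\<close>

lemma multiples_mult_coprime:
  assumes "coprime Q q"
  shows "x \<in> multiples (q * Q) L \<longleftrightarrow> x \<in> multiples q L \<and> x \<in> multiples Q L"
proof
  assume "x \<in> multiples (q * Q) L"
  then show "x \<in> multiples q L \<and> x \<in> multiples Q L"
    using multiples_dvd[of q "q * Q"] multiples_dvd[of Q "q * Q"] by auto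
next
  assume "x \<in> multiples q L \<and> x \<in> multiples Q L"
  then have "\<exists>a\<in>L. x = real q *\<^sub>R a" "\<exists>b\<in>L. x = real Q *\<^sub>R b" by (auto simp: multiples_def)
  then obtain a b where ab: "a \<in> L" "x = real q *\<^sub>R a" "b \<in> L" "x = real Q *\<^sub>R b" by blast
  obtain u v where uv: "u * int Q + v * int q = 1"
    using bezout_int[of "int Q" "int q"] assms(1) by auto
  have "x = of_int (u * int Q) *\<^sub>R x + of_int (v * int q) *\<^sub>R x"
    using uv by (simp only: scaleR_left_distrib[symmetric] of_int_add[symmetric]) simp
  also have "of_int (u * int Q) *\<^sub>R x = of_int (u * int (q * Q)) *\<^sub>R a"
    by (subst ab(2)) simp
  also have "of_int (v * int q) *\<^sub>R x = of_int (v * int (q * Q)) *\<^sub>R b"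
    by (subst ab(4)) simp
  finally show "x \<in> multiples (q * Q) L"
    using scaleR_int_multiples[OF ab(1), of "q * Q" "u * int (q * Q)"]
      scaleR_int_multiples[OF ab(3), of "q * Q" "v * int (q * Q)"] multiples_add by simp
qed

lemma multiples_prod:
  assumes "finite P" "pairwise (\<lambda>p q. coprime (f p) (f q)) P"
  shows "x \<in> multiples (\<Prod>p\<in>P. f p) L \<longleftrightarrow> x \<in> L \<and> (\<forall>p\<in>P. x \<in> multiples (f p) L)"
  using assms
proof (induction P rule: finite_induct)
  case empty
  then show ?case by (simp add: multiples_def)
next
  case (insert q P)
  then show ?case
    using multiples_mult_coprime[OF coprime_prod_insert[OF insert(1,2,4)], of x]
    by (auto simp: pairwise_insert)
qed

lemma chinese_remainder:
  assumes "finite P" "pairwise (\<lambda>p q. coprime (f p) (f q)) P" "\<And>p. p \<in> P \<Longrightarrow> a p \<in> L"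
  shows "\<exists>x\<in>L. \<forall>p\<in>P. x - a p \<in> multiples (f p) L"
  using assms
proof (induction P rule: finite_induct)
  case empty
  then show ?case using zero_in by auto
next
  case (insert q P)
  then obtain x where x: "x \<in> L" "\<forall>p\<in>P. x - a p \<in> multiples (f p) L" by (auto simp: pairwise_insert)
  obtain z where z: "z \<in> L" "z - x \<in> multiples (\<Prod>p\<in>P. f p) L" "z - a q \<in> multiples (f q) L"
    using chinese_remainder_step[OF coprime_prod_insert[OF insert(1,2,4)] x(1)] insert(5) by blast
  have "z - a p \<in> multiples (f p) L" if "p \<in> P" for p
  proof -
    have "z - x \<in> multiples (f p) L"
      using z(2) that insert(1,4) by (simp add: multiples_prod pairwise_insert)
    from multiples_add[OF this, of "x - a p"] x(2) that show ?thesis by simp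
  qed
  then show ?case using z by auto
qed

section \<open>Density and number of the cosets\<close>

lemma has_density_coset:
  assumes "m > 0" "a \<in> L"
  shows "has_density (coset m a) (1 / real m ^ CARD('n))"
proof -
  \<comment> \<open>Dividing by \<open>m\<close> carries the coset to a displaced copy of
    \<open>L\<close>; equivalently \<open>L\<close> itself is counted in a ball of radius
    \<open>R / m\<close> with displaced centre.\<close>
  have "card (coset m a \<inter> ball 0 R) = card (L \<inter> ball (- (1 / real m) *\<^sub>R a) (R / real m))" for R
  proof -
    have "norm (real m *\<^sub>R x + a) < R \<longleftrightarrow> dist (- (1 / real m) *\<^sub>R a) x < R / real m" for x
    proof -
      have "real m *\<^sub>R x + a = real m *\<^sub>R (x - (- (1 / real m) *\<^sub>R a))" using assms by (simp add: algebra_simps)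
      then have "norm (real m *\<^sub>R x + a) = real m * dist (- (1 / real m) *\<^sub>R a) x"
        by (metis abs_of_nat dist_commute dist_norm norm_scaleR)
      then show ?thesis using assms by (simp add: pos_less_divide_eq mult.commute)
    qed
    then have "coset m a \<inter> ball 0 R = (\<lambda>x. real m *\<^sub>R x + a) ` (L \<inter> ball (- (1 / real m) *\<^sub>R a) (R / real m))"
      by (auto simp: coset_def multiples_def dist_norm[of 0])
    then show ?thesis using assms by (simp add: card_image inj_on_def)
  qed
  then show ?thesis
    using card_ball_limit[of "real m" "- (1 / real m) *\<^sub>R a" 0] assms by (simp add: has_density_def)
qed

lemma has_mean_coset:
  assumes "m > 0" "C \<in> cosets m"
  shows "has_mean (\<lambda>x. of_bool (x \<in> C)) (1 / of_nat m ^ CARD('n))"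
proof -
  have "has_density C (1 / real m ^ CARD('n))"
    using assms has_density_coset by (elim cosetsE) simp
  then show ?thesis using has_density_iff[OF cosets_subset[OF assms(2)]] by simp
qed

text \<open>The index is read off from densities. A union of \<open>j\<close> cosets has density
  \<open>j\<close> divided by the \<open>n\<close>-th power of \<open>m\<close>, at most the density
  1 of \<open>L\<close>; this bounds \<open>j\<close>, and all cosets together make up
  \<open>L\<close>, so that equality is attained.\<close>

lemma finite_cosets: "m > 0 \<Longrightarrow> finite (cosets m)"
  and card_cosets: "m > 0 \<Longrightarrow> card (cosets m) = m ^ CARD('n)"
proof -
  have *: "has_mean (\<lambda>x. of_bool (x \<in> \<Union>F)) (of_nat (card F) / of_nat m ^ CARD('n))"
    if "m > 0" "F \<subseteq> cosets m" "finite F" for F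
  proof -
    have "(\<Sum>C\<in>F. of_bool (x \<in> C)) = (of_bool (x \<in> \<Union>F) :: complex)" for x
    proof (cases "x \<in> \<Union>F")
      case True
      then obtain C where C: "C \<in> F" "x \<in> C" by auto
      have "(\<Sum>D\<in>F. of_bool (x \<in> D)) = (\<Sum>D\<in>{C}. 1 :: complex)"
        using C that mem_cosets_iff[of _ m x]
        by (intro sum.mono_neutral_cong_right) (auto simp: subset_iff)
      then show ?thesis using True by simp
    qed auto
    then show ?thesis
      using has_mean_sum[OF that(3), of "\<lambda>C x. of_bool (x \<in> C)" "\<lambda>_. 1 / of_nat m ^ CARD('n)"] has_mean_coset[OF that(1)] that(2)
      by (auto simp: subset_iff)
  qed
  have le: "card F \<le> m ^ CARD('n)" if m: "m > 0" and F: "F \<subseteq> cosets m" "finite F" for F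
  proof -
    have "\<Union>F \<subseteq> L" using cosets_subset F by blast
    then have "has_density (\<Union>F) (card F / real m ^ CARD('n))"
      using *[OF m F] by (subst has_density_iff) auto
    moreover have "has_density L 1" unfolding has_density_def using card_ball_limit[of 1 0 0] by simp
    ultimately have "card F / real m ^ CARD('n) \<le> 1"
      unfolding has_density_def
    proof (elim tendsto_le[OF trivial_limit_at_top_linorder, rotated])
      show "\<forall>\<^sub>F R in at_top. card (\<Union>F \<inter> ball 0 R) / ball_vol TYPE('n) R \<le> card (L \<inter> ball 0 R) / ball_vol TYPE('n) R"
        using eventually_gt_at_top[of 0]
      proof eventually_elim
        case (elim R)
        then show ?case using vol_pos[of R] finite_ball \<open>\<Union>F \<subseteq> L\<close>
          by (intro divide_right_mono of_nat_mono card_mono) auto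
      qed
    qed
    then have "real (card F) \<le> real (m ^ CARD('n))" using m by (simp add: divide_le_eq)
    then show ?thesis by (simp only: of_nat_le_iff)
  qed
  show fin: "finite (cosets m)" if "m > 0"
    using finite_if_finite_subsets_card_bdd[of "cosets m", OF le[OF that]] by blast
  show "card (cosets m) = m ^ CARD('n)" if m: "m > 0"
  proof -
    have "\<Union>(cosets m) = L"
      using cosets_subset coset_in_cosets self_mem_coset by blast
    then have "has_mean (\<lambda>x. of_bool (x \<in> L)) (of_nat (card (cosets m)) / of_nat m ^ CARD('n))"
      using *[OF m subset_refl fin[OF m]] by simp
    then have "has_mean (\<lambda>x. 1) (of_nat (card (cosets m)) / of_nat m ^ CARD('n))"
      by (subst has_mean_cong[where b = "\<lambda>x. of_bool (x \<in> L)"]) auto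
    then have "of_nat (card (cosets m)) / of_nat m ^ CARD('n) = (1 :: complex)"
      using has_mean_1 has_mean_unique by blast
    then have "of_nat (card (cosets m)) = (of_nat (m ^ CARD('n)) :: complex)" using m by simp
    then show ?thesis by (simp only: of_nat_eq_iff)
  qed
qed

end

section \<open>Borel sets of zero-dimensional systems\<close>

lemma space_borel_algebra: "space (borel_algebra T) = topspace T"
  and sets_borel_algebra: "sets (borel_algebra T) = sigma_sets (topspace T) {U. openin T U}"
  unfolding borel_algebra_def
  by (auto intro!: space_measure_of sets_measure_of dest: openin_subset)

text \<open>The functions \<^term>\<open>c N\<close> label the members of a refining sequence of finite partitions into
  clopen sets that generates the topology.\<close>

locale cell_system =
  fixes T :: "'a topology" and c :: "nat \<Rightarrow> 'a \<Rightarrow> 'b"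
  assumes finite_labels: "finite (c N ` topspace T)"
    and refine: "x \<in> topspace T \<Longrightarrow> y \<in> topspace T \<Longrightarrow> c (Suc N) x = c (Suc N) y \<Longrightarrow> c N x = c N y"
    and openin_iff: "openin T U \<longleftrightarrow>
      U \<subseteq> topspace T \<and> (\<forall>x\<in>U. \<exists>N. \<forall>y\<in>topspace T. c N y = c N x \<longrightarrow> y \<in> U)"
begin

lemma refine_le:
  "N \<le> M \<Longrightarrow> x \<in> topspace T \<Longrightarrow> y \<in> topspace T \<Longrightarrow> c M x = c M y \<Longrightarrow> c N x = c N y"
  by (induction rule: dec_induct) (auto dest: refine)

definition cells :: "nat \<Rightarrow> 'b set \<Rightarrow> 'a set" where
  "cells N W = {x \<in> topspace T. c N x \<in> W}"

lemma cells_subset: "cells N W \<subseteq> topspace T"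
  by (auto simp: cells_def)

text \<open>Cells of different levels are brought to a common level in this way; there Boolean
  operations are those on sets of labels, so that cells form an algebra.\<close>

lemma cells_lift: "N \<le> M \<Longrightarrow> cells N W = cells M (c M ` cells N W)"
  unfolding cells_def by (auto dest: refine_le)

lemma openin_cells: "openin T (cells N W)"
  unfolding openin_iff by (auto simp: cells_def intro!: exI[of _ N])

text \<open>There are only countably many pairs of a level and a label attained there, so an open
  set, being the union of the single-label cells inside it, is a countable union.\<close>

lemma sets_borel_eq: "sets (borel_algebra T) = sigma_sets (topspace T) (range (case_prod cells))"
  unfolding sets_borel_algebra
proof (rule sigma_sets_eqI)
  fix U assume "U \<in> {U. openin T U}"
  then have U: "openin T U" by simp
  define I where "I = {(N, v). v \<in> c N ` topspace T \<and> cells N {v} \<subseteq> U}"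
  have "countable I"
  proof (rule countable_subset)
    show "I \<subseteq> Sigma UNIV (\<lambda>N. c N ` topspace T)" by (auto simp: I_def)
    show "countable (Sigma UNIV (\<lambda>N. c N ` topspace T))"
      using finite_labels by (intro countable_SIGMA) (auto intro: countable_finite)
  qed
  moreover have "U = (\<Union>(N, v)\<in>I. cells N {v})"
  proof
    show "U \<subseteq> (\<Union>(N, v)\<in>I. cells N {v})"
    proof
      fix x assume x: "x \<in> U"
      have xT: "x \<in> topspace T" using x openin_subset[OF U] by auto
      obtain N where "\<forall>y\<in>topspace T. c N y = c N x \<longrightarrow> y \<in> U"
        using U x unfolding openin_iff by blast
      then have "(N, c N x) \<in> I" "x \<in> cells N {c N x}" using xT by (auto simp: I_def cells_def)
      then show "x \<in> (\<Union>(N, v)\<in>I. cells N {v})" by blast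
    qed
  qed (auto simp: I_def)
  ultimately show "U \<in> sigma_sets (topspace T) (range (case_prod cells))"
    by (auto intro!: sigma_sets_UNION)
next
  fix U assume "U \<in> range (case_prod cells)"
  then show "U \<in> sigma_sets (topspace T) {U. openin T U}"
    using openin_cells by (auto intro: sigma_sets.Basic)
qed

lemma cells_in_sets: "cells N W \<in> sets (borel_algebra T)"
  unfolding sets_borel_eq by (rule sigma_sets.Basic) (auto intro: image_eqI[where x = "(N, W)"])

lemma measurable_label: "c N \<in> measurable (borel_algebra T) (count_space UNIV)"
proof (rule measurableI)
  fix W show "c N -` W \<inter> space (borel_algebra T) \<in> sets (borel_algebra T)"
    using cells_in_sets[of N W] by (simp add: cells_def space_borel_algebra vimage_def Int_def conj_commute)
qed simp

lemma measurable_into: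
  assumes "\<And>x. x \<in> space M \<Longrightarrow> f x \<in> topspace T"
    and "\<And>N v. v \<in> c N ` topspace T \<Longrightarrow> {x \<in> space M. c N (f x) = v} \<in> sets M"
  shows "f \<in> measurable M (borel_algebra T)"
proof (rule measurable_sigma_sets[OF sets_borel_eq])
  show "range (case_prod cells) \<subseteq> Pow (topspace T)" using cells_subset by auto
  show "f \<in> space M \<rightarrow> topspace T" using assms(1) by auto
  fix U assume "U \<in> range (case_prod cells)"
  then obtain N W where U: "U = cells N W" by auto
  have "f -` U \<inter> space M = (\<Union>v\<in>c N ` topspace T \<inter> W. {x \<in> space M. c N (f x) = v})"
    using assms(1) by (auto simp: U cells_def)
  also have "\<dots> \<in> sets M" using finite_labels assms(2) by (intro sets.finite_UN) auto
  finally show "f -` U \<inter> space M \<in> sets M" .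
qed

lemma measure_cells:
  assumes "finite_measure M" "sets M = sets (borel_algebra T)"
  shows "measure M (cells N W) = (\<Sum>v\<in>c N ` topspace T \<inter> W. measure M (cells N {v}))"
proof -
  interpret finite_measure M by fact
  have "cells N W = (\<Union>v\<in>c N ` topspace T \<inter> W. cells N {v})" by (auto simp: cells_def)
  also have "measure M \<dots> = (\<Sum>v\<in>c N ` topspace T \<inter> W. measure M (cells N {v}))"
    using finite_labels cells_in_sets assms(2)
    by (intro finite_measure_finite_Union) (auto simp: disjoint_family_on_def, auto simp: cells_def)
  finally show ?thesis .
qed

lemma measure_eqI_cells:
  assumes M: "prob_space M" "sets M = sets (borel_algebra T)"
    and M': "prob_space M'" "sets M' = sets (borel_algebra T)"
    and eq: "\<And>N v. v \<in> c N ` topspace T \<Longrightarrow> measure M (cells N {v}) = measure M' (cells N {v})"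
  shows "M = M'"
proof (rule measure_eqI_generator_eq[where E = "range (case_prod cells)" and \<Omega> = "topspace T" and A = "\<lambda>_. cells 0 UNIV"])
  interpret M: prob_space M by fact
  interpret M': prob_space M' by fact
  show "Int_stable (range (case_prod cells))"
  proof (rule Int_stableI_image)
    fix i j :: "nat \<times> 'b set"
    obtain N W K Y where ij: "i = (N, W)" "j = (K, Y)" by fastforce
    obtain W' Y' where "cells N W = cells (max N K) W'" "cells K Y = cells (max N K) Y'"
      using cells_lift[of N "max N K"] cells_lift[of K "max N K"] by (metis max.cobounded1 max.cobounded2)
    then have "(case i of (N, W) \<Rightarrow> cells N W) \<inter> (case j of (N, W) \<Rightarrow> cells N W) = (case (max N K, W' \<inter> Y') of (N, W) \<Rightarrow> cells N W)"
      by (auto simp: ij) (auto simp: cells_def)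
    then show "\<exists>k\<in>UNIV. (case i of (N, W) \<Rightarrow> cells N W) \<inter> (case j of (N, W) \<Rightarrow> cells N W) = (case k of (N, W) \<Rightarrow> cells N W)"
      by blast
  qed
  show "range (case_prod cells) \<subseteq> Pow (topspace T)" using cells_subset by auto
  show "sets M = sigma_sets (topspace T) (range (case_prod cells))"
    "sets M' = sigma_sets (topspace T) (range (case_prod cells))" using M(2) M'(2) sets_borel_eq by auto
  show "range (\<lambda>_. cells 0 UNIV) \<subseteq> range (case_prod cells)" by (auto intro: image_eqI[where x = "(0, UNIV)"])
  show "(\<Union>i :: nat. cells 0 UNIV) = topspace T" by (auto simp: cells_def)
  fix X assume "X \<in> range (case_prod cells)"
  then obtain N W where "X = cells N W" by auto
  then have "measure M X = measure M' X"
    using measure_cells[of M N W] measure_cells[of M' N W] eq M M'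
    by (auto simp: M.finite_measure_axioms M'.finite_measure_axioms intro!: sum.cong)
  then show "emeasure M X = emeasure M' X" by (simp add: M.emeasure_eq_measure M'.emeasure_eq_measure)
next
  fix i :: nat
  show "emeasure M (cells 0 UNIV) \<noteq> \<infinity>"
    using finite_measure.emeasure_finite[OF prob_space.finite_measure[OF M(1)]] by simp
qed

lemma integral_label:
  fixes h :: "'b \<Rightarrow> complex"
  assumes "prob_space M" "sets M = sets (borel_algebra T)"
  shows "integrable M (\<lambda>x. h (c N x))"
    and "(\<integral>x. h (c N x) \<partial>M) = (\<Sum>v\<in>c N ` topspace T. h v * measure M (cells N {v}))"
proof -
  interpret prob_space M by fact
  have sp: "space M = topspace T" using sets_eq_imp_space_eq[OF assms(2)] by (simp add: space_borel_algebra)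
  have cs: "cells N W \<in> sets M" for N W using cells_in_sets assms(2) by simp
  have eq: "h (c N x) = (\<Sum>v\<in>c N ` topspace T. h v * of_real (indicat_real (cells N {v}) x))" if "x \<in> space M" for x
  proof -
    have "(\<Sum>v\<in>c N ` topspace T. h v * of_real (indicat_real (cells N {v}) x)) = (\<Sum>v\<in>{c N x}. h v)"
      using finite_labels that sp by (intro sum.mono_neutral_cong_right) (auto simp: cells_def)
    then show ?thesis by simp
  qed
  have int: "integrable M (\<lambda>x. h v * of_real (indicat_real (cells N {v}) x))" for v
    using cs by (intro integrable_mult_right) (auto simp: less_top[symmetric])
  show "integrable M (\<lambda>x. h (c N x))"
    using int by (subst Bochner_Integration.integrable_cong[OF refl eq]) auto
  show "(\<integral>x. h (c N x) \<partial>M) = (\<Sum>v\<in>c N ` topspace T. h v * measure M (cells N {v}))"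
    using int cs by (subst Bochner_Integration.integral_cong[OF refl eq])
      (auto simp: Bochner_Integration.integral_sum Int_absorb2 sets.sets_into_space)
qed

lemma in_closure_of_iff:
  "x \<in> T closure_of A \<longleftrightarrow> x \<in> topspace T \<and> (\<forall>N. \<exists>y\<in>A \<inter> topspace T. c N y = c N x)"
proof safe
  fix N assume x: "x \<in> T closure_of A"
  then show "x \<in> topspace T" by (simp add: in_closure_of)
  then have "x \<in> cells N {c N x}" by (simp add: cells_def)
  then obtain y where "y \<in> A" "y \<in> cells N {c N x}" using x openin_cells by (meson in_closure_of)
  then show "\<exists>y\<in>A \<inter> topspace T. c N y = c N x" by (auto simp: cells_def)
next
  assume x: "x \<in> topspace T" "\<forall>N. \<exists>y\<in>A \<inter> topspace T. c N y = c N x"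
  then show "x \<in> T closure_of A" unfolding in_closure_of openin_iff by fast
qed

lemma cell_system_subtopology: "cell_system (subtopology T S) c"
proof
  fix N show "finite (c N ` topspace (subtopology T S))"
    by (rule finite_subset[OF _ finite_labels]) auto
next
  fix U
  show "openin (subtopology T S) U \<longleftrightarrow> U \<subseteq> topspace (subtopology T S) \<and>
      (\<forall>x\<in>U. \<exists>N. \<forall>y\<in>topspace (subtopology T S). c N y = c N x \<longrightarrow> y \<in> U)" (is "?l \<longleftrightarrow> ?r")
  proof
    assume ?l
    then obtain W where W: "openin T W" "U = W \<inter> S" by (auto simp: openin_subtopology)
    have "\<exists>N. \<forall>y\<in>topspace (subtopology T S). c N y = c N x \<longrightarrow> y \<in> U" if xU: "x \<in> U" for x
    proof -
      obtain N where "\<forall>y\<in>topspace T. c N y = c N x \<longrightarrow> y \<in> W" using W xU unfolding openin_iff by blast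
      then show ?thesis using W by auto
    qed
    then show ?r using openin_subset[OF \<open>?l\<close>] by blast
  next
    assume r: ?r
    \<comment> \<open>To extend \<open>U\<close> to an open set of the large space, take all full
      cells around points of \<open>U\<close> whose trace on \<open>S\<close> stays in
      \<open>U\<close>; this adds no point of \<open>S\<close>.\<close>
    define W where "W = {y \<in> topspace T. \<exists>x\<in>U. \<exists>N. c N y = c N x \<and> (\<forall>z\<in>topspace (subtopology T S). c N z = c N x \<longrightarrow> z \<in> U)}"
    have "openin T W" unfolding openin_iff
    proof (intro conjI ballI)
      show "W \<subseteq> topspace T" by (auto simp: W_def)
      fix y assume "y \<in> W"
      then obtain x N where x: "x \<in> U" "c N y = c N x" "\<forall>z\<in>topspace (subtopology T S). c N z = c N x \<longrightarrow> z \<in> U"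
        by (auto simp: W_def)
      have "z \<in> W" if "z \<in> topspace T" "c N z = c N y" for z
        using that x unfolding W_def by (intro CollectI conjI bexI[of _ x] exI[of _ N]) auto
      then show "\<exists>N. \<forall>z\<in>topspace T. c N z = c N y \<longrightarrow> z \<in> W" by blast
    qed
    moreover have "U = W \<inter> S"
    proof
      show "U \<subseteq> W \<inter> S"
      proof
        fix x assume x: "x \<in> U"
        then obtain N where N: "\<forall>z\<in>topspace (subtopology T S). c N z = c N x \<longrightarrow> z \<in> U" using r by blast
        have "x \<in> topspace T" "x \<in> S" using r x by auto
        then show "x \<in> W \<inter> S" unfolding W_def using x N by blast
      qed
      show "W \<inter> S \<subseteq> U"
      proof
        fix y assume "y \<in> W \<inter> S"
        then obtain x N where "y \<in> topspace T" "y \<in> S" "c N y = c N x" "\<forall>z\<in>topspace (subtopology T S). c N z = c N x \<longrightarrow> z \<in> U"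
          by (auto simp: W_def)
        then show "y \<in> U" by simp
      qed
    qed
    ultimately show ?l by (auto simp: openin_subtopology)
  qed
qed (use refine in auto)

section \<open>Approximation by functions of a single label\<close>

lemma approximate_set:
  assumes M: "prob_space M" "sets M = sets (borel_algebra T)" and A: "A \<in> sets M" and "e > 0"
  obtains N W where "measure M (sym_diff A (cells N W)) < e"
proof -
  interpret prob_space M by fact
  have cs [measurable, simp]: "cells N W \<in> sets M" for N W using cells_in_sets M(2) by simp
  \<comment> \<open>The sets that cells approximate arbitrarily well in measure contain the cells
    and form a sigma-algebra, hence include all Borel sets.\<close>
  define P where "P A \<longleftrightarrow> A \<in> sets M \<and> (\<forall>e>0. \<exists>N W. measure M (sym_diff A (cells N W)) < e)" for A
  have sp: "space M = topspace T" using M(2) sets_eq_imp_space_eq[OF M(2)] by (simp add: space_borel_algebra)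
  have P_Un: "P (A \<union> B)" if "P A" "P B" for A B
    unfolding P_def
  proof (intro conjI allI impI)
    show "A \<union> B \<in> sets M" using that by (auto simp: P_def)
    fix e :: real assume "e > 0"
    then have "e / 2 > 0" by simp
    then have "\<exists>N W. measure M (sym_diff A (cells N W)) < e / 2" "\<exists>K Y. measure M (sym_diff B (cells K Y)) < e / 2"
      using that unfolding P_def by blast+
    then obtain N W K Y where NK: "measure M (sym_diff A (cells N W)) < e / 2" "measure M (sym_diff B (cells K Y)) < e / 2"
      by blast
    obtain W' Y' where eq: "cells N W = cells (max N K) W'" "cells K Y = cells (max N K) Y'"
      using cells_lift[of N "max N K"] cells_lift[of K "max N K"] by (metis max.cobounded1 max.cobounded2)
    have "cells (max N K) (W' \<union> Y') = cells N W \<union> cells K Y" unfolding eq by (auto simp: cells_def)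
    then have "measure M (sym_diff (A \<union> B) (cells (max N K) (W' \<union> Y')))
        \<le> measure M (sym_diff A (cells N W) \<union> sym_diff B (cells K Y))"
      using that by (intro finite_measure_mono) (auto simp: P_def)
    also have "\<dots> \<le> measure M (sym_diff A (cells N W)) + measure M (sym_diff B (cells K Y))"
      using that by (intro measure_Un_le) (auto simp: P_def)
    also have "\<dots> < e" using NK by simp
    finally show "\<exists>N W. measure M (sym_diff (A \<union> B) (cells N W)) < e" by blast
  qed
  have "P A" if "A \<in> sigma_sets (topspace T) (range (case_prod cells))" for A
    using that
  proof induction
    case (Basic A)
    then obtain N W where "A = cells N W" by auto
    then show ?case unfolding P_def by (auto intro!: exI[of _ N] exI[of _ W])
  next
    case Empty
    have "{} = cells 0 {}" by (simp add: cells_def)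
    then show ?case unfolding P_def by (auto intro!: exI[of _ 0] exI[of _ "{}"])
  next
    case (Compl A)
    have "A \<subseteq> topspace T" using Compl(2) sets.sets_into_space sp by (auto simp: P_def)
    then have "sym_diff (topspace T - A) (cells N (- W)) = sym_diff A (cells N W)" for N W
      by (auto simp: cells_def)
    then show ?case using Compl(2) sp unfolding P_def by (metis sets.compl_sets)
  next
    case (Union A)
    \<comment> \<open>Continuity from below lets a countable union be replaced by a finite one at
      cost \<open>e / 2\<close>; finite unions are covered by \<open>P_Un\<close>.\<close>
    define U where "U n = (\<Union>i<n. A i)" for n :: nat
    have PU: "P (U n)" for n
    proof (induction n)
      case 0
      have "{} = cells 0 {}" by (simp add: cells_def)
      then show ?case unfolding P_def U_def by (auto intro!: exI[of _ 0] exI[of _ "{}"])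
    next
      case (Suc n)
      then show ?case using P_Un[OF _ Union(2)[of n], of "U n"] by (simp add: U_def lessThan_Suc Un_commute)
    qed
    have UA: "(\<Union>n. U n) = \<Union>(range A)" unfolding U_def by auto
    have sets: "A i \<in> sets M" "U i \<in> sets M" for i using Union(2) PU by (auto simp: P_def)
    have lim: "(\<lambda>n. measure M (U n)) \<longlonglongrightarrow> measure M (\<Union>(range A))"
      unfolding UA[symmetric] using sets by (intro finite_Lim_measure_incseq incseq_SucI) (auto simp: U_def lessThan_Suc)
    show ?case unfolding P_def
    proof (intro conjI allI impI)
      show "\<Union>(range A) \<in> sets M" using sets by auto
      fix e :: real assume "e > 0"
      then obtain n where n: "dist (measure M (U n)) (measure M (\<Union>(range A))) < e / 2"
        using lim by (metis LIMSEQ_iff_nz dist_commute half_gt_zero le_refl metric_LIMSEQ_D)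
      obtain N W where NW: "measure M (sym_diff (U n) (cells N W)) < e / 2"
        using PU[of n] \<open>e > 0\<close> unfolding P_def by (meson half_gt_zero)
      have "measure M (\<Union>(range A) - U n) = measure M (\<Union>(range A)) - measure M (U n)"
        using sets UA by (intro finite_measure_Diff) auto
      also have "\<dots> < e / 2" using n unfolding dist_real_def by linarith
      finally have diff: "measure M (\<Union>(range A) - U n) < e / 2" .
      have "measure M (sym_diff (\<Union>(range A)) (cells N W)) \<le> measure M ((\<Union>(range A) - U n) \<union> sym_diff (U n) (cells N W))"
        using sets UA by (intro finite_measure_mono) auto
      also have "\<dots> \<le> measure M (\<Union>(range A) - U n) + measure M (sym_diff (U n) (cells N W))"
        using sets by (intro measure_Un_le) auto
      also have "\<dots> < e" using diff NW by simp
      finally show "\<exists>N W. measure M (sym_diff (\<Union>(range A)) (cells N W)) < e" by blast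
    qed
  qed
  then have "P A" using A M(2) sets_borel_eq by auto
  then show ?thesis using that \<open>e > 0\<close> unfolding P_def by blast
qed

lemma approximate_simple_function:
  assumes M: "prob_space M" "sets M = sets (borel_algebra T)" and s: "simple_function M s" and "e > 0"
  shows "\<exists>N g. (\<forall>v. g v \<in> s ` space M) \<and> {x \<in> space M. s x \<noteq> g (c N x)} \<in> sets M \<and>
    measure M {x \<in> space M. s x \<noteq> g (c N x)} < e"
proof -
  interpret prob_space M by fact
  have cs [measurable, simp]: "cells N W \<in> sets M" for N W using cells_in_sets M(2) by simp
  have sp: "space M = topspace T" using M(2) sets_eq_imp_space_eq[OF M(2)] by (simp add: space_borel_algebra)
  define R where "R = s ` space M"
  have R: "finite R" "R \<noteq> {}" using s not_empty by (auto simp: R_def simple_function_def)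
  define A where "A y = s -` {y} \<inter> space M" for y
  have A: "A y \<in> sets M" if "y \<in> R" for y using s that by (auto simp: A_def R_def simple_function_def)
  \<comment> \<open>Each of the \<open>card R\<close> level sets may be missed on a set of measure
    \<open>\<delta>\<close>, and these errors add up to \<open>e\<close>.\<close>
  define \<delta> where "\<delta> = e / card R"
  have "\<delta> > 0" using \<open>e > 0\<close> R by (simp add: \<delta>_def card_gt_0_iff)
  have "\<forall>y\<in>R. \<exists>p. measure M (sym_diff (A y) (cells (fst p) (snd p))) < \<delta>"
    using approximate_set[OF M A \<open>\<delta> > 0\<close>] by (metis fst_conv snd_conv)
  then obtain p where p: "\<And>y. y \<in> R \<Longrightarrow> measure M (sym_diff (A y) (cells (fst (p y)) (snd (p y)))) < \<delta>" by metis
  define N where "N = Max (fst ` p ` R)"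
  have "\<exists>W. cells (fst (p y)) (snd (p y)) = cells N W" if "y \<in> R" for y
    using cells_lift[of "fst (p y)" N] that R unfolding N_def by (metis Max_ge finite_imageI imageI)
  then obtain W where W: "\<And>y. y \<in> R \<Longrightarrow> cells (fst (p y)) (snd (p y)) = cells N (W y)" by metis
  \<comment> \<open>The approximating cells of different values may overlap or leave gaps, so the
    value is picked arbitrarily there. It is always taken from the range of \<open>s\<close>, which
    keeps the approximation bounded by the same constant and, for partitions, in the same
    alphabet.\<close>
  define g where "g v = (if \<exists>y\<in>R. v \<in> W y then SOME y. y \<in> R \<and> v \<in> W y else (SOME y. y \<in> R))" for v
  have gR: "g v \<in> R" for v
  proof -
    have "(SOME y. y \<in> R \<and> v \<in> W y) \<in> R" if "\<exists>y\<in>R. v \<in> W y"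
      using someI_ex[of "\<lambda>y. y \<in> R \<and> v \<in> W y"] that by blast
    moreover have "(SOME y. y \<in> R) \<in> R" using R by (simp add: some_in_eq)
    ultimately show ?thesis by (simp add: g_def)
  qed
  define Bad where "Bad = (\<Union>y\<in>R. sym_diff (A y) (cells N (W y)))"
  have good: "s x = g (c N x)" if x: "x \<in> space M" "x \<notin> Bad" for x
  proof -
    have "c N x \<in> W y \<longleftrightarrow> y = s x" if "y \<in> R" for y
    proof -
      have "x \<in> A y \<longleftrightarrow> x \<in> cells N (W y)" using x that by (auto simp: Bad_def)
      then show ?thesis using x sp by (auto simp: A_def cells_def)
    qed
    moreover have "s x \<in> R" using x by (simp add: R_def)
    ultimately have "(SOME y. y \<in> R \<and> c N x \<in> W y) = s x" "\<exists>y\<in>R. c N x \<in> W y"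
      by (auto intro!: some_equality)
    then show ?thesis by (simp add: g_def)
  qed
  have "{x \<in> space M. s x \<noteq> g (c N x)} = (\<Union>y\<in>R. A y - cells N {v. g v = y})"
    using sp by (auto simp: A_def R_def cells_def)
  then have meas: "{x \<in> space M. s x \<noteq> g (c N x)} \<in> sets M" using R A by auto
  have "measure M {x \<in> space M. s x \<noteq> g (c N x)} \<le> measure M Bad"
    using good R A by (intro finite_measure_mono) (auto simp: Bad_def)
  also have "\<dots> \<le> (\<Sum>y\<in>R. measure M (sym_diff (A y) (cells N (W y))))"
    unfolding Bad_def using R A by (intro measure_UNION_le) auto
  also have "\<dots> < (\<Sum>y\<in>R. \<delta>)" using p W R by (intro sum_strict_mono) auto
  also have "\<dots> = e" using R by (simp add: \<delta>_def)
  finally show ?thesis using gR meas unfolding R_def by blast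
qed

lemma approximate_L2:
  assumes M: "prob_space M" "sets M = sets (borel_algebra T)" and f: "f \<in> L2 M" and "e > 0"
  obtains N h where "(\<integral>x. (cmod (f x - h (c N x)))\<^sup>2 \<partial>M) < e"
proof -
  interpret prob_space M by fact
  have sp: "space M = topspace T" using M(2) sets_eq_imp_space_eq[OF M(2)] by (simp add: space_borel_algebra)
  have f_meas [measurable]: "f \<in> borel_measurable M" and f_int: "integrable M (\<lambda>x. (cmod (f x))\<^sup>2)"
    using f by (auto simp: L2_def)
  obtain s where s: "\<And>i. simple_function M (s i)" "\<And>x. x \<in> space M \<Longrightarrow> (\<lambda>i. s i x) \<longlonglongrightarrow> f x"
    "\<And>i x. x \<in> space M \<Longrightarrow> dist (s i x) 0 \<le> 2 * dist (f x) 0"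
    using borel_measurable_implies_sequence_metric[OF f_meas, of 0] by blast
  have [measurable]: "s i \<in> borel_measurable M" for i using s(1) by (rule borel_measurable_simple_function)
  have "(\<lambda>i. \<integral>x. (cmod (f x - s i x))\<^sup>2 \<partial>M) \<longlonglongrightarrow> (\<integral>x. 0 \<partial>M)"
  \<comment> \<open>The simple functions satisfy \<open>|s i| \<le> 2 |f|\<close>, so the difference
    is at most \<open>3 |f|\<close> and its square at most 9 times the square.\<close>
  proof (rule integral_dominated_convergence[where w = "\<lambda>x. 9 * (cmod (f x))\<^sup>2"])
    show "AE x in M. (\<lambda>i. (cmod (f x - s i x))\<^sup>2) \<longlonglongrightarrow> 0"
    proof (rule AE_I2)
      fix x assume "x \<in> space M"
      then have "(\<lambda>i. (cmod (f x - s i x))\<^sup>2) \<longlonglongrightarrow> (cmod (f x - f x))\<^sup>2" by (intro tendsto_intros s)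
      then show "(\<lambda>i. (cmod (f x - s i x))\<^sup>2) \<longlonglongrightarrow> 0" by simp
    qed
    fix i
    show "AE x in M. norm ((cmod (f x - s i x))\<^sup>2) \<le> 9 * (cmod (f x))\<^sup>2"
    proof (rule AE_I2)
      fix x assume "x \<in> space M"
      then have "cmod (f x - s i x) \<le> 3 * cmod (f x)"
        using s(3)[of x i] norm_triangle_ineq4[of "f x" "s i x"] by simp
      then have "(cmod (f x - s i x))\<^sup>2 \<le> (3 * cmod (f x))\<^sup>2" by (rule power_mono) simp
      then show "norm ((cmod (f x - s i x))\<^sup>2) \<le> 9 * (cmod (f x))\<^sup>2" by (simp add: power_mult_distrib)
    qed
  qed (use f_int in auto)
  then have "\<forall>\<^sub>F i in sequentially. dist (\<integral>x. (cmod (f x - s i x))\<^sup>2 \<partial>M) 0 < e / 4"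
    using \<open>e > 0\<close> by (intro tendstoD) auto
  then obtain i where i: "dist (\<integral>x. (cmod (f x - s i x))\<^sup>2 \<partial>M) 0 < e / 4"
    by (auto dest: eventually_happens)
  define K where "K = Max (insert 1 (cmod ` s i ` space M))"
  have finR: "finite (cmod ` s i ` space M)" using s(1)[of i] by (auto simp: simple_function_def)
  have K: "K \<ge> 1" "\<And>x. x \<in> space M \<Longrightarrow> cmod (s i x) \<le> K" using finR by (auto simp: K_def intro: Max_ge)
  \<comment> \<open>Chosen for the final estimate: since the square of a sum is at most twice the
    sum of squares, the error is below \<open>2 (e / 4)\<close> from the simple function plus
    \<open>8 K\<^sup>2 \<delta> = e / 2\<close> from the set where the label predicts it
    wrongly.\<close>
  define \<delta> where "\<delta> = e / (16 * K\<^sup>2)"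
  have "\<delta> > 0" using \<open>e > 0\<close> K by (simp add: \<delta>_def)
  obtain N g where g: "\<forall>v. g v \<in> s i ` space M" and small: "measure M {x \<in> space M. s i x \<noteq> g (c N x)} < \<delta>"
    and Bad: "{x \<in> space M. s i x \<noteq> g (c N x)} \<in> sets M"
    using approximate_simple_function[OF M s(1)[of i] \<open>\<delta> > 0\<close>] by blast
  have gK: "cmod (g v) \<le> K" for v using spec[OF g, of v] K(2) by auto
  define B where "B = {x \<in> space M. s i x \<noteq> g (c N x)}"
  have [measurable]: "(\<lambda>x. g (c N x)) \<in> borel_measurable M"
    using measurable_compose[OF measurable_label, of g borel] by (simp cong: measurable_cong_sets add: measurable_cong_sets[OF M(2) refl])
  have bound: "(cmod (f x - g (c N x)))\<^sup>2 \<le> 2 * (cmod (f x - s i x))\<^sup>2 + 8 * K\<^sup>2 * indicator B x" if x: "x \<in> space M" for x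
  proof (cases "x \<in> B")
    case False
    then have "s i x = g (c N x)" using x by (simp add: B_def)
    then show ?thesis using False by simp
  next
    case True
    have "cmod (s i x - g (c N x)) \<le> 2 * K" using K(2)[OF x] gK[of "c N x"] norm_triangle_ineq4[of "s i x" "g (c N x)"] by simp
    then have "(cmod (s i x - g (c N x)))\<^sup>2 \<le> (2 * K)\<^sup>2" by (rule power_mono) simp
    moreover have "(cmod (f x - g (c N x)))\<^sup>2 \<le> (cmod (f x - s i x) + cmod (s i x - g (c N x)))\<^sup>2"
      using norm_triangle_ineq[of "f x - s i x" "s i x - g (c N x)"] by (intro power_mono) auto
    moreover have "(cmod (f x - s i x) + cmod (s i x - g (c N x)))\<^sup>2 \<le> 2 * (cmod (f x - s i x))\<^sup>2 + 2 * (cmod (s i x - g (c N x)))\<^sup>2"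
      using sum_squares_bound[of "cmod (f x - s i x)" "cmod (s i x - g (c N x))"] by (simp add: power2_sum)
    moreover have "(2 * K)\<^sup>2 = 4 * K\<^sup>2" "8 * K\<^sup>2 * indicator B x = 8 * K\<^sup>2" using True by (simp_all add: power_mult_distrib)
    ultimately show ?thesis by linarith
  qed
  have int1: "integrable M (\<lambda>x. (cmod (f x - s i x))\<^sup>2)"
  proof (rule Bochner_Integration.integrable_bound[where f = "\<lambda>x. 9 * (cmod (f x))\<^sup>2"])
    show "AE x in M. norm ((cmod (f x - s i x))\<^sup>2) \<le> norm (9 * (cmod (f x))\<^sup>2)"
    proof (rule AE_I2)
      fix x assume "x \<in> space M"
      then have "cmod (f x - s i x) \<le> 3 * cmod (f x)"
        using s(3)[of x i] norm_triangle_ineq4[of "f x" "s i x"] by simp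
      then have "(cmod (f x - s i x))\<^sup>2 \<le> (3 * cmod (f x))\<^sup>2" by (rule power_mono) simp
      then show "norm ((cmod (f x - s i x))\<^sup>2) \<le> norm (9 * (cmod (f x))\<^sup>2)" by (simp add: power_mult_distrib)
    qed
  qed (use f_int in auto)
  have B: "B \<in> sets M" using Bad by (simp add: B_def)
  have int2: "integrable M (\<lambda>x. 2 * (cmod (f x - s i x))\<^sup>2 + 8 * K\<^sup>2 * indicator B x)"
    using int1 B by (intro Bochner_Integration.integrable_add integrable_mult_right) (auto simp: less_top[symmetric])
  have "(\<integral>x. (cmod (f x - g (c N x)))\<^sup>2 \<partial>M) \<le> (\<integral>x. 2 * (cmod (f x - s i x))\<^sup>2 + 8 * K\<^sup>2 * indicator B x \<partial>M)"
  proof (rule integral_mono[OF _ int2])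
    show "integrable M (\<lambda>x. (cmod (f x - g (c N x)))\<^sup>2)"
      by (rule Bochner_Integration.integrable_bound[OF int2]) (auto intro!: AE_I2 order_trans[OF bound])
  qed (rule bound)
  also have "\<dots> = 2 * (\<integral>x. (cmod (f x - s i x))\<^sup>2 \<partial>M) + 8 * K\<^sup>2 * measure M B"
    using int1 B by (subst Bochner_Integration.integral_add) (auto simp: less_top[symmetric] Int_absorb2 sets.sets_into_space)
  also have "\<dots> < 2 * (e / 4) + 8 * K\<^sup>2 * \<delta>"
    using i small K by (intro add_strict_mono mult_strict_left_mono) (auto simp: B_def dist_real_def)
  also have "\<dots> = e" using K by (simp add: \<delta>_def field_simps)
  finally show ?thesis by (rule that)
qed

text \<open>Uniform continuity on a compact space, with cells of one level in the role of a uniform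
  neighbourhood: finitely many cells of small oscillation cover, and the largest of their levels
  refines them all.\<close>

lemma uniform_cell_approximation:
  fixes f :: "'a \<Rightarrow> 'c :: metric_space"
  assumes "compact_space T" "continuous_map T euclidean f" "e > 0"
  obtains N where "\<And>x y. x \<in> topspace T \<Longrightarrow> y \<in> topspace T \<Longrightarrow> c N x = c N y \<Longrightarrow> dist (f x) (f y) < e"
proof -
  have "\<exists>N. \<forall>y\<in>topspace T. c N y = c N x \<longrightarrow> dist (f x) (f y) < e / 2" if x: "x \<in> topspace T" for x
  proof -
    have "openin T {y \<in> topspace T. f y \<in> ball (f x) (e / 2)}"
      using assms(2) by (intro openin_continuous_map_preimage[where Y = euclidean]) auto
    moreover have "x \<in> {y \<in> topspace T. f y \<in> ball (f x) (e / 2)}" using x \<open>e > 0\<close> by simp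
    ultimately show ?thesis unfolding openin_iff by fastforce
  qed
  then obtain n where n: "\<And>x y. x \<in> topspace T \<Longrightarrow> y \<in> topspace T \<Longrightarrow> c (n x) y = c (n x) x \<Longrightarrow> dist (f x) (f y) < e / 2"
    by metis
  define \<U> where "\<U> = (\<lambda>x. cells (n x) {c (n x) x}) ` topspace T"
  have "\<forall>U\<in>\<U>. openin T U" "topspace T \<subseteq> \<Union>\<U>" using openin_cells by (auto simp: \<U>_def) (auto simp: cells_def)
  then obtain \<F> where \<F>: "finite \<F>" "\<F> \<subseteq> \<U>" "topspace T \<subseteq> \<Union>\<F>"
    using assms(1) unfolding compact_space_alt by metis
  then obtain X where X: "X \<subseteq> topspace T" "finite X" "\<F> = (\<lambda>x. cells (n x) {c (n x) x}) ` X"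
    using finite_subset_image[OF \<F>(1) \<F>(2)[unfolded \<U>_def]] by blast
  define N where "N = Max (insert 0 (n ` X))"
  have nN: "n x \<le> N" if "x \<in> X" for x using X(2) that by (auto simp: N_def)
  have "dist (f x) (f y) < e" if xy: "x \<in> topspace T" "y \<in> topspace T" "c N x = c N y" for x y
  proof -
    obtain z where z: "z \<in> X" "x \<in> cells (n z) {c (n z) z}" using \<F>(3) X(3) xy(1) by auto
    then have "c (n z) x = c (n z) z" by (simp add: cells_def)
    moreover have "c (n z) x = c (n z) y" using refine_le[OF nN[OF z(1)] xy] .
    ultimately have "dist (f z) (f x) < e / 2" "dist (f z) (f y) < e / 2"
      using n[of z x] n[of z y] z(1) X(1) xy by auto
    then show ?thesis using dist_triangle_half_r by blast
  qed
  then show ?thesis by (rule that)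
qed

end

lemma openin_product_discrete:
  "openin (product_topology (\<lambda>i. discrete_topology (S i)) I) U \<longleftrightarrow>
    U \<subseteq> Pi\<^sub>E I S \<and> (\<forall>x\<in>U. \<exists>F. finite F \<and> F \<subseteq> I \<and> (\<forall>y\<in>Pi\<^sub>E I S. restrict y F = restrict x F \<longrightarrow> y \<in> U))"
    (is "?l \<longleftrightarrow> ?r")
proof
  assume l: ?l
  show ?r
  proof (intro conjI ballI)
    show "U \<subseteq> Pi\<^sub>E I S" using openin_subset[OF l] by simp
    fix x assume "x \<in> U"
    then obtain W where W: "finite {i \<in> I. W i \<noteq> S i}" "\<forall>i\<in>I. W i \<subseteq> S i" "x \<in> Pi\<^sub>E I W" "Pi\<^sub>E I W \<subseteq> U"
      using l by (auto simp: openin_product_topology_alt)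
    show "\<exists>F. finite F \<and> F \<subseteq> I \<and> (\<forall>y\<in>Pi\<^sub>E I S. restrict y F = restrict x F \<longrightarrow> y \<in> U)"
    proof (intro exI[of _ "{i \<in> I. W i \<noteq> S i}"] conjI ballI impI)
      fix y assume y: "y \<in> Pi\<^sub>E I S" "restrict y {i \<in> I. W i \<noteq> S i} = restrict x {i \<in> I. W i \<noteq> S i}"
      have "y i \<in> W i" if "i \<in> I" for i
      proof (cases "W i = S i")
        case False
        then have "y i = x i" using y(2) that by (metis (mono_tags, lifting) mem_Collect_eq restrict_apply')
        then show ?thesis using W(3) that by auto
      qed (use y(1) that in auto)
      then show "y \<in> U" using W(4) y(1) by (auto simp: PiE_iff subset_iff)
    qed (use W in auto)
  qed
next
  assume r: ?r
  show ?l unfolding openin_product_topology_alt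
  proof (intro ballI)
    fix x assume x: "x \<in> U"
    then obtain F where F: "finite F" "F \<subseteq> I" "\<forall>y\<in>Pi\<^sub>E I S. restrict y F = restrict x F \<longrightarrow> y \<in> U" using r by blast
    have xS: "x \<in> Pi\<^sub>E I S" using x r by auto
    define W where "W i = (if i \<in> F then {x i} else S i)" for i
    show "\<exists>W. finite {i \<in> I. W i \<noteq> topspace (discrete_topology (S i))} \<and> (\<forall>i\<in>I. openin (discrete_topology (S i)) (W i)) \<and> x \<in> Pi\<^sub>E I W \<and> Pi\<^sub>E I W \<subseteq> U"
    proof (intro exI[of _ W] conjI)
      show "finite {i \<in> I. W i \<noteq> topspace (discrete_topology (S i))}"
        by (rule finite_subset[OF _ F(1)]) (auto simp: W_def)
      show "\<forall>i\<in>I. openin (discrete_topology (S i)) (W i)" using xS F(2) by (auto simp: W_def)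
      show "x \<in> Pi\<^sub>E I W" using xS by (auto simp: W_def PiE_iff)
      show "Pi\<^sub>E I W \<subseteq> U"
      proof
        fix y assume y: "y \<in> Pi\<^sub>E I W"
        have "y \<in> Pi\<^sub>E I S" using y xS F(2) by (auto simp: W_def PiE_iff split: if_splits)
        moreover have "restrict y F = restrict x F" using y F(2) by (auto simp: W_def PiE_iff restrict_def fun_eq_iff split: if_splits)
        ultimately show "y \<in> U" using F(3) by blast
      qed
    qed
  qed
qed

section \<open>The Kronecker system\<close>

lemma translate_0: "translate 0 X = X"
  by (simp add: translate_def)

lemma translate_translate: "translate s (translate t X) = translate (s + t) X"
  by (simp add: translate_def image_image add_ac)

lemma mem_translate: "x \<in> translate t X \<longleftrightarrow> x - t \<in> X"
  by (force simp: translate_def)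

section \<open>Weights of the primes and the sieve estimate\<close>

locale kfree_lattice = unimodular_lattice L B for L :: "(real ^ 'n) set" and B :: "real ^ 'n ^ 'n" +
  fixes k :: nat
  assumes k_pos: "k \<ge> 1" and nontrivial: "\<not> (CARD('n) = 1 \<and> k = 1)"
begin

text \<open>The density of a coset of \<open>q ^ k\<close> times the lattice, and for prime
  \<open>q\<close> the Haar probability that the coordinate at \<open>q\<close> is a prescribed
  coset.\<close>

definition weight :: "nat \<Rightarrow> real" where
  "weight q = 1 / real (q ^ k) ^ CARD('n)"

text \<open>Summing over all integers instead of primes only costs a constant and still gives a
  convergent series, with a simpler index set.\<close>

definition tail :: "nat \<Rightarrow> real" where
  "tail N = (\<Sum>i. weight (i + N))"

text \<open>Here the case \<open>n = k = 1\<close> is excluded: the weights would be the terms of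
  the harmonic series, and already the sum over the primes diverges.\<close>

lemma exponent_ge_2: "k * CARD('n) \<ge> 2"
proof -
  have "CARD('n) \<ge> 1" by (simp add: Suc_leI)
  then consider "CARD('n) \<ge> 2" | "k \<ge> 2" using nontrivial k_pos by linarith
  then show ?thesis
  proof cases
    case 1 then show ?thesis using mult_le_mono[of 1 k 2 "CARD('n)"] k_pos by simp
  next
    case 2 then show ?thesis using mult_le_mono[of 2 k 1 "CARD('n)"] \<open>CARD('n) \<ge> 1\<close> by simp
  qed
qed

lemma weight_eq: "weight q = inverse (real q ^ (k * CARD('n)))"
  by (simp add: weight_def power_mult inverse_eq_divide)

lemma weight_nonneg: "weight q \<ge> 0"
  by (simp add: weight_def)

lemma weight_pos: "q > 0 \<Longrightarrow> weight q > 0"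
  by (simp add: weight_def)

text \<open>Reduces every admissible exponent to the extreme case 2, for which the Euler product is
  compared with a telescoping one.\<close>

lemma weight_le: "weight q \<le> 1 / (real q)\<^sup>2"
proof (cases "q = 0")
  case False
  then have "real q ^ 2 \<le> real q ^ (k * CARD('n))" using exponent_ge_2 by (intro power_increasing) auto
  then show ?thesis using False by (simp add: weight_eq inverse_eq_divide frac_le)
qed (use k_pos in \<open>simp add: weight_def power_0_left\<close>)

lemma summable_weight: "summable weight"
  unfolding weight_eq by (rule inverse_power_summable[OF exponent_ge_2])

lemma tail_limit: "tail \<longlonglongrightarrow> 0"
proof (rule LIMSEQ_I)
  fix r :: real assume "r > 0"
  then show "\<exists>no. \<forall>n\<ge>no. norm (tail n - 0) < r"
    using suminf_exist_split[OF _ summable_weight] by (simp add: tail_def)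
qed

lemma tail_nonneg: "tail N \<ge> 0"
  unfolding tail_def using summable_weight weight_nonneg by (intro suminf_nonneg) (simp_all add: summable_iff_shift)

lemma sum_weight_le_tail:
  assumes "finite J" "J \<subseteq> {N..}"
  shows "sum weight J \<le> tail N"
proof -
  have "J = (\<lambda>i. i + N) ` ((\<lambda>q. q - N) ` J)" using assms by (force simp: image_image)
  then have "sum weight J = sum weight ((\<lambda>i. i + N) ` ((\<lambda>q. q - N) ` J))" by simp
  also have "\<dots> = (\<Sum>i\<in>(\<lambda>q. q - N) ` J. weight (i + N))" by (subst sum.reindex) (auto simp: inj_on_def)
  also have "\<dots> \<le> tail N"
    unfolding tail_def using assms summable_weight weight_nonneg
    by (intro sum_le_suminf) (simp_all add: summable_iff_shift)
  finally show ?thesis .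
qed

text \<open>Excluding \<open>t = x\<close> removes the constant error term from each lattice point count, so that
  the counts can be summed over all \<open>q \<ge> N\<close>.\<close>

lemma sieve_count:
  obtains K where "K > 0" "\<And>N x R. N \<ge> 1 \<Longrightarrow> x \<in> L \<Longrightarrow> R \<ge> 0 \<Longrightarrow>
    real (card {t \<in> L \<inter> ball 0 R. \<exists>q\<ge>N. x - t \<in> multiples (q ^ k) L}) \<le> 1 + K * (R + norm x) ^ CARD('n) * tail N"
proof -
  obtain K where K: "K > 0" "\<And>r :: real. r \<ge> 0 \<Longrightarrow> real (card (L \<inter> ball 0 r - {0})) \<le> K * r ^ CARD('n)"
    using card_punctured_ball_le by blast
  show ?thesis
  proof (rule that[OF K(1)])
    fix N :: nat and x :: "real ^ 'n" and R :: real assume N: "N \<ge> 1" and x: "x \<in> L" and R: "R \<ge> 0"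
    define S where "S = {t \<in> L \<inter> ball 0 R. \<exists>q\<ge>N. x - t \<in> multiples (q ^ k) L} - {x}"
    define S' where "S' q = {t \<in> L \<inter> ball 0 R. x - t \<in> multiples (q ^ k) L} - {x}" for q
    have fin: "finite S" "finite (S' q)" for q
      by (rule finite_subset[OF _ finite_ball[of 0 R]]; auto simp: S_def S'_def)+
    have S'_card: "real (card (S' q)) \<le> K * (R + norm x) ^ CARD('n) * weight q" if q: "q \<ge> N" for q
    proof -
      have qk: "real (q ^ k) > 0" using q N by simp
      \<comment> \<open>A point \<open>t\<close> struck by \<open>q\<close> corresponds to the
        lattice point \<open>(x - t) / q ^ k\<close>. It is nonzero because \<open>t = x\<close> is
        excluded, and its length is below \<open>(R + norm x) / q ^ k\<close>.\<close>
      have "S' q \<subseteq> (\<lambda>y. x - real (q ^ k) *\<^sub>R y) ` (L \<inter> ball 0 ((R + norm x) / real (q ^ k)) - {0})"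
      proof
        fix t assume t: "t \<in> S' q"
        then obtain y where y: "y \<in> L" "x - t = real (q ^ k) *\<^sub>R y" by (auto simp: S'_def multiples_def)
        have "t \<noteq> x" "norm t < R" using t by (auto simp: S'_def)
        have "real (q ^ k) * norm y = norm (x - t)" unfolding y(2) by simp
        also have "\<dots> < R + norm x" using norm_triangle_ineq4[of x t] \<open>norm t < R\<close> by simp
        finally have "norm y < (R + norm x) / real (q ^ k)" using qk by (simp add: pos_less_divide_eq mult.commute)
        moreover have "y \<noteq> 0" using y(2) \<open>t \<noteq> x\<close> by auto
        moreover have "t = x - real (q ^ k) *\<^sub>R y" using y(2) by (simp add: algebra_simps)
        ultimately show "t \<in> (\<lambda>y. x - real (q ^ k) *\<^sub>R y) ` (L \<inter> ball 0 ((R + norm x) / real (q ^ k)) - {0})"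
          using y(1) by auto
      qed
      then have "card (S' q) \<le> card (L \<inter> ball 0 ((R + norm x) / real (q ^ k)) - {0})"
        using finite_ball by (intro surj_card_le) auto
      then have "real (card (S' q)) \<le> K * ((R + norm x) / real (q ^ k)) ^ CARD('n)"
        using K(2)[of "(R + norm x) / real (q ^ k)"] R qk by (simp add: order_trans)
      then show ?thesis by (simp add: weight_def power_divide)
    qed
    have "\<forall>t\<in>S. \<exists>q\<ge>N. t \<in> S' q" by (auto simp: S_def S'_def)
    then obtain q where q: "\<And>t. t \<in> S \<Longrightarrow> q t \<ge> N \<and> t \<in> S' (q t)" by metis
    have "card S \<le> card (\<Union>j\<in>q ` S. S' j)" using fin q by (intro card_mono) auto
    also have "\<dots> \<le> (\<Sum>j\<in>q ` S. card (S' j))" using fin by (intro card_UN_le) auto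
    finally have "real (card S) \<le> (\<Sum>j\<in>q ` S. real (card (S' j)))" by (simp flip: of_nat_sum)
    also have "\<dots> \<le> (\<Sum>j\<in>q ` S. K * (R + norm x) ^ CARD('n) * weight j)"
      using q S'_card by (intro sum_mono) auto
    also have "\<dots> \<le> K * (R + norm x) ^ CARD('n) * tail N"
      unfolding sum_distrib_left[symmetric] using K R q fin
      by (intro mult_left_mono sum_weight_le_tail) auto
    finally have "real (card S) \<le> K * (R + norm x) ^ CARD('n) * tail N" .
    moreover have "card {t \<in> L \<inter> ball 0 R. \<exists>q\<ge>N. x - t \<in> multiples (q ^ k) L} \<le> card S + 1"
    proof -
      have "card {t \<in> L \<inter> ball 0 R. \<exists>q\<ge>N. x - t \<in> multiples (q ^ k) L} \<le> card (insert x S)"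
        using fin by (intro card_mono) (auto simp: S_def)
      also have "\<dots> \<le> card S + 1" using card_insert_le_m1[of "card S + 1" S x] by simp
      finally show ?thesis .
    qed
    ultimately show "real (card {t \<in> L \<inter> ball 0 R. \<exists>q\<ge>N. x - t \<in> multiples (q ^ k) L}) \<le> 1 + K * (R + norm x) ^ CARD('n) * tail N"
      by linarith
  qed
qed

text \<open>The bound \<open>e N\<close> must not depend on \<open>x\<close>, while the count
  involves \<open>norm x\<close> and an additive 1. Beyond \<open>norm x\<close> the radius
  \<open>R + norm x\<close> is at most \<open>2 R\<close>, which gives the factor
  \<open>2 ^ CARD('n)\<close>; once the volume exceeds \<open>N\<close>, the 1 is covered by the
  summand \<open>1 / N\<close>.\<close>

lemma sieve:
  obtains e where "e \<longlonglongrightarrow> 0" "\<And>N x. N \<ge> 1 \<Longrightarrow> x \<in> L \<Longrightarrow>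
    \<forall>\<^sub>F R in at_top. real (card {t \<in> L \<inter> ball 0 R. \<exists>q\<ge>N. x - t \<in> multiples (q ^ k) L}) / ball_vol TYPE('n) R \<le> e N"
proof -
  obtain K where K: "K > 0" "\<And>N x R. N \<ge> 1 \<Longrightarrow> x \<in> L \<Longrightarrow> R \<ge> 0 \<Longrightarrow>
    real (card {t \<in> L \<inter> ball 0 R. \<exists>q\<ge>N. x - t \<in> multiples (q ^ k) L}) \<le> 1 + K * (R + norm x) ^ CARD('n) * tail N"
    using sieve_count by blast
  define u where "u = measure lborel (ball (0 :: real ^ 'n) 1)"
  have u: "u > 0" using unit_ball_pos by (simp add: u_def)
  define e where "e N = K / u * 2 ^ CARD('n) * tail N + 1 / real N" for N
  have "(\<lambda>N. K / u * 2 ^ CARD('n) * tail N + 1 / real N) \<longlonglongrightarrow> K / u * 2 ^ CARD('n) * 0 + 0"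
    by (intro tendsto_intros tail_limit lim_1_over_n)
  then have e: "e \<longlonglongrightarrow> 0" by (simp add: e_def[abs_def])
  show ?thesis
  proof (rule that[OF e])
    fix N :: nat and x :: "real ^ 'n" assume N: "N \<ge> 1" and x: "x \<in> L"
    show "\<forall>\<^sub>F R in at_top. real (card {t \<in> L \<inter> ball 0 R. \<exists>q\<ge>N. x - t \<in> multiples (q ^ k) L}) / ball_vol TYPE('n) R \<le> e N"
      using eventually_ge_at_top[of "max 1 (max (norm x) (N / u))"]
    proof eventually_elim
      case (elim R)
      then have R: "R \<ge> 1" "R \<ge> norm x" "R \<ge> N / u" by auto
      define v where "v = ball_vol TYPE('n) R"
      have v: "v = u * R ^ CARD('n)" by (simp add: v_def ball_vol_def u_def)
      have "v > 0" using v u R by simp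
      have "R \<le> R ^ CARD('n)" using R by (intro self_le_power) auto
      then have "real N / u \<le> R ^ CARD('n)" using R by linarith
      then have "real N \<le> v" using u by (simp add: v pos_divide_le_eq mult.commute)
      then have one: "1 \<le> (1 / real N) * v" using N by (simp add: field_simps)
      have "K * (R + norm x) ^ CARD('n) * tail N \<le> K * (2 * R) ^ CARD('n) * tail N"
        using K R tail_nonneg by (intro mult_right_mono mult_left_mono power_mono) auto
      also have "\<dots> = K / u * 2 ^ CARD('n) * tail N * v"
        using u by (simp add: v power_mult_distrib)
      finally have "1 + K * (R + norm x) ^ CARD('n) * tail N \<le> e N * v"
        using one by (simp add: e_def distrib_right)
      then have "real (card {t \<in> L \<inter> ball 0 R. \<exists>q\<ge>N. x - t \<in> multiples (q ^ k) L}) \<le> e N * v"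
        using K(2)[OF N x, of R] R by linarith
      then show ?case using \<open>v > 0\<close> by (simp add: v_def[symmetric] pos_divide_le_eq)
    qed
  qed
qed

section \<open>The Kronecker group as a space of residue systems\<close>

abbreviation primes_below :: "nat \<Rightarrow> nat set" where
  "primes_below N \<equiv> {p. prime p \<and> p < N}"

definition residues :: "(nat \<Rightarrow> (real ^ 'n) set) set" where
  "residues = (\<Pi>\<^sub>E p\<in>{p. prime p}. cosets (p ^ k))"

definition embed :: "real ^ 'n \<Rightarrow> nat \<Rightarrow> (real ^ 'n) set" where
  "embed x = (\<lambda>p\<in>{p. prime p}. coset (p ^ k) x)"

definition label :: "nat \<Rightarrow> (nat \<Rightarrow> (real ^ 'n) set) \<Rightarrow> nat \<Rightarrow> (real ^ 'n) set" where
  "label N g = restrict g (primes_below N)"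

definition shift :: "real ^ 'n \<Rightarrow> (nat \<Rightarrow> (real ^ 'n) set) \<Rightarrow> nat \<Rightarrow> (real ^ 'n) set" where
  "shift x g = (\<lambda>p\<in>{p. prime p}. translate x (g p))"

lemma finite_primes_below: "finite (primes_below N)"
  by (rule finite_subset[of _ "{..<N}"]) auto

lemma carrier_Mod: "carrier (lattice_group L Mod multiples m L) = cosets m"
  by (auto simp: FactGroup_def RCOSETS_def r_coset_def lattice_group_def cosets_def coset_def)

lemma r_coset_eq: "multiples m L #>\<^bsub>lattice_group L\<^esub> x = coset m x"
  by (auto simp: r_coset_def lattice_group_def coset_def)

lemma set_mult_coset: "coset m a <#>\<^bsub>lattice_group L\<^esub> coset m b = coset m (a + b)"
proof (intro equalityI subsetI)
  fix z assume "z \<in> coset m a <#>\<^bsub>lattice_group L\<^esub> coset m b"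
  then obtain x y where "x - a \<in> multiples m L" "y - b \<in> multiples m L" "z = x + y"
    by (auto simp: set_mult_def lattice_group_def mem_coset)
  then show "z \<in> coset m (a + b)" using multiples_add[of "x - a" m "y - b"] by (simp add: mem_coset algebra_simps)
next
  fix z assume "z \<in> coset m (a + b)"
  then have "z - b \<in> coset m a" by (simp add: mem_coset algebra_simps)
  moreover have "z = (z - b) + b" by simp
  ultimately show "z \<in> coset m a <#>\<^bsub>lattice_group L\<^esub> coset m b"
    using self_mem_coset[of b m] unfolding set_mult_def lattice_group_def by fastforce
qed

lemma carrier_kronecker_group: "carrier (kronecker_group L k) = residues"
  by (auto simp: kronecker_group_def residues_def carrier_Mod)

lemma topspace_kronecker_topology: "topspace (kronecker_topology L k) = residues"
  by (simp add: kronecker_topology_def residues_def carrier_Mod)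

lemma kronecker_mult:
  "g \<otimes>\<^bsub>kronecker_group L k\<^esub> h = (\<lambda>p\<in>{p. prime p}. g p <#>\<^bsub>lattice_group L\<^esub> h p)"
  by (simp add: kronecker_group_def FactGroup_def)

lemma residuesD: "g \<in> residues \<Longrightarrow> prime p \<Longrightarrow> g p \<in> cosets (p ^ k)"
  by (auto simp: residues_def)

lemma residues_eqI: "g \<in> residues \<Longrightarrow> h \<in> residues \<Longrightarrow> (\<And>p. prime p \<Longrightarrow> g p = h p) \<Longrightarrow> g = h"
  unfolding residues_def by (rule PiE_ext) auto

lemma embed_in: "x \<in> L \<Longrightarrow> embed x \<in> residues"
  by (auto simp: embed_def residues_def coset_in_cosets)

lemma translate_in_cosets: "x \<in> L \<Longrightarrow> C \<in> cosets m \<Longrightarrow> translate x C \<in> cosets m"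
  by (elim cosetsE) (simp add: translate_coset coset_in_cosets add_in)

lemma shift_in: "x \<in> L \<Longrightarrow> g \<in> residues \<Longrightarrow> shift x g \<in> residues"
  by (subst residues_def) (auto simp: shift_def residuesD translate_in_cosets)

lemma set_mult_translate: "C \<in> cosets m \<Longrightarrow> C <#>\<^bsub>lattice_group L\<^esub> coset m x = translate x C"
  by (elim cosetsE) (simp add: set_mult_coset translate_coset)

lemma mult_embed: "g \<in> residues \<Longrightarrow> g \<otimes>\<^bsub>kronecker_group L k\<^esub> embed x = shift x g"
  by (simp add: kronecker_mult shift_def embed_def set_mult_translate residuesD fun_eq_iff)

lemma kronecker_action_eq: "g \<in> residues \<Longrightarrow> kronecker_action L k x g = shift x g"
  using mult_embed[of g x] by (simp add: kronecker_action_def r_coset_eq embed_def)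

lemma coprime_prime_powers:
  "P \<subseteq> {p. prime p} \<Longrightarrow> pairwise (\<lambda>p q. coprime (p ^ k) (q ^ k :: nat)) P"
  by (auto simp: pairwise_def subset_iff primes_coprime coprime_power_left_iff coprime_power_right_iff)

text \<open>The Chinese remainder theorem as density of the diagonal image of the lattice. It allows
  any question about finitely many coordinates to be answered by a single lattice point.\<close>

lemma embed_dense:
  assumes "g \<in> residues"
  shows "\<exists>x\<in>L. \<forall>p\<in>primes_below N. g p = coset (p ^ k) x"
proof -
  have "\<forall>p\<in>primes_below N. \<exists>a\<in>L. g p = coset (p ^ k) a"
    using residuesD[OF assms] by (auto simp: cosets_def)
  then obtain a where a: "\<And>p. p \<in> primes_below N \<Longrightarrow> a p \<in> L \<and> g p = coset (p ^ k) (a p)" by metis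
  obtain x where "x \<in> L" "\<forall>p\<in>primes_below N. x - a p \<in> multiples (p ^ k) L"
    using chinese_remainder[OF finite_primes_below coprime_prime_powers, of N a] a by auto
  then show ?thesis using a by (auto simp: coset_eq_iff[symmetric] intro!: bexI[of _ x])
qed

lemma label_eq_iff: "label N g = label N h \<longleftrightarrow> (\<forall>p\<in>primes_below N. g p = h p)"
proof (intro iffI ballI)
  fix p assume "label N g = label N h" "p \<in> primes_below N"
  then have "label N g p = label N h p" by simp
  then show "g p = h p" using \<open>p \<in> primes_below N\<close> by (simp add: label_def)
qed (auto simp: label_def intro!: restrict_ext)

lemma finite_label_residues: "finite (label N ` residues)"
proof (rule finite_subset)
  show "label N ` residues \<subseteq> (\<Pi>\<^sub>E p\<in>primes_below N. cosets (p ^ k))"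
    by (intro image_subsetI) (simp add: label_def restrict_PiE_iff residuesD)
  show "finite (\<Pi>\<^sub>E p\<in>primes_below N. cosets (p ^ k))"
    by (intro finite_PiE finite_primes_below finite_cosets) (auto simp: prime_gt_0_nat)
qed

lemma kronecker_cell_system: "cell_system (kronecker_topology L k) label"
proof
  show "finite (label N ` topspace (kronecker_topology L k))" for N
    by (simp add: topspace_kronecker_topology finite_label_residues)
  show "label (Suc N) x = label (Suc N) y \<Longrightarrow> label N x = label N y" for N x y
    by (auto simp: label_eq_iff)
  fix U
  have *: "(\<exists>F. finite F \<and> F \<subseteq> {p. prime p} \<and> (\<forall>y\<in>residues. restrict y F = restrict x F \<longrightarrow> y \<in> U)) \<longleftrightarrow>
      (\<exists>N. \<forall>y\<in>residues. label N y = label N x \<longrightarrow> y \<in> U)" for x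
  proof
    assume "\<exists>F. finite F \<and> F \<subseteq> {p. prime p} \<and> (\<forall>y\<in>residues. restrict y F = restrict x F \<longrightarrow> y \<in> U)"
    then obtain F where F: "finite F" "F \<subseteq> {p. prime p}" "\<forall>y\<in>residues. restrict y F = restrict x F \<longrightarrow> y \<in> U" by blast
    obtain N where N: "\<forall>p\<in>F. p < N" using F(1) finite_nat_set_iff_bounded by blast
    have "restrict y F = restrict x F" if "label N y = label N x" for y
      using that N F(2) by (intro restrict_ext) (auto simp: label_eq_iff)
    then show "\<exists>N. \<forall>y\<in>residues. label N y = label N x \<longrightarrow> y \<in> U" using F(3) by blast
  next
    assume "\<exists>N. \<forall>y\<in>residues. label N y = label N x \<longrightarrow> y \<in> U"
    then obtain N where "\<forall>y\<in>residues. label N y = label N x \<longrightarrow> y \<in> U" by blast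
    then show "\<exists>F. finite F \<and> F \<subseteq> {p. prime p} \<and> (\<forall>y\<in>residues. restrict y F = restrict x F \<longrightarrow> y \<in> U)"
      using finite_primes_below[of N] by (intro exI[of _ "primes_below N"]) (auto simp: label_def)
  qed
  show "openin (kronecker_topology L k) U \<longleftrightarrow> U \<subseteq> topspace (kronecker_topology L k) \<and>
      (\<forall>x\<in>U. \<exists>N. \<forall>y\<in>topspace (kronecker_topology L k). label N y = label N x \<longrightarrow> y \<in> U)"
    unfolding topspace_kronecker_topology *[symmetric]
    unfolding kronecker_topology_def openin_product_discrete carrier_Mod residues_def ..
qed

sublocale kronecker: cell_system "kronecker_topology L k" label
  by (rule kronecker_cell_system)

subsection \<open>Haar measure\<close>

text \<open>The base is \<^term>\<open>max 1 p\<close> only to have a probability space also at the index \<open>0\<close>.\<close>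

definition product_measure :: "(nat \<Rightarrow> (real ^ 'n) set) measure" where
  "product_measure = PiM {p. prime p} (\<lambda>p. uniform_count_measure (cosets (max 1 p ^ k)))"

lemma product_prob_space: "product_prob_space (\<lambda>p. uniform_count_measure (cosets (max 1 p ^ k)))"
proof -
  have "prob_space (uniform_count_measure (cosets (max 1 p ^ k)))" for p
    using zero_in
    by (intro prob_space_uniform_count_measure finite_cosets) (auto simp: cosets_def)
  then show ?thesis
    by (intro product_prob_space.intro product_sigma_finite.intro product_prob_space_axioms.intro prob_space_imp_sigma_finite)
qed

lemma space_product_measure: "space product_measure = residues"
  by (auto simp: product_measure_def residues_def space_PiM space_uniform_count_measure max_def
      intro!: PiE_cong dest: prime_ge_1_nat)

lemma prob_space_product_measure: "prob_space product_measure"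
proof -
  interpret product_prob_space "\<lambda>p. uniform_count_measure (cosets (max 1 p ^ k))" "{p. prime p}"
    by (rule product_prob_space)
  show ?thesis unfolding product_measure_def by (rule P.prob_space_axioms)
qed

text \<open>Both sigma-algebras are generated by conditions on finitely many coordinates. The
  coordinate \<open>i\<close> is seen from level \<open>Suc i\<close> on, since \<open>label\<close>
  keeps the primes strictly below its level.\<close>

lemma sets_product_measure: "sets product_measure = sets (borel_algebra (kronecker_topology L k))"
proof -
  have eq: "product_measure = PiM {p. prime p} (\<lambda>p. uniform_count_measure (cosets (p ^ k)))"
    unfolding product_measure_def by (rule PiM_cong) (auto simp: max_def dest: prime_ge_1_nat)
  have single: "sets product_measure = sigma_sets residues {{f \<in> residues. f i \<in> A} | i A. prime i \<and> A \<subseteq> cosets (i ^ k)}"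
    by (simp add: eq sets_PiM_single space_uniform_count_measure sets_uniform_count_measure residues_def)
  show ?thesis unfolding single kronecker.sets_borel_eq topspace_kronecker_topology
  proof (rule sigma_sets_eqI)
    fix U assume "U \<in> {{f \<in> residues. f i \<in> A} | i A. prime i \<and> A \<subseteq> cosets (i ^ k)}"
    then obtain i A where U: "prime i" "U = {f \<in> residues. f i \<in> A}" by blast
    then have "U = kronecker.cells (Suc i) {w. w i \<in> A}"
      by (auto simp: kronecker.cells_def topspace_kronecker_topology label_def)
    then show "U \<in> sigma_sets residues (range (case_prod kronecker.cells))"
      by (auto intro!: sigma_sets.Basic image_eqI[where x = "(Suc i, {w. w i \<in> A})"])
  next
    fix U assume "U \<in> range (case_prod kronecker.cells)"
    then obtain N W where U: "U = kronecker.cells N W" by auto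
    have cell: "{g \<in> residues. label N g = label N w} \<in> sets product_measure" if "w \<in> residues" for w
    proof -
      have "{g \<in> residues. label N g = label N w} = {g \<in> residues. \<forall>p\<in>primes_below N. g p = w p}"
        by (auto simp: label_eq_iff)
      also have "\<dots> = {g \<in> space product_measure. \<forall>p\<in>primes_below N. g p = w p}"
        by (simp add: space_product_measure)
      also have "\<dots> \<in> sets product_measure"
      proof (intro sets.sets_Collect_finite_All finite_primes_below)
        fix p assume p: "p \<in> primes_below N"
        have "{g \<in> space product_measure. g p = w p} = {f \<in> residues. f p \<in> {w p}}" by (auto simp: space_product_measure)
        also have "\<dots> \<in> sets product_measure"
          unfolding single using p residuesD[OF that] by (intro sigma_sets.Basic) blast
        finally show "{g \<in> space product_measure. g p = w p} \<in> sets product_measure" .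
      qed
      finally show ?thesis .
    qed
    have "U = (\<Union>v\<in>label N ` residues \<inter> W. {g \<in> residues. label N g = v})"
      by (auto simp: U kronecker.cells_def topspace_kronecker_topology)
    also have "\<dots> \<in> sets product_measure"
      using cell finite_label_residues by (intro sets.finite_UN) auto
    finally show "U \<in> sigma_sets residues {{f \<in> residues. f i \<in> A} | i A. prime i \<and> A \<subseteq> cosets (i ^ k)}"
      unfolding single .
  qed
qed

lemma measure_coordinates:
  assumes "finite J" "J \<subseteq> {p. prime p}" "\<And>p. p \<in> J \<Longrightarrow> w p \<in> cosets (p ^ k)"
  shows "measure product_measure {g \<in> residues. \<forall>p\<in>J. g p = w p} = (\<Prod>p\<in>J. weight p)"
proof -
  interpret product_prob_space "\<lambda>p. uniform_count_measure (cosets (max 1 p ^ k))" "{p. prime p}"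
    by (rule product_prob_space)
  have max1: "max 1 p = p" if "p \<in> J" for p using that assms(2) prime_ge_1_nat by (auto simp: max_def)
  have "emb {p. prime p} J (\<Pi>\<^sub>E p\<in>J. {w p}) = {g \<in> residues. \<forall>p\<in>J. g p = w p}"
    using assms(2) space_product_measure
    by (auto simp: prod_emb_def product_measure_def space_PiM PiE_iff restrict_def extensional_def)
  then have "measure product_measure {g \<in> residues. \<forall>p\<in>J. g p = w p} =
      (\<Prod>p\<in>J. measure (uniform_count_measure (cosets (max 1 p ^ k))) {w p})"
    using measure_PiM_emb[OF assms(2,1), of "\<lambda>p. {w p}"] assms(3) max1
    by (simp add: product_measure_def sets_uniform_count_measure)
  also have "\<dots> = (\<Prod>p\<in>J. weight p)"
  proof (rule prod.cong[OF refl])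
    fix p assume p: "p \<in> J"
    then have "p ^ k > 0" using assms(2) prime_gt_0_nat by auto
    then show "measure (uniform_count_measure (cosets (max 1 p ^ k))) {w p} = weight p"
      unfolding max1[OF p] using assms(3)[OF p] finite_cosets[of "p ^ k"] card_cosets[of "p ^ k"]
      by (simp add: measure_uniform_count_measure weight_def)
  qed
  finally show ?thesis .
qed

lemma cells_singleton:
  "v \<in> label N ` residues \<Longrightarrow> kronecker.cells N {v} = {g \<in> residues. \<forall>p\<in>primes_below N. g p = v p}"
  by (auto simp: kronecker.cells_def topspace_kronecker_topology label_def restrict_def fun_eq_iff)

lemma label_value: "v \<in> label N ` residues \<Longrightarrow> p \<in> primes_below N \<Longrightarrow> v p \<in> cosets (p ^ k)"
  by (auto simp: label_def residuesD)

lemma measure_cell: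
  "v \<in> label N ` residues \<Longrightarrow> measure product_measure (kronecker.cells N {v}) = (\<Prod>p\<in>primes_below N. weight p)"
  unfolding cells_singleton by (rule measure_coordinates) (auto simp: finite_primes_below intro: label_value)

lemma kronecker_mult_in:
  assumes "g \<in> residues" "h \<in> residues"
  shows "g \<otimes>\<^bsub>kronecker_group L k\<^esub> h \<in> residues"
proof -
  have "g p <#>\<^bsub>lattice_group L\<^esub> h p \<in> cosets (p ^ k)" if "prime p" for p
    using residuesD[OF assms(1) that] residuesD[OF assms(2) that]
    by (elim cosetsE) (simp add: set_mult_coset coset_in_cosets add_in)
  then show ?thesis by (auto simp: kronecker_mult residues_def)
qed

text \<open>These two cancellation laws turn images under multiplication by \<open>h\<close> into
  preimages under multiplication by \<open>h'\<close>, to which distributions apply.\<close>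

lemma kronecker_inverse:
  assumes "h \<in> residues"
  obtains h' where "h' \<in> residues"
    "\<And>g. g \<in> residues \<Longrightarrow> g \<otimes>\<^bsub>kronecker_group L k\<^esub> h \<otimes>\<^bsub>kronecker_group L k\<^esub> h' = g"
    "\<And>g. g \<in> residues \<Longrightarrow> g \<otimes>\<^bsub>kronecker_group L k\<^esub> h' \<otimes>\<^bsub>kronecker_group L k\<^esub> h = g"
proof -
  have "\<forall>p\<in>{p. prime p}. \<exists>a\<in>L. h p = coset (p ^ k) a"
    using residuesD[OF assms] by (auto simp: cosets_def)
  then obtain a where a: "\<And>p. prime p \<Longrightarrow> a p \<in> L \<and> h p = coset (p ^ k) (a p)" by (metis mem_Collect_eq)
  define h' where "h' = (\<lambda>p\<in>{p. prime p}. coset (p ^ k) (- a p))"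
  have h': "h' \<in> residues" using a by (auto simp: h'_def residues_def coset_in_cosets minus_in)
  have "g p <#>\<^bsub>lattice_group L\<^esub> h p <#>\<^bsub>lattice_group L\<^esub> h' p = g p"
    "g p <#>\<^bsub>lattice_group L\<^esub> h' p <#>\<^bsub>lattice_group L\<^esub> h p = g p" if "g \<in> residues" "prime p" for g p
    using residuesD[OF that] a[OF that(2)] that(2)
    by (auto simp: h'_def cosets_def set_mult_coset)
  then show ?thesis
    by (intro that[OF h'] residues_eqI kronecker_mult_in h' assms) (auto simp: kronecker_mult)
qed

text \<open>On the finitely many primes below \<open>N\<close>, multiplication by \<open>h\<close>
  is translation by a lattice point \<open>t\<close>, so pulling back a cell translates its label by
  \<open>- t\<close>.\<close>

lemma mult_cell_preimage:
  assumes "h \<in> residues" "v \<in> label N ` residues"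
  obtains v' where "v' \<in> label N ` residues"
    "{g \<in> residues. g \<otimes>\<^bsub>kronecker_group L k\<^esub> h \<in> kronecker.cells N {v}} = kronecker.cells N {v'}"
proof -
  obtain t where t: "t \<in> L" "\<forall>p\<in>primes_below N. h p = coset (p ^ k) t"
      using embed_dense[OF assms(1), of N] by blast
  obtain w where w: "w \<in> residues" "v = label N w" using assms(2) by auto
  define v' where "v' = label N (shift (- t) w)"
  have v': "v' \<in> label N ` residues" unfolding v'_def by (intro imageI shift_in minus_in t w)
  have eq: "(g \<otimes>\<^bsub>kronecker_group L k\<^esub> h) p = v p \<longleftrightarrow> g p = v' p" if "g \<in> residues" "p \<in> primes_below N" for g p
  proof -
    have "(g \<otimes>\<^bsub>kronecker_group L k\<^esub> h) p = translate t (g p)"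
      using that bspec[OF t(2) that(2)] residuesD[OF that(1)] by (simp add: kronecker_mult set_mult_translate)
    moreover have "translate t (g p) = w p \<longleftrightarrow> g p = translate (- t) (w p)"
      by (metis translate_0 translate_translate add.left_inverse add.right_inverse)
    ultimately show ?thesis using that by (simp add: v'_def w(2) label_def shift_def)
  qed
  have "{g \<in> residues. g \<otimes>\<^bsub>kronecker_group L k\<^esub> h \<in> kronecker.cells N {v}} = kronecker.cells N {v'}"
    unfolding cells_singleton[OF v'] cells_singleton[OF assms(2)]
    by (rule Collect_cong) (use kronecker_mult_in[OF _ assms(1)] eq in blast)
  then show ?thesis using that v' by blast
qed

lemma measurable_kronecker_mult:
  assumes "h \<in> residues"
  shows "(\<lambda>g. g \<otimes>\<^bsub>kronecker_group L k\<^esub> h) \<in> measurable product_measure product_measure"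
proof -
  have "(\<lambda>g. g \<otimes>\<^bsub>kronecker_group L k\<^esub> h) \<in> measurable product_measure (borel_algebra (kronecker_topology L k))"
  proof (rule kronecker.measurable_into)
    fix N v assume v: "v \<in> label N ` topspace (kronecker_topology L k)"
    then obtain v' where "v' \<in> label N ` residues"
      "{g \<in> residues. g \<otimes>\<^bsub>kronecker_group L k\<^esub> h \<in> kronecker.cells N {v}} = kronecker.cells N {v'}"
      using mult_cell_preimage[OF assms, of v N] by (auto simp: topspace_kronecker_topology)
    moreover have "{g \<in> space product_measure. label N (g \<otimes>\<^bsub>kronecker_group L k\<^esub> h) = v} =
        {g \<in> residues. g \<otimes>\<^bsub>kronecker_group L k\<^esub> h \<in> kronecker.cells N {v}}"
      using kronecker_mult_in[OF _ assms] by (auto simp: space_product_measure kronecker.cells_def topspace_kronecker_topology)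
    ultimately show "{g \<in> space product_measure. label N (g \<otimes>\<^bsub>kronecker_group L k\<^esub> h) = v} \<in> sets product_measure"
      using kronecker.cells_in_sets by (simp add: sets_product_measure)
  qed (use kronecker_mult_in[OF _ assms] in \<open>auto simp: space_product_measure topspace_kronecker_topology\<close>)
  then show ?thesis by (simp add: measurable_cong_sets[OF refl sets_product_measure])
qed

lemma distr_kronecker_mult:
  assumes "h \<in> residues"
  shows "distr product_measure product_measure (\<lambda>g. g \<otimes>\<^bsub>kronecker_group L k\<^esub> h) = product_measure"
proof (rule kronecker.measure_eqI_cells)
  interpret prob_space product_measure by (rule prob_space_product_measure)
  show "prob_space (distr product_measure product_measure (\<lambda>g. g \<otimes>\<^bsub>kronecker_group L k\<^esub> h))"
    by (rule prob_space_distr[OF measurable_kronecker_mult[OF assms]])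
  fix N v assume "v \<in> label N ` topspace (kronecker_topology L k)"
  then have v: "v \<in> label N ` residues" by (simp add: topspace_kronecker_topology)
  obtain v' where v': "v' \<in> label N ` residues"
      "{g \<in> residues. g \<otimes>\<^bsub>kronecker_group L k\<^esub> h \<in> kronecker.cells N {v}} = kronecker.cells N {v'}"
    by (rule mult_cell_preimage[OF assms v])
  have "measure (distr product_measure product_measure (\<lambda>g. g \<otimes>\<^bsub>kronecker_group L k\<^esub> h)) (kronecker.cells N {v})
      = measure product_measure {g \<in> residues. g \<otimes>\<^bsub>kronecker_group L k\<^esub> h \<in> kronecker.cells N {v}}"
    using kronecker.cells_in_sets
    by (subst measure_distr[OF measurable_kronecker_mult[OF assms]])
      (auto simp: sets_product_measure space_product_measure vimage_def Int_def conj_commute)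
  then show "measure (distr product_measure product_measure (\<lambda>g. g \<otimes>\<^bsub>kronecker_group L k\<^esub> h)) (kronecker.cells N {v})
      = measure product_measure (kronecker.cells N {v})"
    using measure_cell v v' by simp
qed (auto simp: sets_product_measure prob_space_product_measure)

lemma product_measure_invariant:
  assumes "h \<in> residues" "A \<in> sets product_measure"
  shows "emeasure product_measure ((\<lambda>g. g \<otimes>\<^bsub>kronecker_group L k\<^esub> h) ` A) = emeasure product_measure A"
proof -
  obtain h' where h': "h' \<in> residues"
    "\<And>g. g \<in> residues \<Longrightarrow> g \<otimes>\<^bsub>kronecker_group L k\<^esub> h \<otimes>\<^bsub>kronecker_group L k\<^esub> h' = g"
    "\<And>g. g \<in> residues \<Longrightarrow> g \<otimes>\<^bsub>kronecker_group L k\<^esub> h' \<otimes>\<^bsub>kronecker_group L k\<^esub> h = g"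
    using kronecker_inverse[OF assms(1)] by blast
  have AX: "A \<subseteq> residues" using sets.sets_into_space[OF assms(2)] by (simp add: space_product_measure)
  have "(\<lambda>g. g \<otimes>\<^bsub>kronecker_group L k\<^esub> h) ` A = (\<lambda>g. g \<otimes>\<^bsub>kronecker_group L k\<^esub> h') -` A \<inter> space product_measure"
  proof (intro equalityI subsetI)
    fix z assume "z \<in> (\<lambda>g. g \<otimes>\<^bsub>kronecker_group L k\<^esub> h) ` A"
    then show "z \<in> (\<lambda>g. g \<otimes>\<^bsub>kronecker_group L k\<^esub> h') -` A \<inter> space product_measure"
      using h'(2) AX kronecker_mult_in[OF _ assms(1)] by (auto simp: space_product_measure subset_iff)
  next
    fix z assume "z \<in> (\<lambda>g. g \<otimes>\<^bsub>kronecker_group L k\<^esub> h') -` A \<inter> space product_measure"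
    then show "z \<in> (\<lambda>g. g \<otimes>\<^bsub>kronecker_group L k\<^esub> h) ` A"
      using h'(3)[of z] by (auto simp: space_product_measure intro!: image_eqI[where x = "z \<otimes>\<^bsub>kronecker_group L k\<^esub> h'"])
  qed
  then have "emeasure product_measure ((\<lambda>g. g \<otimes>\<^bsub>kronecker_group L k\<^esub> h) ` A) =
      emeasure (distr product_measure product_measure (\<lambda>g. g \<otimes>\<^bsub>kronecker_group L k\<^esub> h')) A"
    using emeasure_distr[OF measurable_kronecker_mult[OF h'(1)] assms(2)] by simp
  then show ?thesis by (simp add: distr_kronecker_mult[OF h'(1)])
qed

text \<open>A lattice translation moves any cell of level \<open>N\<close> into any other one, so an
  invariant measure gives all of them the same mass. This is the uniqueness half of the description
  of Haar measure.\<close>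

lemma invariant_measure_cell:
  assumes M: "prob_space M" "sets M = sets (borel_algebra (kronecker_topology L k))"
    and inv: "\<forall>g\<in>residues. \<forall>A\<in>sets M. emeasure M ((\<lambda>h. h \<otimes>\<^bsub>kronecker_group L k\<^esub> g) ` A) = emeasure M A"
    and v: "v \<in> label N ` residues"
  shows "measure M (kronecker.cells N {v}) = 1 / card (label N ` residues)"
proof -
  interpret prob_space M by fact
  have cs: "kronecker.cells N W \<in> sets M" for W using kronecker.cells_in_sets M(2) by simp
  have le: "measure M (kronecker.cells N {v}) \<le> measure M (kronecker.cells N {v'})"
    if v: "v \<in> label N ` residues" and v': "v' \<in> label N ` residues" for v v'
  proof -
    obtain w w' where w: "w \<in> residues" "v = label N w" "w' \<in> residues" "v' = label N w'" using v v' by auto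
    obtain t where t: "t \<in> L" "\<forall>p\<in>primes_below N. w p = coset (p ^ k) t"
      using embed_dense[OF w(1), of N] by blast
    obtain t' where t': "t' \<in> L" "\<forall>p\<in>primes_below N. w' p = coset (p ^ k) t'"
      using embed_dense[OF w(3), of N] by blast
    define s where "s = t' - t"
    have s: "s \<in> L" unfolding s_def by (intro diff_in t t')
    have "(\<lambda>h. h \<otimes>\<^bsub>kronecker_group L k\<^esub> embed s) ` kronecker.cells N {v} \<subseteq> kronecker.cells N {v'}"
    proof (intro image_subsetI)
      fix h assume "h \<in> kronecker.cells N {v}"
      then have h: "h \<in> residues" "\<And>p. p \<in> primes_below N \<Longrightarrow> h p = coset (p ^ k) t"
        using t(2) w(2) v by (auto simp: cells_singleton label_def)
      have "label N (shift s h) = label N w'"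
        using h(2) t'(2) by (auto simp: label_eq_iff shift_def translate_coset s_def)
      then show "h \<otimes>\<^bsub>kronecker_group L k\<^esub> embed s \<in> kronecker.cells N {v'}"
        using shift_in[OF s h(1)] by (simp add: mult_embed[OF h(1)] kronecker.cells_def topspace_kronecker_topology w(4))
    qed
    then have "emeasure M ((\<lambda>h. h \<otimes>\<^bsub>kronecker_group L k\<^esub> embed s) ` kronecker.cells N {v}) \<le> emeasure M (kronecker.cells N {v'})"
      by (rule emeasure_mono[OF _ cs])
    then show ?thesis using inv embed_in[OF s] cs by (simp add: emeasure_eq_measure)
  qed
  have "1 = measure M (kronecker.cells N UNIV)"
    using prob_space sets_eq_imp_space_eq[OF M(2)] by (simp add: kronecker.cells_def space_borel_algebra)
  also have "\<dots> = (\<Sum>v'\<in>label N ` residues. measure M (kronecker.cells N {v'}))"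
    using kronecker.measure_cells[OF finite_measure_axioms M(2), of N UNIV] by (simp add: topspace_kronecker_topology)
  also have "\<dots> = (\<Sum>v'\<in>label N ` residues. measure M (kronecker.cells N {v}))"
    using le v by (intro sum.cong refl antisym) auto
  finally have "1 = card (label N ` residues) * measure M (kronecker.cells N {v})" by simp
  then show ?thesis by (metis nonzero_eq_divide_eq mult.commute mult_zero_right zero_neq_one)
qed

text \<open>\<open>haar_measure\<close> is a definite description: the product measure satisfies it,
  and every measure satisfying it has the same values on cells.\<close>

lemma kronecker_measure_eq: "kronecker_measure L k = product_measure"
  unfolding kronecker_measure_def haar_measure_def carrier_kronecker_group
proof (rule the_equality, intro conjI ballI)
  show "prob_space product_measure" by (rule prob_space_product_measure)
  show "space product_measure = topspace (kronecker_topology L k)"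
    by (simp add: space_product_measure topspace_kronecker_topology)
  show "sets product_measure = sets (borel_algebra (kronecker_topology L k))" by (rule sets_product_measure)
  show "emeasure product_measure ((\<lambda>h. h \<otimes>\<^bsub>kronecker_group L k\<^esub> g) ` A) = emeasure product_measure A"
    if "g \<in> residues" "A \<in> sets product_measure" for g A
    using that by (rule product_measure_invariant)
  fix M
  assume M: "prob_space M \<and> space M = topspace (kronecker_topology L k) \<and>
    sets M = sets (borel_algebra (kronecker_topology L k)) \<and>
    (\<forall>g\<in>residues. \<forall>A\<in>sets M. emeasure M ((\<lambda>h. h \<otimes>\<^bsub>kronecker_group L k\<^esub> g) ` A) = emeasure M A)"
  show "M = product_measure"
  proof (rule kronecker.measure_eqI_cells)
    fix N v assume "v \<in> label N ` topspace (kronecker_topology L k)"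
    then show "measure M (kronecker.cells N {v}) = measure product_measure (kronecker.cells N {v})"
      using M invariant_measure_cell[of M v N] product_measure_invariant
        invariant_measure_cell[OF prob_space_product_measure sets_product_measure, of v N]
      by (simp add: topspace_kronecker_topology)
  qed (use M in \<open>auto simp: sets_product_measure prob_space_product_measure\<close>)
qed

text \<open>Exact equidistribution at a finite level: the label of a lattice point depends on its
  class modulo \<open>Q\<close>, all classes have the same density, and this density is the Haar
  measure of the corresponding cell.\<close>

lemma has_mean_label:
  "has_mean (\<lambda>x. h (label N (embed x))) (\<integral>g. h (label N g) \<partial>product_measure)"
proof -
  define Q where "Q = (\<Prod>p\<in>primes_below N. p ^ k)"
  have Q: "Q > 0" unfolding Q_def by (intro prod_pos) (auto simp: prime_gt_0_nat)
  have Qw: "1 / of_nat Q ^ CARD('n) = complex_of_real (\<Prod>p\<in>primes_below N. weight p)"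
    by (simp add: Q_def weight_def prod_dividef prod_power_distrib)
  have "has_mean (\<lambda>x. of_bool (label N (embed x) = v)) (1 / of_nat Q ^ CARD('n))"
    if v: "v \<in> label N ` residues" for v
  proof -
    obtain w where w: "w \<in> residues" "v = label N w" using v by auto
    obtain t where t: "t \<in> L" "\<forall>p\<in>primes_below N. w p = coset (p ^ k) t"
      using embed_dense[OF w(1), of N] by blast
    have "x \<in> coset Q t \<longleftrightarrow> label N (embed x) = v" if "x \<in> L" for x
    proof -
      have "x \<in> coset Q t \<longleftrightarrow> (\<forall>p\<in>primes_below N. x - t \<in> multiples (p ^ k) L)"
        unfolding mem_coset Q_def using diff_in[OF that t(1)]
        by (subst multiples_prod[OF finite_primes_below coprime_prime_powers]) auto
      also have "\<dots> \<longleftrightarrow> label N (embed x) = v"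
        using t(2) by (auto simp: w(2) label_eq_iff embed_def coset_eq_iff)
      finally show ?thesis .
    qed
    then show ?thesis using has_mean_coset[OF Q coset_in_cosets[OF t(1)]]
      by (subst has_mean_cong[where b = "\<lambda>x. of_bool (x \<in> coset Q t)"]) auto
  qed
  then have "has_mean (\<lambda>x. \<Sum>v\<in>label N ` residues. h v * of_bool (label N (embed x) = v))
      (\<Sum>v\<in>label N ` residues. h v * (1 / of_nat Q ^ CARD('n)))"
    by (intro has_mean_sum finite_label_residues has_mean_cmult)
  moreover have "(\<Sum>v\<in>label N ` residues. h v * of_bool (label N (embed x) = v)) = h (label N (embed x))" if "x \<in> L" for x
  proof -
    have "(\<Sum>v\<in>label N ` residues. h v * of_bool (label N (embed x) = v)) = (\<Sum>v\<in>{label N (embed x)}. h v)"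
      using embed_in[OF that] finite_label_residues by (intro sum.mono_neutral_cong_right) auto
    then show ?thesis by simp
  qed
  ultimately have "has_mean (\<lambda>x. h (label N (embed x))) (\<Sum>v\<in>label N ` residues. h v * (1 / of_nat Q ^ CARD('n)))"
    by (subst (asm) has_mean_cong[where b = "\<lambda>x. h (label N (embed x))"]) auto
  also have "(\<Sum>v\<in>label N ` residues. h v * (1 / of_nat Q ^ CARD('n))) = (\<integral>g. h (label N g) \<partial>product_measure)"
    unfolding kronecker.integral_label(2)[OF prob_space_product_measure sets_product_measure]
    by (simp add: Qw measure_cell topspace_kronecker_topology)
  finally show ?thesis .
qed

end

section \<open>The hull as a factor of the Kronecker system\<close>

lemma finite_subset_ball:
  fixes F :: "'a :: real_normed_vector set"
  assumes "finite F"
  obtains N :: nat where "F \<subseteq> ball 0 (real N + 1)"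
proof -
  obtain b where b: "\<And>x. x \<in> F \<Longrightarrow> norm x < b"
    using finite_imp_bounded[OF assms] unfolding bounded_pos_less by blast
  obtain N :: nat where "b < real N" using reals_Archimedean2 by blast
  then show ?thesis using that[of N] b by fastforce
qed

context kfree_lattice
begin

definition sifted :: "(nat \<Rightarrow> (real ^ 'n) set) \<Rightarrow> (real ^ 'n) set" where
  "sifted g = {x \<in> L. \<forall>p. prime p \<longrightarrow> x \<notin> g p}"

definition sifted_below :: "nat \<Rightarrow> (nat \<Rightarrow> (real ^ 'n) set) \<Rightarrow> (real ^ 'n) set" where
  "sifted_below N g = {x \<in> L. \<forall>p\<in>primes_below N. x \<notin> g p}"

text \<open>The exceptional set of the truncation at \<open>N\<close>: outside it,
  \<open>sifted\<close> and \<open>sifted_below N\<close> agree on \<open>F\<close>.\<close>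

definition late :: "nat \<Rightarrow> (real ^ 'n) set \<Rightarrow> (nat \<Rightarrow> (real ^ 'n) set) set" where
  "late N F = {g \<in> residues. \<exists>x\<in>F. \<exists>q\<ge>N. prime q \<and> x \<in> g q}"

lemma sifted_subset: "sifted g \<subseteq> L"
  by (auto simp: sifted_def)

text \<open>\<open>x - t\<close> is a multiple of \<open>p ^ k\<close> exactly when \<open>x\<close>
  lies in the coset of \<open>t\<close>. Thus averages over the orbit of \<open>V\<close> become
  averages over embedded lattice points, to which the structure of the Kronecker group
  applies.\<close>

lemma translate_kfree_points: "t \<in> L \<Longrightarrow> translate t (kfree_points L k) = sifted (embed t)"
  by (auto simp: mem_translate kfree_points_def sifted_def embed_def mem_coset diff_in_iff)

lemma sifted_shift: "t \<in> L \<Longrightarrow> sifted (shift t g) = translate t (sifted g)"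
  by (auto simp: sifted_def shift_def mem_translate diff_in_iff)

lemma mem_residue_iff: "g \<in> residues \<Longrightarrow> prime q \<Longrightarrow> x \<in> g q \<longleftrightarrow> g q = coset (q ^ k) x"
  using mem_cosets_iff[OF residuesD] by metis

lemma coordinate_in_sets: "prime p \<Longrightarrow> {g \<in> residues. P (g p)} \<in> sets product_measure"
proof -
  assume "prime p"
  then have "{g \<in> residues. P (g p)} = kronecker.cells (Suc p) {w. P (w p)}"
    by (auto simp: kronecker.cells_def topspace_kronecker_topology label_def)
  then show ?thesis using kronecker.cells_in_sets by (simp add: sets_product_measure)
qed

lemma coordinates_in_sets:
  "finite J \<Longrightarrow> J \<subseteq> {p. prime p} \<Longrightarrow> {g \<in> residues. \<forall>p\<in>J. g p = w p} \<in> sets product_measure"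
  using sets.sets_Collect_finite_All[of J product_measure "\<lambda>p g. g p = w p"]
    coordinate_in_sets[where P = "\<lambda>C. C = w _"]
  by (simp add: space_product_measure subset_iff)

lemma late_in_sets: "finite F \<Longrightarrow> late N F \<in> sets product_measure"
proof -
  assume F: "finite F"
  have "late N F = (\<Union>x\<in>F. \<Union>q\<in>{q. prime q \<and> q \<ge> N}. {g \<in> residues. x \<in> g q})"
    by (auto simp: late_def)
  also have "\<dots> \<in> sets product_measure"
    using F coordinate_in_sets by (intro sets.finite_UN sets.countable_UN') auto
  finally show ?thesis .
qed

text \<open>Being struck by a prime \<open>q \<ge> N\<close> fixes the coordinate at
  \<open>q\<close>, which is independent of the coordinates in \<open>J\<close> below
  \<open>N\<close>; hence the factor in front, followed by union bounds over the points of
  \<open>F\<close> and over \<open>q\<close>. The factor is what allows comparison with the measure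
  of a cell.\<close>

lemma measure_late:
  assumes J: "finite J" "J \<subseteq> primes_below N" "\<And>p. p \<in> J \<Longrightarrow> w p \<in> cosets (p ^ k)"
    and F: "finite F" "F \<subseteq> L"
  shows "measure product_measure ({g \<in> residues. \<forall>p\<in>J. g p = w p} \<inter> late N F) \<le> (\<Prod>p\<in>J. weight p) * (card F * tail N)"
proof -
  interpret prob_space product_measure by (rule prob_space_product_measure)
  define E where "E x i = {g \<in> residues. (\<forall>p\<in>J. g p = w p) \<and> prime (i + N) \<and> x \<in> g (i + N)}" for x i
  have E: "E x i \<in> sets product_measure \<and> measure product_measure (E x i) \<le> (\<Prod>p\<in>J. weight p) * weight (i + N)"
    if x: "x \<in> F" for x i
  proof (cases "prime (i + N)")
    case True
    define w' where "w' = w(i + N := coset ((i + N) ^ k) x)"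
    have notin: "i + N \<notin> J" using J(2) by auto
    have "E x i = {g \<in> residues. \<forall>p\<in>insert (i + N) J. g p = w' p}"
      using mem_residue_iff[OF _ True] notin True by (auto simp: E_def w'_def)
    moreover have "measure product_measure {g \<in> residues. \<forall>p\<in>insert (i + N) J. g p = w' p} = (\<Prod>p\<in>insert (i + N) J. weight p)"
      using J True F x by (intro measure_coordinates) (auto simp: w'_def intro: coset_in_cosets)
    moreover have "{g \<in> residues. \<forall>p\<in>insert (i + N) J. g p = w' p} \<in> sets product_measure"
      using J True by (intro coordinates_in_sets) auto
    ultimately show ?thesis using notin J(1) by (simp add: mult.commute)
  next
    case False
    then have "E x i = {}" by (auto simp: E_def)
    then show ?thesis by (simp add: prod_nonneg weight_nonneg)
  qed
  have sw: "summable (\<lambda>i. (\<Prod>p\<in>J. weight p) * weight (i + N))"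
    using summable_weight by (intro summable_mult) (simp add: summable_iff_shift)
  have le: "measure product_measure (\<Union>i. E x i) \<le> (\<Prod>p\<in>J. weight p) * tail N" if x: "x \<in> F" for x
  proof -
    have sm: "summable (\<lambda>i. measure product_measure (E x i))"
      using E[OF x] by (intro summable_comparison_test[OF _ sw]) auto
    have "measure product_measure (\<Union>i. E x i) \<le> (\<Sum>i. measure product_measure (E x i))"
      using E[OF x] sm by (intro finite_measure_subadditive_countably) auto
    also have "\<dots> \<le> (\<Sum>i. (\<Prod>p\<in>J. weight p) * weight (i + N))"
      using E[OF x] sm sw by (intro suminf_le) auto
    also have "\<dots> = (\<Prod>p\<in>J. weight p) * tail N"
      unfolding tail_def using summable_weight by (intro suminf_mult) (simp add: summable_iff_shift)
    finally show ?thesis .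
  qed
  have UE: "(\<Union>i. E x i) \<in> sets product_measure" if "x \<in> F" for x
    using E[OF that] by (intro sets.countable_UN) auto
  have "{g \<in> residues. \<forall>p\<in>J. g p = w p} \<inter> late N F \<subseteq> (\<Union>x\<in>F. \<Union>i. E x i)"
  proof
    fix g assume "g \<in> {g \<in> residues. \<forall>p\<in>J. g p = w p} \<inter> late N F"
    then obtain x q where g: "g \<in> residues" "\<forall>p\<in>J. g p = w p" "x \<in> F" "q \<ge> N" "prime q" "x \<in> g q"
      by (auto simp: late_def)
    then have "g \<in> E x (q - N)" by (auto simp: E_def)
    then show "g \<in> (\<Union>x\<in>F. \<Union>i. E x i)" using g(3) by blast
  qed
  then have "measure product_measure ({g \<in> residues. \<forall>p\<in>J. g p = w p} \<inter> late N F) \<le> measure product_measure (\<Union>x\<in>F. \<Union>i. E x i)"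
    by (rule finite_measure_mono[OF _ sets.finite_UN[OF F(1) UE]])
  also have "\<dots> \<le> (\<Sum>x\<in>F. measure product_measure (\<Union>i. E x i))"
    using UE F by (intro measure_UNION_le)
  also have "\<dots> \<le> (\<Sum>x\<in>F. (\<Prod>p\<in>J. weight p) * tail N)" by (intro sum_mono le)
  finally show ?thesis by (simp add: mult_ac)
qed

lemma measure_late_le: "finite F \<Longrightarrow> F \<subseteq> L \<Longrightarrow> measure product_measure (late N F) \<le> card F * tail N"
  using measure_late[of "{}" N _ F] by (simp add: Int_absorb1 late_def)

lemma sifted_eq_sifted_below:
  "g \<in> residues \<Longrightarrow> g \<notin> late N F \<Longrightarrow> sifted g \<inter> F = sifted_below N g \<inter> F"
  by (auto simp: sifted_def sifted_below_def late_def) (meson not_less)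

lemma sifted_below_label: "sifted_below N (label N g) = sifted_below N g"
  by (auto simp: sifted_below_def label_def)

lemma embed_late: "t \<in> L \<Longrightarrow> embed t \<in> late N F \<Longrightarrow> \<exists>x\<in>F. \<exists>q\<ge>N. x - t \<in> multiples (q ^ k) L"
proof -
  assume "t \<in> L" "embed t \<in> late N F"
  then obtain x q where "x \<in> F" "q \<ge> N" "prime q" "x \<in> embed t q" by (auto simp: late_def)
  moreover from this have "x - t \<in> multiples (q ^ k) L" by (simp add: embed_def mem_coset)
  ultimately show ?thesis by blast
qed

section \<open>Frequencies of finite patterns\<close>

lemma mem_sifted_in_sets: "{g \<in> residues. x \<in> sifted g} \<in> sets product_measure"
proof (cases "x \<in> L")
  case True
  then have "{g \<in> residues. x \<in> sifted g} = {g \<in> space product_measure. \<forall>p\<in>{p. prime p}. x \<notin> g p}"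
    by (auto simp: sifted_def space_product_measure)
  also have "\<dots> \<in> sets product_measure"
  proof -
    have "{g \<in> space product_measure. prime p \<longrightarrow> x \<notin> g p} \<in> sets product_measure" for p
      using coordinate_in_sets[of p "\<lambda>C. x \<notin> C"] sets.top[of product_measure] by (cases "prime p") (auto simp: space_product_measure)
    then show ?thesis using sets.sets_Collect_countable_All[of product_measure "\<lambda>p g. prime p \<longrightarrow> x \<notin> g p"] by simp
  qed
  finally show ?thesis .
next
  case False
  then have "{g \<in> residues. x \<in> sifted g} = {}" by (auto simp: sifted_def)
  then show ?thesis by (simp only: sets.empty_sets)
qed

lemma pattern_in_sets:
  assumes "finite F"
  shows "{g \<in> residues. sifted g \<inter> F = P} \<in> sets product_measure"
proof (cases "P \<subseteq> F")
  case True
  have m: "{g \<in> residues. x \<in> sifted g \<longleftrightarrow> x \<in> P} \<in> sets product_measure" for x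
  proof (cases "x \<in> P")
    case False
    have "{g \<in> residues. x \<in> sifted g \<longleftrightarrow> x \<in> P} = space product_measure - {g \<in> residues. x \<in> sifted g}"
      using False by (auto simp: space_product_measure)
    then show ?thesis using mem_sifted_in_sets by auto
  qed (simp add: mem_sifted_in_sets)
  have eq: "{g \<in> residues. sifted g \<inter> F = P} = {g \<in> space product_measure. \<forall>x\<in>F. x \<in> sifted g \<longleftrightarrow> x \<in> P}"
    using True by (auto simp: space_product_measure)
  show ?thesis unfolding eq
    by (rule sets.sets_Collect_finite_All) (use m assms in \<open>auto simp: space_product_measure\<close>)
next
  case False
  then have "{g \<in> residues. sifted g \<inter> F = P} = {}" by auto
  then show ?thesis by (simp only: sets.empty_sets)
qed

lemma measurable_pattern:
  assumes "finite F"
  shows "(\<lambda>g. sifted g \<inter> F) \<in> measurable product_measure (count_space UNIV)"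
proof (rule measurableI)
  fix W :: "(real ^ 'n) set set"
  have "(\<lambda>g. sifted g \<inter> F) -` W \<inter> space product_measure = (\<Union>P\<in>Pow F \<inter> W. {g \<in> residues. sifted g \<inter> F = P})"
    by (auto simp: space_product_measure)
  also have "\<dots> \<in> sets product_measure" using assms pattern_in_sets by (intro sets.finite_UN) auto
  finally show "(\<lambda>g. sifted g \<inter> F) -` W \<inter> space product_measure \<in> sets product_measure" .
qed simp

lemma integrable_pattern:
  fixes \<Phi> :: "(real ^ 'n) set \<Rightarrow> complex"
  assumes "finite F"
  shows "integrable product_measure (\<lambda>g. \<Phi> (sifted g \<inter> F))"
proof -
  interpret prob_space product_measure by (rule prob_space_product_measure)
  show ?thesis
  proof (rule integrable_const_bound)
    show "AE g in product_measure. norm (\<Phi> (sifted g \<inter> F)) \<le> (\<Sum>P\<in>Pow F. norm (\<Phi> P))"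
      using assms by (intro AE_I2 member_le_sum) auto
    show "(\<lambda>g. \<Phi> (sifted g \<inter> F)) \<in> borel_measurable product_measure"
      using measurable_compose[OF measurable_pattern[OF assms], of \<Phi> borel] by simp
  qed
qed

lemma integral_pattern:
  assumes "finite F"
  shows "(\<integral>g. of_bool (sifted g \<inter> F = P) \<partial>product_measure) = complex_of_real (measure product_measure {g \<in> residues. sifted g \<inter> F = P})"
proof -
  interpret prob_space product_measure by (rule prob_space_product_measure)
  have "(\<integral>g. of_bool (sifted g \<inter> F = P) \<partial>product_measure) = (\<integral>g. complex_of_real (indicat_real {g \<in> residues. sifted g \<inter> F = P} g) \<partial>product_measure)"
    by (intro Bochner_Integration.integral_cong) (auto simp: space_product_measure)
  also have "\<dots> = complex_of_real (measure product_measure ({g \<in> residues. sifted g \<inter> F = P} \<inter> space product_measure))"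
    by simp
  also have "{g \<in> residues. sifted g \<inter> F = P} \<inter> space product_measure = {g \<in> residues. sifted g \<inter> F = P}"
    by (auto simp: space_product_measure)
  finally show ?thesis .
qed

text \<open>The central transfer from orbit averages to integrals. After truncation the function
  depends on a label and \<open>has_mean_label\<close> applies exactly; the truncation error tends
  to zero in measure by \<open>measure_late_le\<close> and in density by
  \<open>sieve\<close>.\<close>

lemma has_mean_pattern:
  fixes \<Phi> :: "(real ^ 'n) set \<Rightarrow> complex"
  assumes F: "finite F" "F \<subseteq> L"
  shows "has_mean (\<lambda>t. \<Phi> (sifted (embed t) \<inter> F)) (\<integral>g. \<Phi> (sifted g \<inter> F) \<partial>product_measure)"
proof -
  interpret prob_space product_measure by (rule prob_space_product_measure)
  obtain e where e: "e \<longlonglongrightarrow> 0" "\<And>N x. N \<ge> 1 \<Longrightarrow> x \<in> L \<Longrightarrow>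
    \<forall>\<^sub>F R in at_top. real (card {t \<in> L \<inter> ball 0 R. \<exists>q\<ge>N. x - t \<in> multiples (q ^ k) L}) / ball_vol TYPE('n) R \<le> e N"
    using sieve by blast
  define M where "M = (\<Sum>P\<in>Pow F. norm (\<Phi> P))"
  have M: "norm (\<Phi> (P \<inter> F)) \<le> M" for P unfolding M_def using F(1) by (intro member_le_sum) auto
  have M0: "0 \<le> M" by (simp add: M_def sum_nonneg)
  have M2: "norm (\<Phi> (P \<inter> F) - \<Phi> (Q \<inter> F)) \<le> 2 * M" for P Q
    using norm_triangle_ineq4[of "\<Phi> (P \<inter> F)" "\<Phi> (Q \<inter> F)"] M[of P] M[of Q] by simp
  have diff: "norm (\<Phi> (sifted g \<inter> F) - \<Phi> (sifted_below N g \<inter> F)) \<le> 2 * M * indicator (late N F) g"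
    if "g \<in> residues" for g N
    using M2 sifted_eq_sifted_below[OF that, of N F] by (cases "g \<in> late N F") auto
  \<comment> \<open>The level is \<open>Suc N\<close> because the sieve estimate requires a
    threshold of at least 1.\<close>
  define h where "h N w = \<Phi> (sifted_below (Suc N) w \<inter> F)" for N w
  have h: "\<Phi> (sifted_below (Suc N) g \<inter> F) = h N (label (Suc N) g)" for N g
    by (simp add: h_def sifted_below_label)
  show ?thesis
  proof (rule has_mean_approximation)
    show "has_mean (\<lambda>t. h N (label (Suc N) (embed t))) (\<integral>g. h N (label (Suc N) g) \<partial>product_measure)" for N
      by (rule has_mean_label)
    have int_h: "integrable product_measure (\<lambda>g. h N (label (Suc N) g))" for N
      by (rule kronecker.integral_label[OF prob_space_product_measure sets_product_measure])
    show "(\<lambda>N. \<integral>g. h N (label (Suc N) g) \<partial>product_measure) \<longlonglongrightarrow> (\<integral>g. \<Phi> (sifted g \<inter> F) \<partial>product_measure)"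
    proof (rule LIM_zero_cancel, rule Lim_null_comparison)
      show "\<forall>\<^sub>F N in sequentially. norm ((\<integral>g. h N (label (Suc N) g) \<partial>product_measure) - (\<integral>g. \<Phi> (sifted g \<inter> F) \<partial>product_measure))
          \<le> 2 * M * (card F * tail (Suc N))"
      proof (rule always_eventually, rule allI)
        fix N
        have "norm ((\<integral>g. h N (label (Suc N) g) \<partial>product_measure) - (\<integral>g. \<Phi> (sifted g \<inter> F) \<partial>product_measure))
            = norm (\<integral>g. h N (label (Suc N) g) - \<Phi> (sifted g \<inter> F) \<partial>product_measure)"
          using int_h integrable_pattern[OF F(1)] by simp
        also have "\<dots> \<le> (\<integral>g. norm (h N (label (Suc N) g) - \<Phi> (sifted g \<inter> F)) \<partial>product_measure)"
          by (rule integral_norm_bound)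
        also have "\<dots> \<le> (\<integral>g. 2 * M * indicator (late (Suc N) F) g \<partial>product_measure)"
        proof (rule integral_mono)
          show "integrable product_measure (\<lambda>g. norm (h N (label (Suc N) g) - \<Phi> (sifted g \<inter> F)))"
            using int_h integrable_pattern[OF F(1)] by (intro integrable_norm Bochner_Integration.integrable_diff) auto
          show "integrable product_measure (\<lambda>g. 2 * M * indicator (late (Suc N) F) g)"
            using late_in_sets[OF F(1)] by (intro integrable_mult_right) (auto simp: less_top[symmetric])
          fix g assume "g \<in> space product_measure"
          then show "norm (h N (label (Suc N) g) - \<Phi> (sifted g \<inter> F)) \<le> 2 * M * indicator (late (Suc N) F) g"
            using diff[of g "Suc N"] by (simp add: space_product_measure h[symmetric] norm_minus_commute)
        qed
        also have "\<dots> = 2 * M * measure product_measure (late (Suc N) F)"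
          using sets.sets_into_space[OF late_in_sets[OF F(1)]] by (simp add: Int_absorb2)
        also have "\<dots> \<le> 2 * M * (card F * tail (Suc N))"
          using measure_late_le[OF F] M0 by (intro mult_left_mono) auto
        finally show "norm ((\<integral>g. h N (label (Suc N) g) \<partial>product_measure) - (\<integral>g. \<Phi> (sifted g \<inter> F) \<partial>product_measure))
          \<le> 2 * M * (card F * tail (Suc N))" .
      qed
      have "(\<lambda>N. 2 * M * (card F * tail (Suc N))) \<longlonglongrightarrow> 2 * M * (real (card F) * 0)"
        by (intro tendsto_intros LIMSEQ_Suc tail_limit)
      then show "(\<lambda>N. 2 * M * (card F * tail (Suc N))) \<longlonglongrightarrow> 0" by simp
    qed
    have "(\<lambda>N. 2 * M * (card F * e (Suc N))) \<longlonglongrightarrow> 2 * M * (real (card F) * 0)"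
      by (intro tendsto_intros LIMSEQ_Suc e)
    then show "(\<lambda>N. 2 * M * (card F * e (Suc N))) \<longlonglongrightarrow> 0" by simp
    fix N
    have "\<forall>\<^sub>F R in at_top. \<forall>x\<in>F. real (card {t \<in> L \<inter> ball 0 R. \<exists>q\<ge>Suc N. x - t \<in> multiples (q ^ k) L}) / ball_vol TYPE('n) R \<le> e (Suc N)"
      using e(2)[of "Suc N"] F by (intro eventually_ball_finite) auto
    then show "\<forall>\<^sub>F R in at_top. (\<Sum>t\<in>L \<inter> ball 0 R. norm (\<Phi> (sifted (embed t) \<inter> F) - h N (label (Suc N) (embed t)))) / ball_vol TYPE('n) R
        \<le> 2 * M * (card F * e (Suc N))"
      using eventually_gt_at_top[of 0]
    proof eventually_elim
      case (elim R)
      define D where "D x = {t \<in> L \<inter> ball 0 R. \<exists>q\<ge>Suc N. x - t \<in> multiples (q ^ k) L}" for x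
      have finD: "finite (D x)" for x by (rule finite_subset[OF _ finite_ball[of 0 R]]) (auto simp: D_def)
      have "(\<Sum>t\<in>L \<inter> ball 0 R. norm (\<Phi> (sifted (embed t) \<inter> F) - h N (label (Suc N) (embed t))))
          \<le> (\<Sum>t\<in>L \<inter> ball 0 R. 2 * M * of_bool (t \<in> (\<Union>x\<in>F. D x)))"
      proof (rule sum_mono)
        fix t assume t: "t \<in> L \<inter> ball 0 R"
        have "embed t \<in> late (Suc N) F \<Longrightarrow> t \<in> (\<Union>x\<in>F. D x)"
          using embed_late[of t "Suc N" F] t by (auto simp: D_def)
        then show "norm (\<Phi> (sifted (embed t) \<inter> F) - h N (label (Suc N) (embed t))) \<le> 2 * M * of_bool (t \<in> (\<Union>x\<in>F. D x))"
          using diff[OF embed_in, of t "Suc N"] t M0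
          by (cases "embed t \<in> late (Suc N) F") (auto simp: h[symmetric])
      qed
      also have "\<dots> = 2 * M * (\<Sum>t\<in>L \<inter> ball 0 R. of_bool (t \<in> (\<Union>x\<in>F. D x)))"
        by (simp add: sum_distrib_left)
      also have "(\<Sum>t\<in>L \<inter> ball 0 R. of_bool (t \<in> (\<Union>x\<in>F. D x))) = real (card (\<Union>x\<in>F. D x))"
      proof -
        have "(\<Sum>t\<in>L \<inter> ball 0 R. of_bool (t \<in> (\<Union>x\<in>F. D x))) = (\<Sum>t\<in>(\<Union>x\<in>F. D x). 1 :: real)"
          using finite_ball by (intro sum.mono_neutral_cong_right) (auto simp: D_def)
        then show ?thesis by simp
      qed
      also have "2 * M * real (card (\<Union>x\<in>F. D x)) \<le> 2 * M * (\<Sum>x\<in>F. real (card (D x)))"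
        using card_UN_le[OF F(1), of D] M0
        by (intro mult_left_mono) (auto simp flip: of_nat_sum)
      finally have "(\<Sum>t\<in>L \<inter> ball 0 R. norm (\<Phi> (sifted (embed t) \<inter> F) - h N (label (Suc N) (embed t)))) / ball_vol TYPE('n) R
          \<le> 2 * M * (\<Sum>x\<in>F. real (card (D x))) / ball_vol TYPE('n) R"
        using vol_nonneg[of R] elim by (intro divide_right_mono) auto
      also have "\<dots> = 2 * M * (\<Sum>x\<in>F. real (card (D x)) / ball_vol TYPE('n) R)"
        by (simp add: sum_divide_distrib[symmetric])
      also have "\<dots> \<le> 2 * M * (\<Sum>x\<in>F. e (Suc N))"
        using elim M0 by (intro mult_left_mono sum_mono) (auto simp: D_def)
      finally show ?case by simp
    qed
  qed
qed

text \<open>Choose \<open>N\<close> beyond one striking prime for each struck point of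
  \<open>F\<close> and with \<open>card F * tail N < 1\<close>. The cell of \<open>g\<close> at
  level \<open>N\<close> then produces the same pattern except on its late part, which is a proper
  fraction of it in measure.\<close>

lemma pattern_positive:
  assumes g: "g \<in> residues" and F: "finite F" "F \<subseteq> L"
  shows "measure product_measure {h \<in> residues. sifted h \<inter> F = sifted g \<inter> F} > 0"
proof -
  interpret prob_space product_measure by (rule prob_space_product_measure)
  have "\<forall>x\<in>F. \<exists>p. (\<exists>q. prime q \<and> x \<in> g q) \<longrightarrow> prime p \<and> x \<in> g p" by blast
  then obtain p where p: "\<forall>x\<in>F. (\<exists>q. prime q \<and> x \<in> g q) \<longrightarrow> prime (p x) \<and> x \<in> g (p x)"
    using bchoice[of F "\<lambda>x p. (\<exists>q. prime q \<and> x \<in> g q) \<longrightarrow> prime p \<and> x \<in> g p"] by blast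
  have "(\<lambda>N. card F * tail N) \<longlonglongrightarrow> real (card F) * 0" by (intro tendsto_intros tail_limit)
  then have "\<forall>\<^sub>F N in sequentially. card F * tail N < 1" by (intro order_tendstoD(2)) auto
  moreover have "\<forall>\<^sub>F N in sequentially. \<forall>x\<in>F. p x < N"
    using F(1) by (intro eventually_ball_finite ballI eventually_gt_at_top)
  ultimately have "\<forall>\<^sub>F N in sequentially. card F * tail N < 1 \<and> (\<forall>x\<in>F. p x < N)" by (rule eventually_conj)
  then obtain N where N: "card F * tail N < 1" "\<forall>x\<in>F. p x < N" by (auto dest: eventually_happens)
  define C where "C = {h \<in> residues. \<forall>p\<in>primes_below N. h p = g p}"
  have C: "C \<in> sets product_measure" "measure product_measure C = (\<Prod>p\<in>primes_below N. weight p)"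
    unfolding C_def using finite_primes_below residuesD[OF g]
    by (intro coordinates_in_sets measure_coordinates; auto)+
  have Cpos: "measure product_measure C > 0"
    unfolding C by (intro prod_pos) (auto intro!: weight_pos simp: prime_gt_0_nat)
  have below: "sifted_below N g \<inter> F = sifted g \<inter> F"
    using p N(2) unfolding sifted_below_def sifted_def by blast
  have "C - late N F \<subseteq> {h \<in> residues. sifted h \<inter> F = sifted g \<inter> F}"
  proof
    fix h assume h: "h \<in> C - late N F"
    then have "sifted h \<inter> F = sifted_below N h \<inter> F" by (intro sifted_eq_sifted_below) (auto simp: C_def)
    also have "sifted_below N h = sifted_below N g" using h by (auto simp: C_def sifted_below_def)
    finally show "h \<in> {h \<in> residues. sifted h \<inter> F = sifted g \<inter> F}" using h below by (auto simp: C_def)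
  qed
  then have "measure product_measure (C - late N F) \<le> measure product_measure {h \<in> residues. sifted h \<inter> F = sifted g \<inter> F}"
    using pattern_in_sets[OF F(1)] by (intro finite_measure_mono)
  moreover have "measure product_measure (C - late N F) = measure product_measure C - measure product_measure (C \<inter> late N F)"
    using C late_in_sets[OF F(1)] by (intro finite_measure_Diff')
  moreover have "measure product_measure (C \<inter> late N F) \<le> measure product_measure C * (card F * tail N)"
    unfolding C(2) unfolding C_def using residuesD[OF g] finite_primes_below F by (intro measure_late) auto
  moreover have "measure product_measure C * (card F * tail N) < measure product_measure C * 1"
    using Cpos N(1) by (intro mult_strict_left_mono)
  ultimately show ?thesis by simp
qed

text \<open>A pattern absent from the orbit of \<open>V\<close> would have frequency zero, yet its
  frequency is a positive Haar measure. This puts all sifted sets into the hull.\<close>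

lemma pattern_occurs:
  assumes "g \<in> residues" "finite F" "F \<subseteq> L"
  shows "\<exists>t\<in>L. translate t (kfree_points L k) \<inter> F = sifted g \<inter> F"
proof (rule ccontr)
  assume "\<not> ?thesis"
  then have "has_mean (\<lambda>t. of_bool (sifted (embed t) \<inter> F = sifted g \<inter> F)) 0 \<longleftrightarrow> has_mean (\<lambda>_. 0) 0"
    by (intro has_mean_cong) (auto simp: translate_kfree_points)
  moreover have "has_mean (\<lambda>t. of_bool (sifted (embed t) \<inter> F = sifted g \<inter> F))
      (measure product_measure {h \<in> residues. sifted h \<inter> F = sifted g \<inter> F})"
    using has_mean_pattern[OF assms(2,3), of "\<lambda>P. of_bool (P = sifted g \<inter> F)"] integral_pattern[OF assms(2)] by simp
  ultimately show False using has_mean_0 has_mean_unique pattern_positive[OF assms] by fastforce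
qed

section \<open>The hull and its frequency measure\<close>

definition window :: "nat \<Rightarrow> (real ^ 'n) set \<Rightarrow> (real ^ 'n) set" where
  "window N X = X \<inter> ball 0 (real N + 1)"

lemma topspace_power_set_topology: "topspace (power_set_topology L) = Pow L"
  by (auto simp: power_set_topology_def topspace_pullback_topology)

lemma power_set_cell_system: "cell_system (power_set_topology L) window"
proof
  fix N :: nat
  show "finite (window N ` topspace (power_set_topology L))"
  proof (rule finite_subset)
    show "window N ` topspace (power_set_topology L) \<subseteq> Pow (L \<inter> ball 0 (real N + 1))"
      by (auto simp: topspace_power_set_topology window_def)
    show "finite (Pow (L \<inter> ball 0 (real N + 1)))" by (simp only: finite_Pow_iff finite_ball)
  qed
  have "ball 0 (real N + 1) \<subseteq> ball (0 :: real ^ 'n) (real (Suc N) + 1)" by (intro subset_ball) simp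
  then show "window (Suc N) X = window (Suc N) Y \<Longrightarrow> window N X = window N Y" for X Y
    unfolding window_def by blast
next
  fix W :: "(real ^ 'n) set set"
  define f :: "(real ^ 'n) set \<Rightarrow> real ^ 'n \<Rightarrow> bool" where "f X = (\<lambda>x\<in>L. x \<in> X)" for X
  define T where "T = product_topology (\<lambda>_. discrete_topology (UNIV :: bool set)) L"
  have T: "power_set_topology L = pullback_topology (Pow L) f T"
    by (simp add: power_set_topology_def T_def f_def[abs_def])
  have fX: "f X \<in> (\<Pi>\<^sub>E x\<in>L. UNIV)" for X by (auto simp: f_def)
  have inj: "X = Y" if "X \<subseteq> L" "Y \<subseteq> L" "f X = f Y" for X Y
    using that(1,2) fun_cong[OF that(3)] by (auto simp: f_def) (metis restrict_apply' subsetD)+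
  have surj: "f {x \<in> L. y x} = y" if "y \<in> (\<Pi>\<^sub>E x\<in>L. UNIV)" for y
    using that by (auto simp: f_def restrict_def PiE_iff extensional_def fun_eq_iff)
  show "openin (power_set_topology L) W \<longleftrightarrow> W \<subseteq> topspace (power_set_topology L) \<and>
    (\<forall>X\<in>W. \<exists>N. \<forall>Y\<in>topspace (power_set_topology L). window N Y = window N X \<longrightarrow> Y \<in> W)" (is "?l \<longleftrightarrow> ?r")
  proof
    assume ?l
    then obtain U where U: "openin T U" "W = f -` U \<inter> Pow L" by (auto simp: T openin_pullback_topology)
    have "\<exists>N. \<forall>Y\<in>Pow L. window N Y = window N X \<longrightarrow> Y \<in> W" if X: "X \<in> W" for X
    proof -
      have "f X \<in> U" using X U(2) by simp
      then obtain F where F: "finite F" "F \<subseteq> L" "\<forall>y\<in>\<Pi>\<^sub>E x\<in>L. UNIV. restrict y F = restrict (f X) F \<longrightarrow> y \<in> U"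
        using U(1) unfolding T_def openin_product_discrete by blast
      obtain N :: nat where N: "F \<subseteq> ball 0 (real N + 1)" by (rule finite_subset_ball[OF F(1)])
      have "Y \<in> W" if Y: "Y \<in> Pow L" "window N Y = window N X" for Y
      proof -
        have "x \<in> Y \<longleftrightarrow> x \<in> X" if "x \<in> F" for x
          using Y(2) N that by (auto simp: window_def)
        then have "restrict (f Y) F = restrict (f X) F" using F(2) by (intro restrict_ext) (auto simp: f_def)
        then show ?thesis using F(3) fX U(2) Y(1) by simp
      qed
      then show ?thesis by blast
    qed
    then show ?r using openin_subset[OF \<open>?l\<close>] by (simp add: topspace_power_set_topology)
  next
    assume r: ?r
    have "openin T (f ` W)"
      unfolding T_def openin_product_discrete
    proof (intro conjI ballI)
      show "f ` W \<subseteq> (\<Pi>\<^sub>E x\<in>L. UNIV)" using fX by auto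
      fix z assume "z \<in> f ` W"
      then obtain X where X: "X \<in> W" "z = f X" by auto
      obtain N where N: "\<forall>Y\<in>Pow L. window N Y = window N X \<longrightarrow> Y \<in> W"
        using r X(1) topspace_power_set_topology by metis
      have XL: "X \<subseteq> L" using r X(1) by (auto simp: topspace_power_set_topology)
      show "\<exists>F. finite F \<and> F \<subseteq> L \<and> (\<forall>y\<in>\<Pi>\<^sub>E x\<in>L. UNIV. restrict y F = restrict z F \<longrightarrow> y \<in> f ` W)"
      proof (intro exI[of _ "L \<inter> ball 0 (real N + 1)"] conjI ballI impI finite_ball)
        fix y :: "real ^ 'n \<Rightarrow> bool"
        assume y: "y \<in> (\<Pi>\<^sub>E x\<in>L. UNIV)" "restrict y (L \<inter> ball 0 (real N + 1)) = restrict z (L \<inter> ball 0 (real N + 1))"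
        have "y x \<longleftrightarrow> x \<in> X" if "x \<in> L" "x \<in> ball 0 (real N + 1)" for x
          using fun_cong[OF y(2), of x] that by (simp add: X(2) f_def)
        then have "window N {x \<in> L. y x} = window N X" using XL by (auto simp: window_def)
        then have "{x \<in> L. y x} \<in> W" using N by auto
        then have "f {x \<in> L. y x} \<in> f ` W" by (rule imageI)
        then show "y \<in> f ` W" using surj[OF y(1)] by simp
      qed auto
    qed
    moreover have "W = f -` (f ` W) \<inter> Pow L"
    proof (intro equalityI subsetI)
      fix X assume "X \<in> W"
      then show "X \<in> f -` (f ` W) \<inter> Pow L" using r by (auto simp: topspace_power_set_topology)
    next
      fix X assume "X \<in> f -` (f ` W) \<inter> Pow L"
      then obtain Y where "Y \<in> W" "f X = f Y" "X \<subseteq> L" by blast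
      moreover from this have "Y \<subseteq> L" using r by (auto simp: topspace_power_set_topology)
      ultimately show "X \<in> W" using inj[of X Y] by simp
    qed
    ultimately show ?l unfolding T openin_pullback_topology by blast
  qed
qed

lemma discrete_hull_iff:
  "X \<in> discrete_hull L (kfree_points L k) \<longleftrightarrow>
    X \<subseteq> L \<and> (\<forall>N. \<exists>t\<in>L. window N (translate t (kfree_points L k)) = window N X)"
proof -
  interpret P: cell_system "power_set_topology L" window by (rule power_set_cell_system)
  have "translate t (kfree_points L k) \<subseteq> L" if "t \<in> L" for t
    using that sifted_subset by (simp add: translate_kfree_points)
  then have "(\<exists>y\<in>{translate t (kfree_points L k) |t. t \<in> L} \<inter> Pow L. window N y = window N X) \<longleftrightarrow>
      (\<exists>t\<in>L. window N (translate t (kfree_points L k)) = window N X)" for N by blast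
  then show ?thesis
    unfolding discrete_hull_def P.in_closure_of_iff topspace_power_set_topology by simp
qed

lemma discrete_hull_subset: "X \<in> discrete_hull L (kfree_points L k) \<Longrightarrow> X \<subseteq> L"
  by (simp add: discrete_hull_iff)

lemma topspace_hull_topology: "topspace (hull_topology L (kfree_points L k)) = discrete_hull L (kfree_points L k)"
  using discrete_hull_subset by (auto simp: hull_topology_def topspace_power_set_topology)

sublocale hull: cell_system "hull_topology L (kfree_points L k)" window
  unfolding hull_topology_def by (rule cell_system.cell_system_subtopology[OF power_set_cell_system])

text \<open>The power set is a continuous image of the compact product of two-point spaces, and the
  hull is closed in it.\<close>

lemma compact_hull: "compact_space (hull_topology L (kfree_points L k))"
proof -
  define f :: "(real ^ 'n) set \<Rightarrow> real ^ 'n \<Rightarrow> bool" where "f X = (\<lambda>x\<in>L. x \<in> X)" for X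
  define T where "T = product_topology (\<lambda>_. discrete_topology (UNIV :: bool set)) L"
  define u :: "(real ^ 'n \<Rightarrow> bool) \<Rightarrow> (real ^ 'n) set" where "u y = {x \<in> L. y x}" for y
  have T: "power_set_topology L = pullback_topology (Pow L) f T"
    by (simp add: power_set_topology_def T_def f_def[abs_def])
  have top: "topspace T = (\<Pi>\<^sub>E x\<in>L. UNIV)" by (simp add: T_def)
  have fu: "(f \<circ> u) y = y" if "y \<in> topspace T" for y
    using that by (auto simp: top u_def f_def restrict_def PiE_iff extensional_def fun_eq_iff)
  have "compact_space T"
    unfolding T_def by (subst compact_space_product_topology) (simp add: compact_space_discrete_topology)
  moreover have "continuous_map T (power_set_topology L) u"
    unfolding T
  proof (rule continuous_map_pullback')
    show "continuous_map T T (f \<circ> u)" by (rule continuous_map_eq[OF continuous_map_id]) (use fu in \<open>simp add: o_def\<close>)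
    show "topspace T \<subseteq> u -` Pow L" unfolding u_def by blast
  qed
  ultimately have "compactin (power_set_topology L) (u ` topspace T)"
    unfolding compact_space_def by (rule image_compactin)
  moreover have "u ` topspace T = Pow L"
  proof (intro equalityI subsetI)
    fix X assume "X \<in> Pow L"
    then show "X \<in> u ` topspace T" by (intro image_eqI[where x = "f X"]) (auto simp: u_def f_def top)
  qed (auto simp: u_def)
  ultimately have "compact_space (power_set_topology L)" by (simp add: compact_space_def topspace_power_set_topology)
  then have "compactin (power_set_topology L) (discrete_hull L (kfree_points L k))"
    unfolding discrete_hull_def by (intro closedin_compact_space closedin_closure_of)
  then show ?thesis unfolding hull_topology_def by (rule compact_space_subtopology)
qed

lemma sifted_in_hull: "g \<in> residues \<Longrightarrow> sifted g \<in> discrete_hull L (kfree_points L k)"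
proof -
  assume g: "g \<in> residues"
  have "\<exists>t\<in>L. window N (translate t (kfree_points L k)) = window N (sifted g)" for N
  proof -
    obtain t where t: "t \<in> L" "translate t (kfree_points L k) \<inter> (L \<inter> ball 0 (real N + 1)) = sifted g \<inter> (L \<inter> ball 0 (real N + 1))"
      using pattern_occurs[OF g finite_ball] by blast
    then show ?thesis using sifted_subset[of "embed t"] sifted_subset[of g]
      by (intro bexI[OF _ t(1)]) (simp add: translate_kfree_points window_def Int_assoc[symmetric] Int_absorb2)
  qed
  then show ?thesis using sifted_subset by (simp add: discrete_hull_iff)
qed

definition hull_measure :: "(real ^ 'n) set measure" where
  "hull_measure = distr product_measure (borel_algebra (hull_topology L (kfree_points L k))) sifted"

lemma measurable_sifted: "sifted \<in> measurable product_measure (borel_algebra (hull_topology L (kfree_points L k)))"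
proof (rule hull.measurable_into)
  fix N v
  have "{g \<in> space product_measure. window N (sifted g) = v} = {g \<in> residues. sifted g \<inter> (L \<inter> ball 0 (real N + 1)) = v}"
    using sifted_subset by (auto simp: space_product_measure window_def)
  then show "{g \<in> space product_measure. window N (sifted g) = v} \<in> sets product_measure"
    using pattern_in_sets[OF finite_ball] by simp
qed (auto simp: space_product_measure topspace_hull_topology sifted_in_hull)

lemma sets_hull_measure: "sets hull_measure = sets (borel_algebra (hull_topology L (kfree_points L k)))"
  by (simp add: hull_measure_def)

lemma space_hull_measure: "space hull_measure = discrete_hull L (kfree_points L k)"
  by (simp add: hull_measure_def space_borel_algebra topspace_hull_topology)

lemma prob_space_hull_measure: "prob_space hull_measure"
  unfolding hull_measure_def by (rule prob_space.prob_space_distr[OF prob_space_product_measure measurable_sifted])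

lemma sifted_measure_preserving: "sifted \<in> measurable product_measure hull_measure"
  using measurable_sifted by (simp add: hull_measure_def)

lemma measure_hull: "A \<in> sets hull_measure \<Longrightarrow> measure hull_measure A = measure product_measure {g \<in> residues. sifted g \<in> A}"
  using measure_distr[OF measurable_sifted, of A]
  by (simp add: hull_measure_def space_product_measure vimage_def Int_def conj_commute)

text \<open>Patches are read off \<open>V - t\<close>, whereas the orbit consists of the sets
  \<open>V + t\<close>; balls about the origin are symmetric.\<close>

lemma has_mean_minus:
  assumes "has_mean a c"
  shows "has_mean (\<lambda>x. a (- x)) c"
proof -
  have "(\<Sum>x\<in>L \<inter> ball 0 R. a (- x)) = (\<Sum>x\<in>L \<inter> ball 0 R. a x)" for R
    by (rule sum.reindex_bij_witness[where i = uminus and j = uminus]) (auto simp: minus_in)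
  then show ?thesis using assms by (simp add: has_mean_def)
qed

lemma patch_at_eq:
  assumes "t \<in> L"
  shows "patch_at (kfree_points L k) \<rho> t = sifted (embed (- t)) \<inter> (L \<inter> ball 0 \<rho>)"
  using sifted_subset[of "embed (- t)"] by (auto simp: patch_at_def translate_kfree_points[OF minus_in[OF assms]])

lemma cylinder_in_sets: "cylinder L (kfree_points L k) \<rho> P \<in> sets hull_measure"
proof -
  obtain N :: nat where N: "\<rho> < real N" using reals_Archimedean2 by blast
  have "ball 0 \<rho> \<subseteq> ball (0 :: real ^ 'n) (real N + 1)" using N by (intro subset_ball) simp
  then have "cylinder L (kfree_points L k) \<rho> P = hull.cells N {W. W \<inter> ball 0 \<rho> = P}"
    by (auto simp: cylinder_def hull.cells_def topspace_hull_topology window_def)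
  then show ?thesis using hull.cells_in_sets by (simp add: sets_hull_measure)
qed

lemma frequency_hull_measure: "is_frequency_measure L (kfree_points L k) hull_measure"
  unfolding is_frequency_measure_def
proof (intro conjI allI impI ballI)
  fix \<rho> :: real and P assume "P \<in> patch_at (kfree_points L k) \<rho> ` L"
  define F where "F = L \<inter> ball 0 \<rho>"
  have "measure hull_measure (cylinder L (kfree_points L k) \<rho> P) = measure product_measure {g \<in> residues. sifted g \<inter> F = P}"
    unfolding measure_hull[OF cylinder_in_sets] F_def
    using sifted_in_hull sifted_subset by (intro arg_cong[where f = "measure product_measure"]) (auto simp: cylinder_def)
  moreover have "has_mean (\<lambda>t. of_bool (sifted (embed (- t)) \<inter> F = P)) (measure product_measure {g \<in> residues. sifted g \<inter> F = P})"
    using has_mean_minus[OF has_mean_pattern[of F "\<lambda>Q. of_bool (Q = P)"]] integral_pattern[of F P]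
    by (simp add: F_def finite_ball)
  moreover have "has_mean (\<lambda>t. of_bool (sifted (embed (- t)) \<inter> F = P)) c \<longleftrightarrow>
      has_mean (\<lambda>t. of_bool (t \<in> {t \<in> L. patch_at (kfree_points L k) \<rho> t = P})) c" for c
    by (rule has_mean_cong) (simp add: patch_at_eq F_def)
  ultimately show "has_density {t \<in> L. patch_at (kfree_points L k) \<rho> t = P} (measure hull_measure (cylinder L (kfree_points L k) \<rho> P))"
    by (subst has_density_iff) auto
qed (auto simp: prob_space_hull_measure space_hull_measure sets_hull_measure)

text \<open>By the description of the closure, every window of a point of the hull is a patch of
  \<open>V\<close>. The prescribed densities therefore fix the measure of all cells, and uniqueness
  follows.\<close>

lemma frequency_measure_eq: "frequency_measure L (kfree_points L k) = hull_measure"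
  unfolding frequency_measure_def
proof (rule the_equality)
  show "is_frequency_measure L (kfree_points L k) hull_measure" by (rule frequency_hull_measure)
  fix M assume M: "is_frequency_measure L (kfree_points L k) M"
  show "M = hull_measure"
  proof (rule hull.measure_eqI_cells)
    fix N v assume "v \<in> window N ` topspace (hull_topology L (kfree_points L k))"
    then obtain X where X: "X \<in> discrete_hull L (kfree_points L k)" "v = window N X" by (auto simp: topspace_hull_topology)
    then have "\<exists>t\<in>L. window N (translate t (kfree_points L k)) = v" by (simp add: discrete_hull_iff)
    then obtain t where t: "t \<in> L" "window N (translate t (kfree_points L k)) = v" by blast
    then have "v = patch_at (kfree_points L k) (real N + 1) (- t)" by (simp add: patch_at_def window_def)
    then have v: "v \<in> patch_at (kfree_points L k) (real N + 1) ` L" using minus_in[OF t(1)] by blast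
    have "hull.cells N {v} = cylinder L (kfree_points L k) (real N + 1) v"
      by (auto simp: hull.cells_def cylinder_def topspace_hull_topology window_def)
    \<comment> \<open>Cylinder measures are prescribed for positive radii only; this is why windows
      have radius \<open>N + 1\<close>.\<close>
    moreover have "real N + 1 > 0" by simp
    then have "measure M (cylinder L (kfree_points L k) (real N + 1) v) = measure hull_measure (cylinder L (kfree_points L k) (real N + 1) v)"
      using M frequency_hull_measure v has_density_unique unfolding is_frequency_measure_def by blast
    ultimately show "measure M (hull.cells N {v}) = measure hull_measure (hull.cells N {v})" by simp
  qed (use M in \<open>auto simp: is_frequency_measure_def prob_space_hull_measure sets_hull_measure\<close>)
qed

end

section \<open>Equidistribution and ergodicity\<close>

context kfree_lattice
begin

text \<open>Compactness makes \<open>f\<close> uniformly close to a function of a finite window, for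
  which the claim is \<open>has_mean_pattern\<close>; uniform errors survive both averaging and
  integration.\<close>

lemma equidistribution:
  fixes f :: "(real ^ 'n) set \<Rightarrow> complex"
  assumes f: "continuous_map (hull_topology L (kfree_points L k)) euclidean f"
  shows "has_mean (\<lambda>x. f (translate x (kfree_points L k))) (\<integral>X. f X \<partial>hull_measure)"
proof -
  interpret prob_space product_measure by (rule prob_space_product_measure)
  have "\<exists>N. \<forall>X Y. X \<in> discrete_hull L (kfree_points L k) \<longrightarrow> Y \<in> discrete_hull L (kfree_points L k) \<longrightarrow>
      window N X = window N Y \<longrightarrow> dist (f X) (f Y) < 1 / (real m + 1)" for m
    using hull.uniform_cell_approximation[OF compact_hull f, of "1 / (real m + 1)"]
    unfolding topspace_hull_topology by (metis of_nat_0_le_iff add_nonneg_pos zero_less_one zero_less_divide_1_iff)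
  then obtain N where N: "\<And>m X Y. X \<in> discrete_hull L (kfree_points L k) \<Longrightarrow> Y \<in> discrete_hull L (kfree_points L k) \<Longrightarrow>
      window (N m) X = window (N m) Y \<Longrightarrow> dist (f X) (f Y) < 1 / (real m + 1)" by metis
  define F where "F m = L \<inter> ball 0 (real (N m) + 1)" for m
  have F: "finite (F m)" "F m \<subseteq> L" for m by (auto simp: F_def finite_ball)
  \<comment> \<open>The approximating function takes the value of \<open>f\<close> at an arbitrary
    point of the hull with the given window.\<close>
  define \<Phi> where "\<Phi> m P = f (SOME Y. Y \<in> discrete_hull L (kfree_points L k) \<and> window (N m) Y = P)" for m P
  have close: "cmod (f (sifted g) - \<Phi> m (sifted g \<inter> F m)) \<le> 1 / (real m + 1)" if g: "g \<in> residues" for g m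
  proof -
    have "window (N m) (sifted g) = sifted g \<inter> F m" using sifted_subset by (auto simp: window_def F_def)
    define Y where "Y = (SOME Y. Y \<in> discrete_hull L (kfree_points L k) \<and> window (N m) Y = sifted g \<inter> F m)"
    have "Y \<in> discrete_hull L (kfree_points L k) \<and> window (N m) Y = sifted g \<inter> F m"
      unfolding Y_def by (rule someI[of _ "sifted g"]) (simp add: sifted_in_hull[OF g] \<open>window (N m) (sifted g) = sifted g \<inter> F m\<close>)
    then have "dist (f (sifted g)) (f Y) < 1 / (real m + 1)"
      using N[of "sifted g" Y m] sifted_in_hull[OF g] \<open>window (N m) (sifted g) = sifted g \<inter> F m\<close> by simp
    then have "dist (f (sifted g)) (\<Phi> m (sifted g \<inter> F m)) < 1 / (real m + 1)"
      by (simp add: \<Phi>_def Y_def)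
    then show ?thesis by (simp add: dist_norm)
  qed
  have f_meas: "f \<in> borel_measurable (borel_algebra (hull_topology L (kfree_points L k)))"
  proof (rule borel_measurableI)
    fix S :: "complex set" assume "open S"
    then have "openin (hull_topology L (kfree_points L k)) {X \<in> topspace (hull_topology L (kfree_points L k)). f X \<in> S}"
      by (intro openin_continuous_map_preimage[OF f]) (simp only: open_openin)
    then show "f -` S \<inter> space (borel_algebra (hull_topology L (kfree_points L k))) \<in> sets (borel_algebra (hull_topology L (kfree_points L k)))"
      by (simp add: sets_borel_algebra space_borel_algebra vimage_def Int_def conj_commute sigma_sets.Basic)
  qed
  then have [measurable]: "(\<lambda>g. f (sifted g)) \<in> borel_measurable product_measure"
    using measurable_compose[OF measurable_sifted] by blast
  have int_\<Phi>: "integrable product_measure (\<lambda>g. \<Phi> m (sifted g \<inter> F m))" for m by (rule integrable_pattern[OF F(1)])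
  \<comment> \<open>Integrability comes from the approximation with index 0, which differs from the
    function by at most 1 and is integrable.\<close>
  have int_f: "integrable product_measure (\<lambda>g. f (sifted g))"
  proof -
    have "integrable product_measure (\<lambda>g. f (sifted g) - \<Phi> 0 (sifted g \<inter> F 0))"
    proof (rule integrable_const_bound)
      show "AE g in product_measure. norm (f (sifted g) - \<Phi> 0 (sifted g \<inter> F 0)) \<le> 1"
        using close[of _ 0] by (intro AE_I2) (simp add: space_product_measure)
    qed (use int_\<Phi>[of 0] in measurable)
    then show ?thesis using Bochner_Integration.integrable_add[OF _ int_\<Phi>[of 0]] by fastforce
  qed
  have lim1: "(\<lambda>m. 1 / (real m + 1)) \<longlonglongrightarrow> 0"
    using LIMSEQ_Suc[OF lim_1_over_n[where 'a = real]] by (simp add: add.commute)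
  have "has_mean (\<lambda>t. f (sifted (embed t))) (\<integral>g. f (sifted g) \<partial>product_measure)"
  proof (rule has_mean_approximation)
    show "has_mean (\<lambda>t. \<Phi> m (sifted (embed t) \<inter> F m)) (\<integral>g. \<Phi> m (sifted g \<inter> F m) \<partial>product_measure)" for m
      by (rule has_mean_pattern[OF F])
    show "(\<lambda>m. \<integral>g. \<Phi> m (sifted g \<inter> F m) \<partial>product_measure) \<longlonglongrightarrow> (\<integral>g. f (sifted g) \<partial>product_measure)"
    proof (rule LIM_zero_cancel, rule Lim_null_comparison[OF always_eventually lim1], rule allI)
      fix m
      have "norm ((\<integral>g. \<Phi> m (sifted g \<inter> F m) \<partial>product_measure) - (\<integral>g. f (sifted g) \<partial>product_measure))
          = norm (\<integral>g. \<Phi> m (sifted g \<inter> F m) - f (sifted g) \<partial>product_measure)"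
        using int_\<Phi> int_f by simp
      also have "\<dots> \<le> (\<integral>g. norm (\<Phi> m (sifted g \<inter> F m) - f (sifted g)) \<partial>product_measure)"
        by (rule integral_norm_bound)
      also have "\<dots> \<le> (\<integral>g. 1 / (real m + 1) \<partial>product_measure)"
      proof (rule integral_mono)
        show "integrable product_measure (\<lambda>g. norm (\<Phi> m (sifted g \<inter> F m) - f (sifted g)))"
          using int_\<Phi> int_f by (intro integrable_norm Bochner_Integration.integrable_diff)
        show "norm (\<Phi> m (sifted g \<inter> F m) - f (sifted g)) \<le> 1 / (real m + 1)" if "g \<in> space product_measure" for g
          using close[of g m] that by (simp add: space_product_measure norm_minus_commute)
      qed simp
      also have "\<dots> = 1 / (real m + 1)" by (simp add: prob_space)
      finally show "norm ((\<integral>g. \<Phi> m (sifted g \<inter> F m) \<partial>product_measure) - (\<integral>g. f (sifted g) \<partial>product_measure)) \<le> 1 / (real m + 1)" .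
    qed
    \<comment> \<open>The error per point is summed over the ball; the number of points divided by
      the volume tends to 1 and is eventually below 2.\<close>
    show "(\<lambda>m. 2 * (1 / (real m + 1))) \<longlonglongrightarrow> 0" using tendsto_mult_left[OF lim1, of 2] by simp
    fix m
    have "((\<lambda>R. card (L \<inter> ball 0 R) / ball_vol TYPE('n) R) \<longlongrightarrow> 1) at_top"
      using card_ball_limit[of 1 0 0] by simp
    then have "\<forall>\<^sub>F R in at_top. card (L \<inter> ball 0 R) / ball_vol TYPE('n) R < 2" by (rule order_tendstoD) simp
    then show "\<forall>\<^sub>F R in at_top. (\<Sum>t\<in>L \<inter> ball 0 R. cmod (f (sifted (embed t)) - \<Phi> m (sifted (embed t) \<inter> F m))) / ball_vol TYPE('n) R \<le> 2 * (1 / (real m + 1))"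
      using eventually_gt_at_top[of 0]
    proof eventually_elim
      case (elim R)
      have "(\<Sum>t\<in>L \<inter> ball 0 R. cmod (f (sifted (embed t)) - \<Phi> m (sifted (embed t) \<inter> F m))) \<le> (\<Sum>t\<in>L \<inter> ball 0 R. 1 / (real m + 1))"
        using close embed_in by (intro sum_mono) auto
      then have "(\<Sum>t\<in>L \<inter> ball 0 R. cmod (f (sifted (embed t)) - \<Phi> m (sifted (embed t) \<inter> F m))) / ball_vol TYPE('n) R
          \<le> (\<Sum>t\<in>L \<inter> ball 0 R. 1 / (real m + 1)) / ball_vol TYPE('n) R"
        using vol_nonneg[of R] elim by (intro divide_right_mono) auto
      also have "\<dots> = card (L \<inter> ball 0 R) / ball_vol TYPE('n) R * (1 / (real m + 1))" by simp
      also have "\<dots> \<le> 2 * (1 / (real m + 1))" using elim by (intro mult_right_mono) auto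
      finally show ?case .
    qed
  qed
  moreover have "(\<integral>X. f X \<partial>hull_measure) = (\<integral>g. f (sifted g) \<partial>product_measure)"
    unfolding hull_measure_def by (rule integral_distr[OF measurable_sifted f_meas])
  ultimately show ?thesis
    by (subst has_mean_cong[where b = "\<lambda>t. f (sifted (embed t))"]) (auto simp: translate_kfree_points)
qed

section \<open>Invariance and ergodicity\<close>

lemma measurable_shift: "x \<in> L \<Longrightarrow> shift x \<in> measurable product_measure product_measure"
  using measurable_kronecker_mult[OF embed_in, of x]
  by (subst measurable_cong[where g = "\<lambda>g. g \<otimes>\<^bsub>kronecker_group L k\<^esub> embed x"]) (auto simp: space_product_measure mult_embed)

lemma distr_shift: "x \<in> L \<Longrightarrow> distr product_measure product_measure (shift x) = product_measure"
  using distr_kronecker_mult[OF embed_in, of x]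
  by (subst distr_cong[where g = "\<lambda>g. g \<otimes>\<^bsub>kronecker_group L k\<^esub> embed x"]) (auto simp: space_product_measure mult_embed)

lemma window_translate:
  assumes "real N + norm t \<le> real M" "window M X = window M Y"
  shows "window N (translate t X) = window N (translate t Y)"
proof -
  have "x - t \<in> ball 0 (real M + 1)" if "x \<in> ball 0 (real N + 1)" for x
    using that assms(1) norm_triangle_ineq4[of x t] by simp
  then show ?thesis using assms(2) unfolding window_def by (auto simp: mem_translate)
qed

lemma translate_hull:
  assumes "t \<in> L" "X \<in> discrete_hull L (kfree_points L k)"
  shows "translate t X \<in> discrete_hull L (kfree_points L k)"
  unfolding discrete_hull_iff
proof (intro conjI allI)
  show "translate t X \<subseteq> L" using discrete_hull_subset[OF assms(2)] assms(1) by (auto simp: translate_def intro: add_in)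
  fix N
  obtain M :: nat where M: "real N + norm t \<le> real M" using real_arch_simple by blast
  obtain s where s: "s \<in> L" "window M (translate s (kfree_points L k)) = window M X"
    using assms(2) unfolding discrete_hull_iff by blast
  have "window N (translate t (translate s (kfree_points L k))) = window N (translate t X)"
    by (rule window_translate[OF M s(2)])
  then show "\<exists>s\<in>L. window N (translate s (kfree_points L k)) = window N (translate t X)"
    using add_in[OF assms(1) s(1)] by (auto simp: translate_translate)
qed

lemma measurable_translate:
  assumes "t \<in> L"
  shows "translate t \<in> measurable hull_measure hull_measure"
proof -
  have "translate t \<in> measurable hull_measure (borel_algebra (hull_topology L (kfree_points L k)))"
  proof (rule hull.measurable_into)
    fix N v
    obtain M :: nat where M: "real N + norm t \<le> real M" using real_arch_simple by blast
    have "window N (translate t X) = window N (translate t (window M X))" for X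
      by (rule window_translate[OF M]) (simp add: window_def)
    then have "{X \<in> space hull_measure. window N (translate t X) = v} = hull.cells M {W. window N (translate t W) = v}"
      by (simp add: hull.cells_def topspace_hull_topology space_hull_measure)
    then show "{X \<in> space hull_measure. window N (translate t X) = v} \<in> sets hull_measure"
      using hull.cells_in_sets by (simp add: sets_hull_measure)
  qed (use translate_hull[OF assms] in \<open>auto simp: space_hull_measure topspace_hull_topology\<close>)
  then show ?thesis by (simp add: measurable_cong_sets[OF refl sets_hull_measure])
qed

lemma hull_measure_eq: "hull_measure = distr product_measure hull_measure sifted"
proof (rule measure_eqI)
  fix A assume "A \<in> sets hull_measure"
  then show "emeasure hull_measure A = emeasure (distr product_measure hull_measure sifted) A"
    using emeasure_distr[OF sifted_measure_preserving, of A] emeasure_distr[OF measurable_sifted, of A]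
    by (simp add: hull_measure_def)
qed simp

lemma distr_translate:
  assumes "t \<in> L"
  shows "distr hull_measure hull_measure (translate t) = hull_measure"
proof -
  have "distr hull_measure hull_measure (translate t) = distr product_measure hull_measure (translate t \<circ> sifted)"
    by (subst hull_measure_eq) (rule distr_distr[OF measurable_translate[OF assms] sifted_measure_preserving])
  also have "translate t \<circ> sifted = sifted \<circ> shift t" using sifted_shift[OF assms] by auto
  also have "distr product_measure hull_measure (sifted \<circ> shift t) = distr (distr product_measure product_measure (shift t)) hull_measure sifted"
    by (rule distr_distr[OF sifted_measure_preserving measurable_shift[OF assms], symmetric])
  also have "\<dots> = hull_measure" by (simp add: distr_shift[OF assms] hull_measure_eq[symmetric])
  finally show ?thesis .
qed

lemma pmp_hull: "pmp_action L translate hull_measure"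
  unfolding pmp_action_def
  by (auto simp: prob_space_hull_measure measurable_translate distr_translate translate_0 translate_translate)

lemma measure_shift_preimage:
  assumes "x \<in> L" "A \<in> sets product_measure"
  shows "measure product_measure {g \<in> residues. shift x g \<in> A} = measure product_measure A"
proof -
  have "measure product_measure A = measure (distr product_measure product_measure (shift x)) A"
    by (simp add: distr_shift[OF assms(1)])
  also have "\<dots> = measure product_measure (shift x -` A \<inter> space product_measure)"
    by (rule measure_distr[OF measurable_shift[OF assms(1)] assms(2)])
  also have "shift x -` A \<inter> space product_measure = {g \<in> residues. shift x g \<in> A}"
    by (auto simp: space_product_measure)
  finally show ?thesis by simp
qed

lemma label_transitive:
  assumes "v \<in> label N ` residues" "v' \<in> label N ` residues"
  shows "\<exists>s\<in>L. \<forall>g\<in>residues. shift s g \<in> kronecker.cells N {v'} \<longleftrightarrow> g \<in> kronecker.cells N {v}"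
proof -
  obtain w w' where w: "w \<in> residues" "v = label N w" "w' \<in> residues" "v' = label N w'" using assms by auto
  obtain t where t: "t \<in> L" "\<forall>p\<in>primes_below N. w p = coset (p ^ k) t" using embed_dense[OF w(1), of N] by blast
  obtain t' where t': "t' \<in> L" "\<forall>p\<in>primes_below N. w' p = coset (p ^ k) t'" using embed_dense[OF w(3), of N] by blast
  have s: "t' - t \<in> L" by (intro diff_in t t')
  have "shift (t' - t) g \<in> kronecker.cells N {v'} \<longleftrightarrow> g \<in> kronecker.cells N {v}" if g: "g \<in> residues" for g
  proof -
    have "shift (t' - t) g p = w' p \<longleftrightarrow> g p = w p" if p: "p \<in> primes_below N" for p
    proof -
      obtain a where "g p = coset (p ^ k) a" using residuesD[OF g, of p] p by (auto simp: cosets_def)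
      then have "translate (t' - t) (g p) = coset (p ^ k) t' \<longleftrightarrow> g p = coset (p ^ k) t"
        by (simp add: translate_coset coset_eq_iff)
      then show ?thesis using t(2) t'(2) p by (simp add: shift_def)
    qed
    then show ?thesis using shift_in[OF s g] g
      by (simp add: kronecker.cells_def topspace_kronecker_topology w(2,4) label_eq_iff)
  qed
  then show ?thesis using s by blast
qed

text \<open>The lattice permutes the cells of each level transitively, so an invariant set has the
  same mass in each of them and is independent of all cells. Approximating \<open>A\<close> by cells
  makes it independent of itself, whence its measure equals its own square.\<close>

lemma ergodic_product_measure:
  assumes A: "A \<in> sets product_measure" and inv: "\<And>x g. x \<in> L \<Longrightarrow> g \<in> residues \<Longrightarrow> shift x g \<in> A \<longleftrightarrow> g \<in> A"
  shows "measure product_measure A = 0 \<or> measure product_measure A = 1"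
proof -
  interpret prob_space product_measure by (rule prob_space_product_measure)
  have AX: "A \<subseteq> residues" using sets.sets_into_space[OF A] by (simp add: space_product_measure)
  have cs: "kronecker.cells N W \<in> sets product_measure" for N W
    using kronecker.cells_in_sets by (simp add: sets_product_measure)
  have indep: "measure product_measure (A \<inter> kronecker.cells N W) = measure product_measure A * measure product_measure (kronecker.cells N W)" for N W
  proof -
    have const: "measure product_measure (A \<inter> kronecker.cells N {v}) = measure product_measure (A \<inter> kronecker.cells N {v'})"
      if v: "v \<in> label N ` residues" "v' \<in> label N ` residues" for v v'
    proof -
      obtain s where s: "s \<in> L" "\<forall>g\<in>residues. shift s g \<in> kronecker.cells N {v'} \<longleftrightarrow> g \<in> kronecker.cells N {v}"
        using label_transitive[OF v] by blast
      have "{g \<in> residues. shift s g \<in> A \<inter> kronecker.cells N {v'}} = A \<inter> kronecker.cells N {v}"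
        using s inv AX by auto
      then show ?thesis using measure_shift_preimage[OF s(1), of "A \<inter> kronecker.cells N {v'}"] A cs by auto
    qed
    have sum: "measure product_measure (A \<inter> kronecker.cells N W) = (\<Sum>v\<in>label N ` residues \<inter> W. measure product_measure (A \<inter> kronecker.cells N {v}))" for W
    proof -
      have "A \<inter> kronecker.cells N W = (\<Union>v\<in>label N ` residues \<inter> W. A \<inter> kronecker.cells N {v})"
        by (auto simp: kronecker.cells_def topspace_kronecker_topology)
      also have "measure product_measure \<dots> = (\<Sum>v\<in>label N ` residues \<inter> W. measure product_measure (A \<inter> kronecker.cells N {v}))"
        using A cs finite_label_residues
        by (intro finite_measure_finite_Union) (auto simp: disjoint_family_on_def, auto simp: kronecker.cells_def)
      finally show ?thesis .
    qed
    obtain v0 where v0: "v0 \<in> label N ` residues" using embed_in[OF zero_in] by blast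
    define a where "a = measure product_measure (A \<inter> kronecker.cells N {v0})"
    define n where "n = card (label N ` residues)"
    have n: "n > 0" using v0 finite_label_residues by (auto simp: n_def card_gt_0_iff)
    have "A \<inter> kronecker.cells N UNIV = A" using AX by (auto simp: kronecker.cells_def topspace_kronecker_topology)
    then have "measure product_measure A = n * a"
      using sum[of UNIV] const[OF _ v0] by (simp add: a_def n_def)
    moreover have "measure product_measure (A \<inter> kronecker.cells N W) = card (label N ` residues \<inter> W) * a"
      using sum[of W] const[OF _ v0] by (simp add: a_def)
    moreover have "measure product_measure (kronecker.cells N W) = card (label N ` residues \<inter> W) / n"
      using kronecker.measure_cells[OF finite_measure_axioms sets_product_measure, of N W]
        invariant_measure_cell[OF prob_space_product_measure sets_product_measure] product_measure_invariant
      by (simp add: topspace_kronecker_topology n_def)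
    ultimately show ?thesis using n by simp
  qed
  \<comment> \<open>With \<open>C\<close> within \<open>e\<close> of \<open>A\<close>, one
    \<open>e\<close> pays for replacing \<open>A\<close> by its intersection with \<open>C\<close>,
    the other for replacing the measure of \<open>C\<close> by that of \<open>A\<close> in the
    product.\<close>
  have "\<bar>measure product_measure A - (measure product_measure A)\<^sup>2\<bar> \<le> 2 * e" if "e > 0" for e
  proof -
    obtain N W where NW: "measure product_measure (sym_diff A (kronecker.cells N W)) < e"
      by (rule kronecker.approximate_set[OF prob_space_product_measure sets_product_measure A \<open>e > 0\<close>])
    define C where "C = kronecker.cells N W"
    have C: "C \<in> sets product_measure" by (simp add: C_def cs)
    have "measure product_measure (sym_diff A C) = measure product_measure (A - C) + measure product_measure (C - A)"
      using A C by (intro finite_measure_Union) auto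
    moreover have "measure product_measure (A - C) = measure product_measure A - measure product_measure (A \<inter> C)"
      using A C by (intro finite_measure_Diff')
    moreover have "measure product_measure (C - A) = measure product_measure C - measure product_measure (A \<inter> C)"
      using A C finite_measure_Diff'[of C A] by (simp add: Int_commute)
    moreover have "measure product_measure (A - C) \<ge> 0" "measure product_measure (C - A) \<ge> 0" by auto
    ultimately have 1: "\<bar>measure product_measure A - measure product_measure (A \<inter> C)\<bar> \<le> e"
      and 2: "\<bar>measure product_measure C - measure product_measure A\<bar> \<le> e"
      using NW unfolding C_def by linarith+
    have "\<bar>measure product_measure A * (measure product_measure C - measure product_measure A)\<bar> \<le> 1 * e"
      unfolding abs_mult using 2 by (intro mult_mono) auto
    then have "\<bar>measure product_measure (A \<inter> C) - (measure product_measure A)\<^sup>2\<bar> \<le> e"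
      using indep[of N W] by (simp add: C_def power2_eq_square right_diff_distrib)
    then show ?thesis using 1 by linarith
  qed
  then have "\<bar>measure product_measure A - (measure product_measure A)\<^sup>2\<bar> \<le> 0 + e" if "e > 0" for e
    using that half_gt_zero[OF that] by (metis add_0 field_sum_of_halves mult_2)
  then have "\<bar>measure product_measure A - (measure product_measure A)\<^sup>2\<bar> \<le> 0" by (rule field_le_epsilon)
  then have "measure product_measure A * (1 - measure product_measure A) = 0"
    by (simp add: power2_eq_square algebra_simps)
  then show ?thesis by simp
qed

lemma ergodic_hull: "ergodic_action L translate hull_measure"
  unfolding ergodic_action_def
proof (intro conjI ballI impI pmp_hull)
  fix A assume A: "A \<in> sets hull_measure" and inv: "\<forall>t\<in>L. translate t -` A \<inter> space hull_measure = A"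
  define A' where "A' = {g \<in> residues. sifted g \<in> A}"
  have "A' = sifted -` A \<inter> space product_measure" by (auto simp: A'_def space_product_measure)
  then have A': "A' \<in> sets product_measure" using measurable_sets[OF sifted_measure_preserving A] by simp
  have "shift x g \<in> A' \<longleftrightarrow> g \<in> A'" if "x \<in> L" "g \<in> residues" for x g
  proof -
    have "translate x (sifted g) \<in> A \<longleftrightarrow> sifted g \<in> A"
      using inv that sifted_in_hull[OF that(2)] by (auto simp: space_hull_measure)
    then show ?thesis using that shift_in[OF that] by (simp add: A'_def sifted_shift)
  qed
  from ergodic_product_measure[OF A' this] show "measure hull_measure A = 0 \<or> measure hull_measure A = 1"
    by (simp add: measure_hull[OF A] A'_def)
qed

section \<open>The isomorphism with the Kronecker system\<close>

definition missed :: "nat \<Rightarrow> (real ^ 'n) set \<Rightarrow> (real ^ 'n) set set" where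
  "missed p X = {C \<in> cosets (p ^ k). C \<inter> X = {}}"

text \<open>Almost every \<open>g\<close> is recovered from the sifted set, which misses no other cosets than the
  \<open>g p\<close>; the value \<open>coset (p ^ k) 0\<close> is a dummy.\<close>

definition recover :: "(real ^ 'n) set \<Rightarrow> nat \<Rightarrow> (real ^ 'n) set" where
  "recover X = (\<lambda>p\<in>{p. prime p}. if missed p X = {} then coset (p ^ k) 0 else SOME C. C \<in> missed p X)"

definition recoverable :: "(nat \<Rightarrow> (real ^ 'n) set) set" where
  "recoverable = {g \<in> residues. \<forall>p. prime p \<longrightarrow> missed p (sifted g) = {g p}}"

lemma recover_in: "recover X \<in> residues"
proof -
  have "(SOME C. C \<in> missed p X) \<in> missed p X" if "missed p X \<noteq> {}" for p using that by (simp add: some_in_eq)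
  then have "(SOME C. C \<in> missed p X) \<in> cosets (p ^ k)" if "missed p X \<noteq> {}" for p using that unfolding missed_def by blast
  then show ?thesis using zero_in by (auto simp: recover_def residues_def coset_in_cosets)
qed

lemma recover_sifted: "g \<in> recoverable \<Longrightarrow> recover (sifted g) = g"
  by (rule residues_eqI[OF recover_in]) (auto simp: recoverable_def recover_def)

lemma self_missed: "g \<in> residues \<Longrightarrow> prime p \<Longrightarrow> g p \<in> missed p (sifted g)"
  by (auto simp: missed_def residuesD sifted_def)

lemma shift_recoverable:
  assumes "t \<in> L" "g \<in> recoverable"
  shows "shift t g \<in> recoverable"
proof -
  have g: "g \<in> residues" using assms by (simp add: recoverable_def)
  have "C = shift t g p" if p: "prime p" and C: "C \<in> missed p (sifted (shift t g))" for p C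
  proof -
    have "translate (- t) C \<in> missed p (sifted g)"
    proof -
      have "translate (- t) C \<in> cosets (p ^ k)" using C by (auto simp: missed_def intro: translate_in_cosets minus_in assms)
      moreover have "translate (- t) C \<inter> sifted g = {}"
      proof (rule ccontr)
        assume "\<not> ?thesis"
        then obtain x where "x + t \<in> C" "x \<in> sifted g" by (auto simp: mem_translate)
        then have "x + t \<in> C \<inter> translate t (sifted g)" by (simp add: mem_translate)
        then show False using C by (auto simp: missed_def sifted_shift[OF assms(1)])
      qed
      ultimately show ?thesis by (simp add: missed_def)
    qed
    then have "translate (- t) C = g p" using assms(2) p by (simp add: recoverable_def)
    then have "translate t (translate (- t) C) = translate t (g p)" by simp
    then show ?thesis using p by (simp add: translate_translate translate_0 shift_def)
  qed
  then show ?thesis using shift_in[OF assms(1) g] self_missed[OF shift_in[OF assms(1) g]]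
    by (auto simp: recoverable_def)
qed

lemma mem_in_sets_hull: "{X \<in> space hull_measure. x \<in> X} \<in> sets hull_measure"
proof -
  obtain N :: nat where N: "{x} \<subseteq> ball 0 (real N + 1)" by (rule finite_subset_ball[of "{x}"]) auto
  then have "{X \<in> space hull_measure. x \<in> X} = hull.cells N {W. x \<in> W}"
    by (auto simp: hull.cells_def space_hull_measure topspace_hull_topology window_def)
  then show ?thesis using hull.cells_in_sets by (simp add: sets_hull_measure)
qed

text \<open>Missing a coset is a countable conjunction of conditions on single points, and with
  finitely many cosets \<open>missed p X\<close> takes finitely many values; this makes arbitrary
  predicates of it measurable.\<close>

lemma missed_in_sets:
  assumes "prime p"
  shows "{X \<in> space hull_measure. P (missed p X)} \<in> sets hull_measure"
proof -
  have fin: "finite (cosets (p ^ k))" using assms by (intro finite_cosets) (simp add: prime_gt_0_nat)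
  have miss: "{X \<in> space hull_measure. C \<inter> X = {}} \<in> sets hull_measure" if "C \<in> cosets (p ^ k)" for C
  proof -
    have "{X \<in> space hull_measure. C \<inter> X = {}} = space hull_measure - (\<Union>x\<in>C. {X \<in> space hull_measure. x \<in> X})" by auto
    also have "\<dots> \<in> sets hull_measure"
      using countable_subset[OF cosets_subset[OF that] countable_L] mem_in_sets_hull
      by (intro sets.Diff sets.countable_UN') auto
    finally show ?thesis .
  qed
  have eq: "{X \<in> space hull_measure. missed p X = R} \<in> sets hull_measure" if R: "R \<subseteq> cosets (p ^ k)" for R
  proof -
    have "{X \<in> space hull_measure. (C \<inter> X = {}) = (C \<in> R)} \<in> sets hull_measure" if "C \<in> cosets (p ^ k)" for C
    proof (cases "C \<in> R")
      case False
      have "{X \<in> space hull_measure. (C \<inter> X = {}) = (C \<in> R)} = space hull_measure - {X \<in> space hull_measure. C \<inter> X = {}}"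
        using False by auto
      then show ?thesis using miss[OF that] by auto
    qed (simp add: miss[OF that])
    moreover have "{X \<in> space hull_measure. missed p X = R} = {X \<in> space hull_measure. \<forall>C\<in>cosets (p ^ k). (C \<inter> X = {}) = (C \<in> R)}"
      using R by (auto simp: missed_def)
    ultimately show ?thesis using sets.sets_Collect_finite_All[OF _ fin, of hull_measure "\<lambda>C X. (C \<inter> X = {}) = (C \<in> R)"] by simp
  qed
  have "{X \<in> space hull_measure. P (missed p X)} = (\<Union>R\<in>Pow (cosets (p ^ k)) \<inter> {R. P R}. {X \<in> space hull_measure. missed p X = R})"
    by (auto simp: missed_def)
  also have "\<dots> \<in> sets hull_measure" using fin eq by (intro sets.finite_UN) auto
  finally show ?thesis .
qed

lemma measurable_recover: "recover \<in> measurable hull_measure product_measure"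
proof -
  have "recover \<in> measurable hull_measure (borel_algebra (kronecker_topology L k))"
  proof (rule kronecker.measurable_into)
    fix N v assume "v \<in> label N ` topspace (kronecker_topology L k)"
    then obtain w where w: "w \<in> residues" "v = label N w" by (auto simp: topspace_kronecker_topology)
    have "{X \<in> space hull_measure. label N (recover X) = v} = {X \<in> space hull_measure. \<forall>p\<in>primes_below N. recover X p = w p}"
      by (simp add: w(2) label_eq_iff)
    also have "\<dots> \<in> sets hull_measure"
    proof (rule sets.sets_Collect_finite_All[OF _ finite_primes_below])
      fix p assume "p \<in> primes_below N"
      then show "{X \<in> space hull_measure. recover X p = w p} \<in> sets hull_measure"
        using missed_in_sets[of p "\<lambda>R. (if R = {} then coset (p ^ k) 0 else SOME C. C \<in> R) = w p"]
        by (simp add: recover_def)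
    qed
    finally show "{X \<in> space hull_measure. label N (recover X) = v} \<in> sets hull_measure" .
  qed (simp add: topspace_kronecker_topology recover_in)
  then show ?thesis by (simp add: measurable_cong_sets[OF refl sets_product_measure])
qed

lemma recoverable_in_sets: "recoverable \<in> sets product_measure"
proof -
  have "{g \<in> space product_measure. prime p \<longrightarrow> missed p (sifted g) = {g p}} \<in> sets product_measure" for p
  proof (cases "prime p")
    case True
    then have fin: "finite (cosets (p ^ k))" by (intro finite_cosets) (simp add: prime_gt_0_nat)
    have "{g \<in> space product_measure. prime p \<longrightarrow> missed p (sifted g) = {g p}} =
        (\<Union>C\<in>cosets (p ^ k). {g \<in> residues. g p = C} \<inter> (sifted -` {X \<in> space hull_measure. missed p X = {C}} \<inter> space product_measure))"
      using True residuesD[OF _ True] sifted_in_hull by (auto simp: space_product_measure space_hull_measure)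
    also have "\<dots> \<in> sets product_measure"
    proof (rule sets.finite_UN[OF fin])
      fix C
      show "{g \<in> residues. g p = C} \<inter> (sifted -` {X \<in> space hull_measure. missed p X = {C}} \<inter> space product_measure) \<in> sets product_measure"
        using coordinate_in_sets[OF True, of "\<lambda>D. D = C"]
          measurable_sets[OF sifted_measure_preserving missed_in_sets[OF True, of "\<lambda>R. R = {C}"]] by (rule sets.Int)
    qed
    finally show ?thesis .
  qed simp
  then have "{g \<in> space product_measure. \<forall>p. prime p \<longrightarrow> missed p (sifted g) = {g p}} \<in> sets product_measure"
    by (rule sets.sets_Collect_countable_All)
  then show ?thesis by (simp add: recoverable_def space_product_measure)
qed

text \<open>A coset \<open>C \<noteq> g p\<close> contains, by the Chinese remainder theorem, a point that survives the sieve
  by the primes below \<open>N\<close>; the remaining primes strike it with probability at most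
  \<^term>\<open>tail N\<close>, independently of the coordinates below \<open>N\<close>.\<close>

lemma wrongly_missed_null:
  assumes p: "prime p" and C: "C \<in> cosets (p ^ k)"
  shows "measure product_measure {g \<in> residues. g p \<noteq> C \<and> C \<in> missed p (sifted g)} = 0"
proof -
  interpret prob_space product_measure by (rule prob_space_product_measure)
  define E where "E = {g \<in> residues. g p \<noteq> C \<and> C \<in> missed p (sifted g)}"
  have Es: "E \<in> sets product_measure"
  proof -
    have "E = {g \<in> residues. g p \<noteq> C} \<inter> (sifted -` {X \<in> space hull_measure. C \<in> missed p X} \<inter> space product_measure)"
      using sifted_in_hull by (auto simp: E_def space_product_measure space_hull_measure)
    then show ?thesis using coordinate_in_sets[OF p] measurable_sets[OF sifted_measure_preserving missed_in_sets[OF p]] by auto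
  qed
  have le: "measure product_measure E \<le> tail N" if N: "p < N" for N
  proof -
    define K where "K v = kronecker.cells N {v}" for v
    have cs: "K v \<in> sets product_measure" for v
      using kronecker.cells_in_sets by (simp add: K_def sets_product_measure)
    have cell: "measure product_measure (E \<inter> K v) \<le> measure product_measure (K v) * tail N"
      if v: "v \<in> label N ` residues" for v
    proof (cases "v p = C")
      case True
      then have "E \<inter> K v = {}" using N p by (auto simp: E_def K_def cells_singleton[OF v])
      then show ?thesis using tail_nonneg by simp
    next
      case False
      \<comment> \<open>Because \<open>k \<ge> 1\<close>, there is more than one coset at every
        prime.\<close>
      have "\<exists>D\<in>cosets (q ^ k). D \<noteq> v q" if q: "prime q" for q
      proof (rule ccontr)
        assume "\<not> ?thesis"
        then have "cosets (q ^ k) \<subseteq> {v q}" by blast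
        then have "card (cosets (q ^ k)) \<le> 1" using card_mono[of "{v q}"] by simp
        moreover have "card (cosets (q ^ k)) = (q ^ k) ^ CARD('n)" using q by (intro card_cosets) (simp add: prime_gt_0_nat)
        moreover have "q ^ k > 1" using k_pos by (intro one_less_power prime_gt_1_nat[OF q]) simp
        then have "(q ^ k) ^ CARD('n) > 1" using one_less_power[of "q ^ k" "CARD('n)"] by simp
        ultimately show False by simp
      qed
      then have "\<forall>q. \<exists>D. prime q \<longrightarrow> D \<in> cosets (q ^ k) \<and> D \<noteq> v q" by blast
      then obtain D where D: "\<And>q. prime q \<Longrightarrow> D q \<in> cosets (q ^ k) \<and> D q \<noteq> v q" by metis
      \<comment> \<open>A lattice point with these residues below \<open>N\<close> lies in
        \<open>C\<close> and avoids every coset that the cell of \<open>v\<close> removes at primes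
        below \<open>N\<close>.\<close>
      define w where "w = (\<lambda>q\<in>{q. prime q}. if q = p then C else D q)"
      have w: "w \<in> residues" using D C p by (auto simp: w_def residues_def)
      obtain x where x: "x \<in> L" "\<forall>q\<in>primes_below N. w q = coset (q ^ k) x" using embed_dense[OF w, of N] by blast
      have w_ne: "w q \<noteq> v q" if "q \<in> primes_below N" for q using D False that by (auto simp: w_def)
      have xC: "x \<in> C" using bspec[OF x(2), of p] N p self_mem_coset[of x "p ^ k"] by (simp add: w_def)
      have "E \<inter> K v \<subseteq> K v \<inter> late N {x}"
      proof
        fix g assume g: "g \<in> E \<inter> K v"
        then have gr: "g \<in> residues" "\<forall>q\<in>primes_below N. g q = v q" by (auto simp: K_def cells_singleton[OF v])
        have "x \<notin> sifted g" using g xC by (auto simp: E_def missed_def)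
        then obtain q where q: "prime q" "x \<in> g q" using x(1) by (auto simp: sifted_def)
        have "q \<ge> N"
        proof (rule ccontr)
          assume "\<not> ?thesis"
          then have "q \<in> primes_below N" using q by simp
          moreover from this have "w q = coset (q ^ k) x" "g q = v q" using x(2) gr(2) by auto
          moreover have "g q = coset (q ^ k) x" using mem_residue_iff[OF gr(1) q(1), of x] q(2) by simp
          ultimately show False using w_ne[of q] by simp
        qed
        then show "g \<in> K v \<inter> late N {x}" using g q gr by (auto simp: late_def)
      qed
      then have "measure product_measure (E \<inter> K v) \<le> measure product_measure (K v \<inter> late N {x})"
        using cs late_in_sets by (intro finite_measure_mono) auto
      also have "\<dots> \<le> (\<Prod>q\<in>primes_below N. weight q) * (card {x} * tail N)"
        unfolding K_def cells_singleton[OF v] using finite_primes_below label_value[OF v] x(1) by (intro measure_late) auto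
      finally show ?thesis using measure_cell[OF v] by (simp add: K_def)
    qed
    have "measure product_measure E = (\<Sum>v\<in>label N ` residues. measure product_measure (E \<inter> K v))"
    proof -
      have "E = (\<Union>v\<in>label N ` residues. E \<inter> K v)" by (auto simp: E_def K_def kronecker.cells_def topspace_kronecker_topology)
      also have "measure product_measure \<dots> = (\<Sum>v\<in>label N ` residues. measure product_measure (E \<inter> K v))"
        using Es cs finite_label_residues
        by (intro finite_measure_finite_Union) (auto simp: disjoint_family_on_def, auto simp: K_def kronecker.cells_def)
      finally show ?thesis .
    qed
    also have "\<dots> \<le> (\<Sum>v\<in>label N ` residues. measure product_measure (K v) * tail N)" using cell by (intro sum_mono) auto
    also have "\<dots> = measure product_measure (kronecker.cells N UNIV) * tail N"
      using kronecker.measure_cells[OF finite_measure_axioms sets_product_measure, of N UNIV]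
      by (simp add: K_def sum_distrib_right topspace_kronecker_topology)
    also have "\<dots> \<le> 1 * tail N" using tail_nonneg by (intro mult_right_mono) auto
    finally show ?thesis by simp
  qed
  have "measure product_measure E \<le> 0"
    by (rule LIMSEQ_le_const[OF tail_limit]) (use le in \<open>auto intro!: exI[of _ "Suc p"]\<close>)
  then show ?thesis by (simp add: E_def[symmetric] measure_le_0_iff)
qed

lemma AE_recoverable: "AE g in product_measure. g \<in> recoverable"
proof -
  interpret prob_space product_measure by (rule prob_space_product_measure)
  have "AE g in product_measure. \<forall>p\<in>{p. prime p}. \<forall>C\<in>cosets (p ^ k). \<not> (g p \<noteq> C \<and> C \<in> missed p (sifted g))"
  proof (rule AE_ball_countable', rule AE_finite_allI)
    fix p :: nat assume p: "p \<in> {p. prime p}"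
    then show "finite (cosets (p ^ k))" by (intro finite_cosets) (simp add: prime_gt_0_nat)
    fix C assume C: "C \<in> cosets (p ^ k)"
    have "{g \<in> residues. g p \<noteq> C} \<inter> (sifted -` {X \<in> space hull_measure. C \<in> missed p X} \<inter> space product_measure) \<in> sets product_measure"
      using coordinate_in_sets[of p] p measurable_sets[OF sifted_measure_preserving missed_in_sets[of p]] by auto
    also have "{g \<in> residues. g p \<noteq> C} \<inter> (sifted -` {X \<in> space hull_measure. C \<in> missed p X} \<inter> space product_measure)
        = {g \<in> residues. g p \<noteq> C \<and> C \<in> missed p (sifted g)}"
      using sifted_in_hull by (auto simp: space_product_measure space_hull_measure)
    finally have "{g \<in> residues. g p \<noteq> C \<and> C \<in> missed p (sifted g)} \<in> sets product_measure" .
    then show "AE g in product_measure. \<not> (g p \<noteq> C \<and> C \<in> missed p (sifted g))"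
      using wrongly_missed_null[of p C] p C
      by (intro AE_I[where N = "{g \<in> residues. g p \<noteq> C \<and> C \<in> missed p (sifted g)}"]) (auto simp: space_product_measure emeasure_eq_measure)
  qed auto
  then show ?thesis
  proof (rule AE_mp, intro AE_I2 impI)
    fix g assume g: "g \<in> space product_measure"
      "\<forall>p\<in>{p. prime p}. \<forall>C\<in>cosets (p ^ k). \<not> (g p \<noteq> C \<and> C \<in> missed p (sifted g))"
    have "missed p (sifted g) = {g p}" if "prime p" for p
    proof -
      have "missed p (sifted g) \<subseteq> cosets (p ^ k)" by (auto simp: missed_def)
      then show ?thesis using g that self_missed[of g p] by (auto simp: space_product_measure)
    qed
    then show "g \<in> recoverable" using g by (simp add: recoverable_def space_product_measure)
  qed
qed

lemma emeasure_unrecoverable: "emeasure product_measure (space product_measure - recoverable) = 0"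
  using AE_recoverable recoverable_in_sets by (subst (asm) AE_iff_measurable[OF _ refl]) (auto simp: set_diff_eq)

text \<open>This is the image of \<open>recoverable\<close> under \<open>sifted\<close>, described
  through the inverse map so that its measurability follows from preimages and countably many
  membership conditions.\<close>

definition faithful :: "(real ^ 'n) set set" where
  "faithful = {X \<in> space hull_measure. recover X \<in> recoverable \<and> sifted (recover X) = X}"

lemma sifted_faithful: "g \<in> recoverable \<Longrightarrow> sifted g \<in> faithful"
  using sifted_in_hull by (auto simp: faithful_def recover_sifted space_hull_measure recoverable_def)

lemma faithful_in_sets: "faithful \<in> sets hull_measure"
proof -
  have 1: "recover -` recoverable \<inter> space hull_measure \<in> sets hull_measure"
    by (rule measurable_sets[OF measurable_recover recoverable_in_sets])
  have 2: "{X \<in> space hull_measure. x \<in> sifted (recover X) \<longleftrightarrow> x \<in> X} \<in> sets hull_measure" for x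
  proof -
    have a: "recover -` {g \<in> residues. x \<in> sifted g} \<inter> space hull_measure \<in> sets hull_measure"
      by (rule measurable_sets[OF measurable_recover mem_sifted_in_sets])
    have b: "recover -` {g \<in> residues. x \<in> sifted g} \<inter> space hull_measure = {X \<in> space hull_measure. x \<in> sifted (recover X)}"
      using recover_in by auto
    have "{X \<in> space hull_measure. x \<in> sifted (recover X) \<longleftrightarrow> x \<in> X} =
        ({X \<in> space hull_measure. x \<in> sifted (recover X)} \<inter> {X \<in> space hull_measure. x \<in> X}) \<union>
        (space hull_measure - ({X \<in> space hull_measure. x \<in> sifted (recover X)} \<union> {X \<in> space hull_measure. x \<in> X}))"
      by blast
    then show ?thesis using a mem_in_sets_hull[of x] unfolding b by (simp only: sets.Int sets.Un sets.Diff sets.top)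
  qed
  have "faithful = (recover -` recoverable \<inter> space hull_measure) \<inter> {X \<in> space hull_measure. \<forall>x\<in>L. x \<in> sifted (recover X) \<longleftrightarrow> x \<in> X}"
    using sifted_subset discrete_hull_subset by (auto simp: faithful_def space_hull_measure) blast+
  moreover have "{X \<in> space hull_measure. \<forall>x\<in>L. x \<in> sifted (recover X) \<longleftrightarrow> x \<in> X} \<in> sets hull_measure"
  proof -
    have "{X \<in> space hull_measure. \<forall>x\<in>L. x \<in> sifted (recover X) \<longleftrightarrow> x \<in> X} =
        space hull_measure - (\<Union>x\<in>L. space hull_measure - {X \<in> space hull_measure. x \<in> sifted (recover X) \<longleftrightarrow> x \<in> X})"
      by blast
    also have "\<dots> \<in> sets hull_measure" using 2 countable_L by (intro sets.Diff sets.countable_UN') auto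
    finally show ?thesis .
  qed
  ultimately show ?thesis using 1 by auto
qed

lemma emeasure_unfaithful: "emeasure hull_measure (space hull_measure - faithful) = 0"
proof -
  have "emeasure hull_measure (space hull_measure - faithful) = emeasure product_measure (sifted -` (space hull_measure - faithful) \<inter> space product_measure)"
    by (subst hull_measure_eq, rule emeasure_distr[OF sifted_measure_preserving]) (use faithful_in_sets in auto)
  also have "\<dots> \<le> emeasure product_measure (space product_measure - recoverable)"
    using sifted_faithful recoverable_in_sets by (intro emeasure_mono) auto
  finally show ?thesis using emeasure_unrecoverable by simp
qed

lemma AE_faithful: "AE X in hull_measure. X \<in> faithful"
  using emeasure_unfaithful faithful_in_sets by (intro AE_I[where N = "space hull_measure - faithful"]) auto

lemma translate_faithful:
  assumes "t \<in> L" "X \<in> faithful"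
  shows "translate t X \<in> faithful" "recover (translate t X) = shift t (recover X)"
proof -
  have "X = sifted (recover X)" "recover X \<in> recoverable" using assms by (auto simp: faithful_def)
  then have "translate t X = sifted (shift t (recover X))" "shift t (recover X) \<in> recoverable"
    using sifted_shift[OF assms(1), of "recover X"] shift_recoverable[OF assms(1)] by auto
  then show "translate t X \<in> faithful" "recover (translate t X) = shift t (recover X)"
    using sifted_faithful recover_sifted by auto
qed

theorem kronecker_isomorphic:
  "metrically_isomorphic L (kronecker_action L k) (kronecker_measure L k) translate hull_measure"
proof -
  have AX: "recoverable \<subseteq> residues" by (auto simp: recoverable_def)
  have phi: "sifted \<in> measurable (restrict_space product_measure recoverable) (restrict_space hull_measure faithful)"
    using sifted_faithful by (intro measurable_restrict_space3[OF sifted_measure_preserving]) auto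
  have psi: "recover \<in> measurable (restrict_space hull_measure faithful) (restrict_space product_measure recoverable)"
    by (intro measurable_restrict_space3[OF measurable_recover]) (auto simp: faithful_def)
  have distr: "distr (restrict_space product_measure recoverable) (restrict_space hull_measure faithful) sifted = restrict_space hull_measure faithful"
  proof (rule measure_eqI)
    fix Y assume "Y \<in> sets (distr (restrict_space product_measure recoverable) (restrict_space hull_measure faithful) sifted)"
    then have Y: "Y \<in> sets (restrict_space hull_measure faithful)" by simp
    then have YS: "Y \<subseteq> faithful" "Y \<in> sets hull_measure"
      using faithful_in_sets by (auto simp: sets_restrict_space_iff)
    have Y': "sifted -` Y \<inter> space product_measure \<in> sets product_measure"
      by (rule measurable_sets[OF sifted_measure_preserving YS(2)])
    have "emeasure (distr (restrict_space product_measure recoverable) (restrict_space hull_measure faithful) sifted) Y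
        = emeasure (restrict_space product_measure recoverable) (sifted -` Y \<inter> recoverable)"
      using emeasure_distr[OF phi Y] recoverable_in_sets AX
      by (simp add: space_restrict_space space_product_measure Int_absorb2)
    also have "\<dots> = emeasure product_measure (sifted -` Y \<inter> recoverable)"
      using recoverable_in_sets by (intro emeasure_restrict_space) auto
    \<comment> \<open>The points outside \<open>recoverable\<close> form a null set, so the
      restricted preimage has the measure of the full one.\<close>
    also have "\<dots> = emeasure product_measure (sifted -` Y \<inter> space product_measure)"
    proof (rule emeasure_eq_AE)
      show "AE g in product_measure. g \<in> sifted -` Y \<inter> recoverable \<longleftrightarrow> g \<in> sifted -` Y \<inter> space product_measure"
        using AE_recoverable by (rule AE_mp) (auto intro!: AE_I2)
      have "sifted -` Y \<inter> recoverable = (sifted -` Y \<inter> space product_measure) \<inter> recoverable"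
        using AX by (auto simp: space_product_measure)
      then show "sifted -` Y \<inter> recoverable \<in> sets product_measure" using Y' recoverable_in_sets by auto
    qed (rule Y')
    also have "\<dots> = emeasure hull_measure Y"
      by (subst hull_measure_eq) (rule emeasure_distr[OF sifted_measure_preserving YS(2), symmetric])
    also have "\<dots> = emeasure (restrict_space hull_measure faithful) Y"
      using faithful_in_sets YS by (intro emeasure_restrict_space[symmetric]) auto
    finally show "emeasure (distr (restrict_space product_measure recoverable) (restrict_space hull_measure faithful) sifted) Y
      = emeasure (restrict_space hull_measure faithful) Y" .
  qed simp
  show ?thesis
    unfolding metrically_isomorphic_def kronecker_measure_eq
    by (rule exI[of _ recoverable], rule exI[of _ faithful], rule exI[of _ sifted], rule exI[of _ recover])
      (use recoverable_in_sets emeasure_unrecoverable faithful_in_sets emeasure_unfaithful phi psi distr translate_faithful AX in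
        \<open>auto simp: kronecker_action_eq shift_recoverable recover_sifted subset_iff sifted_shift, auto simp: faithful_def\<close>)
qed

end

section \<open>Entropy\<close>

text \<open>Gibbs' inequality, from \<open>ln t \<le> t - 1\<close> at \<open>t = q w / p w\<close>.
  Allowing \<open>q\<close> total mass below 1 leaves room for crude choices of the comparison
  distribution.\<close>

lemma (in prob_space) entropy_le_cross_entropy:
  fixes q :: "'b \<Rightarrow> real"
  assumes X: "simple_function M X" and q: "\<And>x. x \<in> space M \<Longrightarrow> q (X x) > 0" "(\<Sum>w\<in>X ` space M. q w) \<le> 1"
  shows "entropy (exp 1) (count_space (X ` space M)) X \<le> (\<integral>x. - ln (q (X x)) \<partial>M)"
proof -
  interpret information_space M "exp 1" by unfold_locales simp
  define p where "p w = prob (X -` {w} \<inter> space M)" for w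
  have fin: "finite (X ` space M)" using X by (simp add: simple_function_def)
  have sets: "X -` {w} \<inter> space M \<in> events" if "w \<in> X ` space M" for w
    using X that by (auto simp: simple_function_def)
  have sum_p: "(\<Sum>w\<in>X ` space M. p w) = 1"
  proof -
    have "(\<Sum>w\<in>X ` space M. p w) = prob (\<Union>w\<in>X ` space M. X -` {w} \<inter> space M)"
      unfolding p_def using fin sets
      by (intro finite_measure_finite_Union[symmetric]) (auto simp: disjoint_family_on_def)
    also have "(\<Union>w\<in>X ` space M. X -` {w} \<inter> space M) = space M" by auto
    finally show ?thesis by (simp add: prob_space)
  qed
  have le: "p w * (- ln (p w)) \<le> p w * (- ln (q w)) + (q w - p w)" if "w \<in> X ` space M" for w
  proof (cases "p w = 0")
    case True
    then show ?thesis using q(1) that by (auto intro: less_imp_le)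
  next
    case False
    then have p: "p w > 0" using measure_nonneg[of M "X -` {w} \<inter> space M"] unfolding p_def by linarith
    have qw: "q w > 0" using q(1) that by auto
    have "ln (q w / p w) \<le> q w / p w - 1" using p qw by (intro ln_le_minus_one) simp
    then have "p w * ln (q w / p w) \<le> p w * (q w / p w - 1)" using p by (intro mult_left_mono) auto
    also have "\<dots> = q w - p w" using p by (simp add: field_simps)
    finally show ?thesis using p qw by (simp add: ln_div algebra_simps)
  qed
  have "entropy (exp 1) (count_space (X ` space M)) X = - (\<Sum>w\<in>X ` space M. p w * log (exp 1) (p w))"
    unfolding p_def by (rule entropy_simple_distributed[OF simple_distributedI[OF X measure_nonneg refl]])
  also have "\<dots> = (\<Sum>w\<in>X ` space M. p w * (- ln (p w)))" by (simp add: log_def sum_negf)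
  also have "\<dots> \<le> (\<Sum>w\<in>X ` space M. p w * (- ln (q w)) + (q w - p w))" by (rule sum_mono[OF le])
  also have "\<dots> = (\<Sum>w\<in>X ` space M. p w * (- ln (q w))) + ((\<Sum>w\<in>X ` space M. q w) - 1)"
    by (simp add: sum.distrib sum_subtractf sum_p sum_negf)
  also have "\<dots> \<le> (\<Sum>w\<in>X ` space M. p w * (- ln (q w)))" using q(2) by simp
  also have "\<dots> = (\<integral>x. - ln (q (X x)) \<partial>M)"
  proof -
    have eq: "- ln (q (X x)) = (\<Sum>w\<in>X ` space M. - ln (q w) * indicat_real (X -` {w} \<inter> space M) x)" if "x \<in> space M" for x
    proof -
      have "(\<Sum>w\<in>X ` space M. - ln (q w) * indicat_real (X -` {w} \<inter> space M) x) = (\<Sum>w\<in>{X x}. - ln (q w))"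
        using that fin by (intro sum.mono_neutral_cong_right) auto
      then show ?thesis by simp
    qed
    have "(\<integral>x. - ln (q (X x)) \<partial>M) = (\<integral>x. (\<Sum>w\<in>X ` space M. - ln (q w) * indicat_real (X -` {w} \<inter> space M) x) \<partial>M)"
      by (rule Bochner_Integration.integral_cong[OF refl eq])
    also have "\<dots> = (\<Sum>w\<in>X ` space M. \<integral>x. - ln (q w) * indicat_real (X -` {w} \<inter> space M) x \<partial>M)"
      using sets by (intro Bochner_Integration.integral_sum integrable_mult_right) (auto simp: less_top[symmetric])
    also have "\<dots> = (\<Sum>w\<in>X ` space M. p w * (- ln (q w)))"
      by (intro sum.cong refl) (simp add: p_def mult.commute)
    finally show ?thesis by (simp add: sum_negf)
  qed
  finally show ?thesis .
qed

lemma (in prob_space) entropy_nonneg_exp: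
  assumes X: "simple_function M X"
  shows "entropy (exp 1) (count_space (X ` space M)) X \<ge> 0"
proof -
  interpret information_space M "exp 1" by unfold_locales simp
  have "entropy (exp 1) (count_space (X ` space M)) X =
      - (\<Sum>w\<in>X ` space M. prob (X -` {w} \<inter> space M) * log (exp 1) (prob (X -` {w} \<inter> space M)))"
    by (rule entropy_simple_distributed[OF simple_distributedI[OF X measure_nonneg refl]])
  moreover have "prob (X -` {w} \<inter> space M) * log (exp 1) (prob (X -` {w} \<inter> space M)) \<le> 0" for w
  proof (cases "prob (X -` {w} \<inter> space M) = 0")
    case False
    then have "0 < prob (X -` {w} \<inter> space M)" using measure_nonneg[of M "X -` {w} \<inter> space M"] by linarith
    then show ?thesis by (simp add: log_def mult_nonneg_nonpos)
  qed simp
  ultimately show ?thesis by (simp add: sum_nonpos)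
qed

lemma simple_function_refinement:
  assumes "finite F" "\<And>t. t \<in> F \<Longrightarrow> T t \<in> measurable M M" and \<xi>: "simple_function M \<xi>"
  shows "simple_function M (\<lambda>x. \<lambda>t\<in>F. \<xi> (T t x))"
  unfolding simple_function_def
proof (intro conjI ballI)
  have "(\<lambda>x. \<lambda>t\<in>F. \<xi> (T t x)) ` space M \<subseteq> F \<rightarrow>\<^sub>E \<xi> ` space M"
    by (intro image_subsetI) (auto simp: restrict_PiE_iff intro!: imageI measurable_space[OF assms(2)])
  moreover have "finite (F \<rightarrow>\<^sub>E \<xi> ` space M)" using assms by (intro finite_PiE) (auto simp: simple_function_def)
  ultimately show "finite ((\<lambda>x. \<lambda>t\<in>F. \<xi> (T t x)) ` space M)" by (rule finite_subset)
  fix w assume "w \<in> (\<lambda>x. \<lambda>t\<in>F. \<xi> (T t x)) ` space M"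
  then obtain z where w: "w = (\<lambda>t\<in>F. \<xi> (T t z))" "z \<in> space M" by auto
  have "(\<lambda>x. \<lambda>t\<in>F. \<xi> (T t x)) -` {w} \<inter> space M = {x \<in> space M. \<forall>t\<in>F. \<xi> (T t x) = \<xi> (T t z)}"
    by (auto simp: w fun_eq_iff) (metis restrict_apply')
  also have "\<dots> \<in> sets M"
  proof (rule sets.sets_Collect_finite_All[OF _ assms(1)])
    fix t assume t: "t \<in> F"
    have "\<xi> -` {\<xi> (T t z)} \<inter> space M \<in> sets M"
      using \<xi> measurable_space[OF assms(2)[OF t] w(2)] by (auto simp: simple_function_def)
    from measurable_sets[OF assms(2)[OF t] this]
    show "{x \<in> space M. \<xi> (T t x) = \<xi> (T t z)} \<in> sets M"
      using measurable_space[OF assms(2)[OF t]] by (auto simp: vimage_def Int_def conj_commute elim!: back_subst[of "\<lambda>A. A \<in> sets M"])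
  qed
  finally show "(\<lambda>x. \<lambda>t\<in>F. \<xi> (T t x)) -` {w} \<inter> space M \<in> sets M" .
qed

context kfree_lattice
begin

text \<open>All labels along an orbit are determined by the label at its start, so for a fixed level
  the number of predicted words does not grow with the set of translations.\<close>

lemma label_shift_label: "label N (shift t (label N g)) = label N (shift t g)"
  by (subst label_eq_iff) (simp add: shift_def label_def)

text \<open>The comparison distribution \<open>q\<close> averages, over the finitely many values \<open>v\<close> of
  \<^term>\<open>label N\<close>, the law of the words that copy the word read off \<open>v\<close> with independent
  errors of probability about \<open>\<delta>\<close>.\<close>

lemma refined_entropy_le:
  assumes \<xi>: "simple_function hull_measure \<xi>" and "e > 0"
  shows "\<exists>c. \<forall>F. finite F \<longrightarrow> F \<subseteq> L \<longrightarrow> refined_entropy translate hull_measure \<xi> F \<le> c + real (card F) * (2 * e)"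
proof -
  interpret mu: prob_space product_measure by (rule prob_space_product_measure)
  interpret nu: prob_space hull_measure by (rule prob_space_hull_measure)
  define S where "S = \<xi> ` space hull_measure"
  have S: "finite S" "S \<noteq> {}" using \<xi> nu.not_empty by (auto simp: S_def simple_function_def)
  define s where "s = real (card S)"
  have s: "s \<ge> 1" using S by (simp add: s_def Suc_leI card_gt_0_iff)
  \<comment> \<open>The error rate is chosen so that a correctly predicted letter costs exactly
    \<open>- ln (1 - \<delta>) = e\<close>.\<close>
  define \<delta> where "\<delta> = 1 - exp (- e)"
  have \<delta>: "\<delta> > 0" "\<delta> < 1" "- ln (1 - \<delta>) = e" using \<open>e > 0\<close> by (auto simp: \<delta>_def)
  \<comment> \<open>The cost of a wrongly predicted letter, whose comparison probability is
    \<open>\<delta> / s\<close>.\<close>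
  define \<kappa> where "\<kappa> = ln (s / \<delta>)"
  have \<kappa>: "\<kappa> \<ge> 0" using s \<delta> by (simp add: \<kappa>_def)
  define \<xi>' where "\<xi>' g = \<xi> (sifted g)" for g
  have \<xi>'_S: "\<xi>' g \<in> S" if "g \<in> residues" for g
    using sifted_in_hull[OF that] by (auto simp: S_def \<xi>'_def space_hull_measure)
  have \<xi>': "simple_function product_measure \<xi>'"
    unfolding simple_function_def
  proof (intro conjI ballI)
    show "finite (\<xi>' ` space product_measure)"
      by (rule finite_subset[OF _ S(1)]) (auto simp: space_product_measure \<xi>'_S)
    fix y assume "y \<in> \<xi>' ` space product_measure"
    then have "y \<in> S" using \<xi>'_S by (auto simp: space_product_measure)
    then have "\<xi> -` {y} \<inter> space hull_measure \<in> sets hull_measure" using \<xi> by (auto simp: S_def simple_function_def)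
    from measurable_sets[OF sifted_measure_preserving this]
    have "sifted -` (\<xi> -` {y} \<inter> space hull_measure) \<inter> space product_measure \<in> sets product_measure" .
    moreover have "sifted -` (\<xi> -` {y} \<inter> space hull_measure) \<inter> space product_measure = \<xi>' -` {y} \<inter> space product_measure"
      using sifted_in_hull by (auto simp: \<xi>'_def space_product_measure space_hull_measure)
    ultimately show "\<xi>' -` {y} \<inter> space product_measure \<in> sets product_measure" by simp
  qed
  \<comment> \<open>The approximation must be good enough that the mean cost
    \<open>\<eta> * \<kappa>\<close> of wrong letters is at most \<open>e\<close>; the added 1
    guards against a zero denominator.\<close>
  define \<eta> where "\<eta> = e / (\<kappa> + 1)"
  have \<eta>: "\<eta> > 0" "\<eta> * \<kappa> \<le> e" using \<kappa> \<open>e > 0\<close> by (auto simp: \<eta>_def field_simps)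
  obtain N \<gamma> where \<gamma>: "\<forall>v. \<gamma> v \<in> \<xi>' ` space product_measure"
    and Bad_sets: "{g \<in> space product_measure. \<xi>' g \<noteq> \<gamma> (label N g)} \<in> sets product_measure"
    and Bad: "measure product_measure {g \<in> space product_measure. \<xi>' g \<noteq> \<gamma> (label N g)} < \<eta>"
    using kronecker.approximate_simple_function[OF prob_space_product_measure sets_product_measure \<xi>' \<eta>(1)] by blast
  have \<gamma>S: "\<gamma> v \<in> S" for v using \<gamma> \<xi>'_S by (metis image_iff space_product_measure)
  define B where "B = {g \<in> residues. \<xi>' g \<noteq> \<gamma> (label N g)}"
  have B: "B \<in> sets product_measure" "measure product_measure B < \<eta>"
    using Bad Bad_sets by (simp_all add: B_def space_product_measure)
  \<comment> \<open>Every wrong letter gets \<open>\<delta> / s\<close>. There are at most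
    \<open>s\<close> of them, so each row has sum at most 1, as Gibbs' inequality permits.\<close>
  define K where "K a b = (if a = b then 1 - \<delta> else \<delta> / s)" for a b :: nat
  have Kpos: "K a b > 0" for a b using \<delta> s by (simp add: K_def)
  have Kne: "K a b \<noteq> 0" for a b using Kpos[of a b] by simp
  have Ksum: "(\<Sum>b\<in>S. K a b) \<le> 1" if "a \<in> S" for a
  proof -
    have "(\<Sum>b\<in>S. K a b) = K a a + (\<Sum>b\<in>S - {a}. K a b)" using S that by (intro sum.remove)
    also have "(\<Sum>b\<in>S - {a}. K a b) = (\<Sum>b\<in>S - {a}. \<delta> / s)" by (intro sum.cong) (auto simp: K_def)
    also have "\<dots> = real (card (S - {a})) * (\<delta> / s)" by simp
    also have "\<dots> \<le> s * (\<delta> / s)" using S \<delta> s by (intro mult_right_mono) (auto simp: s_def card_Diff1_le)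
    also have "\<dots> = \<delta>" using s by simp
    finally show ?thesis by (simp add: K_def)
  qed
  define V where "V = label N ` residues"
  have V: "finite V" "V \<noteq> {}" using finite_label_residues embed_in[OF zero_in] by (auto simp: V_def)
  define n where "n = real (card V)"
  have n: "n > 0" using V by (simp add: n_def card_gt_0_iff)
  show ?thesis
  proof (intro exI[of _ "ln n"] allI impI)
    fix F assume F: "finite F" "F \<subseteq> L"
    define J where "J X = (\<lambda>t\<in>F. \<xi> (translate t X))" for X
    have J: "simple_function hull_measure J"
      unfolding J_def using F measurable_translate by (intro simple_function_refinement[OF F(1) _ \<xi>]) auto
    define Q where "Q v w = (\<Prod>t\<in>F. K (\<gamma> (label N (shift t v))) (w t))" for v w
    define q where "q w = (\<Sum>v\<in>V. Q v w) / n" for w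
    have Qpos: "Q v w > 0" for v w unfolding Q_def using Kpos by (intro prod_pos) auto
    have Qne: "Q v w \<noteq> 0" for v w using Qpos[of v w] by simp
    have qpos: "q w > 0" for w unfolding q_def using Qpos V n by (intro divide_pos_pos sum_pos) auto
    have "(\<Sum>w\<in>J ` space hull_measure. q w) \<le> (\<Sum>w\<in>F \<rightarrow>\<^sub>E S. q w)"
    proof (rule sum_mono2)
      show "finite (F \<rightarrow>\<^sub>E S)" using F S by (intro finite_PiE) auto
      show "J ` space hull_measure \<subseteq> F \<rightarrow>\<^sub>E S"
        using F(2) translate_hull by (auto simp: J_def S_def space_hull_measure)
    qed (use qpos in \<open>auto intro: less_imp_le\<close>)
    also have "\<dots> = (\<Sum>v\<in>V. \<Sum>w\<in>F \<rightarrow>\<^sub>E S. Q v w) / n"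
      unfolding q_def sum_divide_distrib[symmetric] by (subst sum.swap) simp
    also have "\<dots> \<le> (\<Sum>v\<in>V. 1) / n"
    proof (intro divide_right_mono sum_mono)
      fix v
      have "(\<Sum>w\<in>F \<rightarrow>\<^sub>E S. Q v w) = (\<Prod>t\<in>F. \<Sum>b\<in>S. K (\<gamma> (label N (shift t v))) b)"
        unfolding Q_def using F S by (intro prod_sum_PiE[symmetric]) auto
      also have "\<dots> \<le> 1" by (intro prod_le_1) (auto intro!: sum_nonneg Ksum \<gamma>S simp: less_imp_le[OF Kpos])
      finally show "(\<Sum>w\<in>F \<rightarrow>\<^sub>E S. Q v w) \<le> 1" .
    qed (use n in simp)
    also have "\<dots> = 1" using n by (simp add: n_def)
    finally have qsum: "(\<Sum>w\<in>J ` space hull_measure. q w) \<le> 1" .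
    have Bt: "{g \<in> residues. shift t g \<in> B} \<in> sets product_measure" if "t \<in> F" for t
    proof -
      have "shift t -` B \<inter> space product_measure \<in> sets product_measure"
        using measurable_sets[OF measurable_shift B(1)] that F by auto
      then show ?thesis by (simp add: space_product_measure vimage_def Int_def conj_commute)
    qed
    have "refined_entropy translate hull_measure \<xi> F = nu.entropy (exp 1) (count_space (J ` space hull_measure)) J"
      by (simp add: refined_entropy_def Let_def J_def[abs_def])
    also have "\<dots> \<le> (\<integral>X. - ln (q (J X)) \<partial>hull_measure)"
      by (rule nu.entropy_le_cross_entropy[OF J qpos qsum])
    also have "\<dots> = (\<integral>g. - ln (q (J (sifted g))) \<partial>product_measure)"
    proof -
      have "(\<lambda>X. - ln (q (J X))) \<in> borel_measurable hull_measure"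
        by (rule borel_measurable_simple_function[OF simple_function_compose1[OF J, of "\<lambda>w. - ln (q w)"]])
      then show ?thesis by (subst hull_measure_eq) (rule integral_distr[OF sifted_measure_preserving])
    qed
    also have "\<dots> \<le> (\<integral>g. ln n + (\<Sum>t\<in>F. e + \<kappa> * indicator {g \<in> residues. shift t g \<in> B} g) \<partial>product_measure)"
    proof (rule integral_mono)
      show "integrable product_measure (\<lambda>g. ln n + (\<Sum>t\<in>F. e + \<kappa> * indicator {g \<in> residues. shift t g \<in> B} g))"
        using Bt by (intro Bochner_Integration.integrable_add Bochner_Integration.integrable_sum integrable_mult_right)
          (auto simp: less_top[symmetric])
      show "integrable product_measure (\<lambda>g. - ln (q (J (sifted g))))"
      proof (rule integrable_distr[OF sifted_measure_preserving])
        have sf: "simple_function hull_measure (\<lambda>X. - ln (q (J X)))"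
          by (rule simple_function_compose1[OF J, of "\<lambda>w. - ln (q w)"])
        have "integrable hull_measure (\<lambda>X. - ln (q (J X)))"
        proof (rule nu.integrable_const_bound)
          show "AE X in hull_measure. norm (- ln (q (J X))) \<le> Max (abs ` (\<lambda>X. - ln (q (J X))) ` space hull_measure)"
            unfolding real_norm_def
            by (intro AE_I2 Max_ge[OF finite_imageI[OF simple_functionD(1)[OF sf]]] imageI)
        qed (rule borel_measurable_simple_function[OF sf])
        then show "integrable (distr product_measure hull_measure sifted) (\<lambda>X. - ln (q (J X)))" by (simp add: hull_measure_eq[symmetric])
      qed
      fix g assume "g \<in> space product_measure"
      then have g: "g \<in> residues" by (simp add: space_product_measure)
      have Jt: "J (sifted g) t = \<xi>' (shift t g)" if "t \<in> F" for t
        using that F(2) by (auto simp: J_def \<xi>'_def sifted_shift)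
      \<comment> \<open>Of the average over labels only the term of the true label is kept. This
        costs \<open>ln n\<close>, a constant independent of \<open>F\<close>.\<close>
      have "Q (label N g) (J (sifted g)) \<le> (\<Sum>v\<in>V. Q v (J (sifted g)))"
        using V g Qpos by (intro member_le_sum) (auto simp: V_def less_imp_le)
      then have "ln (Q (label N g) (J (sifted g)) / n) \<le> ln (q (J (sifted g)))"
        unfolding q_def using n Qpos by (intro ln_mono divide_right_mono divide_pos_pos) auto
      then have "- ln (q (J (sifted g))) \<le> ln n - ln (Q (label N g) (J (sifted g)))"
        using n Qne by (simp add: ln_div)
      also have "ln (Q (label N g) (J (sifted g))) = (\<Sum>t\<in>F. ln (K (\<gamma> (label N (shift t g))) (\<xi>' (shift t g))))"
        unfolding Q_def using F Kpos Kne by (subst ln_prod) (auto simp: label_shift_label Jt intro!: sum.cong)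
      also have "ln n - \<dots> \<le> ln n + (\<Sum>t\<in>F. e + \<kappa> * indicator {g \<in> residues. shift t g \<in> B} g)"
        unfolding diff_conv_add_uminus sum_negf[symmetric]
      proof (intro add_left_mono sum_mono)
        fix t assume t: "t \<in> F"
        have "shift t g \<in> residues" using shift_in g t F by auto
        then show "- ln (K (\<gamma> (label N (shift t g))) (\<xi>' (shift t g))) \<le> e + \<kappa> * indicator {g \<in> residues. shift t g \<in> B} g"
          using g \<delta> s \<open>e > 0\<close> by (auto simp: K_def B_def \<kappa>_def ln_div)
      qed
      finally show "- ln (q (J (sifted g))) \<le> ln n + (\<Sum>t\<in>F. e + \<kappa> * indicator {g \<in> residues. shift t g \<in> B} g)" .
    qed
    also have "\<dots> = ln n + (\<Sum>t\<in>F. e + \<kappa> * measure product_measure B)"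
    proof -
      have int: "integrable product_measure (\<lambda>g. e + \<kappa> * indicator {g \<in> residues. shift t g \<in> B} g)" if "t \<in> F" for t
        using Bt[OF that] by (intro Bochner_Integration.integrable_add integrable_mult_right) (auto simp: less_top[symmetric])
      have "(\<integral>g. e + \<kappa> * indicator {g \<in> residues. shift t g \<in> B} g \<partial>product_measure) = e + \<kappa> * measure product_measure B" if t: "t \<in> F" for t
      proof -
        have "(\<integral>g. e + \<kappa> * indicator {g \<in> residues. shift t g \<in> B} g \<partial>product_measure)
            = e + \<kappa> * measure product_measure ({g \<in> residues. shift t g \<in> B} \<inter> space product_measure)"
          using Bt[OF t] by (subst Bochner_Integration.integral_add) (auto simp: less_top[symmetric] mu.prob_space)
        also have "{g \<in> residues. shift t g \<in> B} \<inter> space product_measure = {g \<in> residues. shift t g \<in> B}"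
          by (auto simp: space_product_measure)
        finally show ?thesis using measure_shift_preimage[OF _ B(1), of t] t F by auto
      qed
      then show ?thesis using int
        by (subst Bochner_Integration.integral_add) (auto simp: mu.prob_space Bochner_Integration.integral_sum intro!: Bochner_Integration.integrable_sum)
    qed
    also have "\<dots> = ln n + real (card F) * (e + \<kappa> * measure product_measure B)" by simp
    also have "\<dots> \<le> ln n + real (card F) * (2 * e)"
    proof -
      have "\<kappa> * measure product_measure B \<le> \<kappa> * \<eta>" using B(2) \<kappa> by (intro mult_left_mono) auto
      then show ?thesis using \<eta>(2) by (intro add_left_mono mult_left_mono) (auto simp: mult.commute)
    qed
    finally show "refined_entropy translate hull_measure \<xi> F \<le> ln n + real (card F) * (2 * e)" .
  qed
qed

lemma card_ball_at_top: "filterlim (\<lambda>R. real (card (L \<inter> ball 0 R))) at_top at_top"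
proof (rule filterlim_at_top_mono)
  define u where "u = measure lborel (ball (0 :: real ^ 'n) 1)"
  have u: "u > 0" using unit_ball_pos by (simp add: u_def)
  show "filterlim (\<lambda>R. u * (R - cell_diam)) at_top at_top"
    unfolding filterlim_at_top
  proof
    fix Z
    show "\<forall>\<^sub>F R in at_top. Z \<le> u * (R - cell_diam)"
      using eventually_ge_at_top[of "Z / u + cell_diam"]
      by eventually_elim (use u in \<open>simp add: field_simps\<close>)
  qed
  show "\<forall>\<^sub>F R in at_top. u * (R - cell_diam) \<le> real (card (L \<inter> ball 0 R))"
    using eventually_ge_at_top[of "cell_diam + 1"]
  proof eventually_elim
    case (elim R)
    then have "R - cell_diam \<le> (R - cell_diam) ^ CARD('n)" by (intro self_le_power) auto
    then have "u * (R - cell_diam) \<le> ball_vol TYPE('n) (R - cell_diam)"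
      unfolding ball_vol_def u_def[symmetric] using u by (intro mult_left_mono) auto
    also have "\<dots> \<le> real (card (L \<inter> ball 0 R))" using elim by (intro card_ball_ge) simp
    finally show ?case .
  qed
qed

theorem entropy_hull: "measure_entropy L translate hull_measure = 0"
proof -
  interpret nu: prob_space hull_measure by (rule prob_space_hull_measure)
  define h where "h \<xi> R = ereal (refined_entropy translate hull_measure \<xi> (L \<inter> ball 0 R) / card (L \<inter> ball 0 R))" for \<xi> R
  have "Limsup at_top (h \<xi>) = 0" if \<xi>: "simple_function hull_measure \<xi>" for \<xi>
  proof (rule antisym)
    have nonneg: "refined_entropy translate hull_measure \<xi> F \<ge> 0" if "finite F" "F \<subseteq> L" for F
      unfolding refined_entropy_def Let_def
      using that measurable_translate
      by (intro nu.entropy_nonneg_exp simple_function_refinement[OF _ _ \<xi>]) auto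
    then show "0 \<le> Limsup at_top (h \<xi>)"
      by (intro le_Limsup always_eventually) (auto simp: h_def finite_ball intro!: divide_nonneg_nonneg)
    show "Limsup at_top (h \<xi>) \<le> 0"
    proof (rule ereal_le_epsilon2)
      \<comment> \<open>With \<open>e / 3\<close> the bound per point is \<open>2 e / 3\<close>, and
        the constant \<open>c\<close> contributes at most \<open>e / 3\<close> once the ball
        contains enough points.\<close>
      fix e :: real assume "e > 0"
      then obtain c where c: "\<And>F. finite F \<Longrightarrow> F \<subseteq> L \<Longrightarrow> refined_entropy translate hull_measure \<xi> F \<le> c + real (card F) * (2 * (e / 3))"
        using refined_entropy_le[OF \<xi>, of "e / 3"] by auto
      have "\<forall>\<^sub>F R in at_top. max 1 (c / (e / 3)) \<le> real (card (L \<inter> ball 0 R))"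
        using card_ball_at_top unfolding filterlim_at_top by blast
      then have "\<forall>\<^sub>F R in at_top. h \<xi> R \<le> ereal e"
      proof eventually_elim
        case (elim R)
        define m where "m = real (card (L \<inter> ball 0 R))"
        have m: "m \<ge> 1" "c \<le> m * (e / 3)" using elim \<open>e > 0\<close> by (auto simp: m_def pos_divide_le_eq)
        have "refined_entropy translate hull_measure \<xi> (L \<inter> ball 0 R) \<le> e * m"
          using c[of "L \<inter> ball 0 R"] m(2) finite_ball by (simp add: m_def[symmetric] algebra_simps)
        then show ?case using m by (simp add: h_def m_def[symmetric] pos_divide_le_eq)
      qed
      then show "Limsup at_top (h \<xi>) \<le> 0 + ereal e" by (simp add: Limsup_bounded)
    qed
  qed
  moreover have "{\<xi> :: (real ^ 'n) set \<Rightarrow> nat. simple_function hull_measure \<xi>} \<noteq> {}"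
    using simple_function_const[of hull_measure 0] by blast
  ultimately show ?thesis by (simp add: measure_entropy_def h_def[abs_def])
qed

end

section \<open>Characters and the dynamical spectrum\<close>

lemma borel_measurable_cnj [measurable]:
  "f \<in> borel_measurable M \<Longrightarrow> (\<lambda>x. cnj (f x)) \<in> borel_measurable M"
  by (rule measurable_compose[OF _ borel_measurable_continuous_onI]) (auto intro: continuous_intros)

lemma cis_sum: "cis (\<Sum>i\<in>A. f i) = (\<Prod>i\<in>A. cis (f i))"
  by (induction A rule: infinite_finite_induct) (auto simp: cis_mult[symmetric])

lemma geometric_sum_cis:
  assumes "Q > 0"
  shows "(\<Sum>a<Q. cis (2 * pi * (real a / real Q * of_int c))) = (if int Q dvd c then of_nat Q else 0)"
proof -
  define w where "w = cis (2 * pi * (of_int c / real Q))"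
  have "cis (2 * pi * (real a / real Q * of_int c)) = w ^ a" for a
    by (simp add: w_def Complex.DeMoivre mult_ac)
  then have sum: "(\<Sum>a<Q. cis (2 * pi * (real a / real Q * of_int c))) = (\<Sum>a<Q. w ^ a)" by simp
  have w1: "w = 1 \<longleftrightarrow> int Q dvd c"
  proof -
    have "w = 1 \<longleftrightarrow> of_int c / real Q \<in> \<int>" unfolding w_def by (rule cis_2pi_eq_1_iff)
    also have "\<dots> \<longleftrightarrow> int Q dvd c"
    proof
      assume "of_int c / real Q \<in> \<int>"
      then obtain m where "of_int c / real Q = of_int m" by (auto elim: Ints_cases)
      then have "real_of_int c = of_int (m * int Q)" using assms by (simp add: field_simps)
      then have "c = m * int Q" by (simp only: of_int_eq_iff)
      then show "int Q dvd c" by simp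
    qed (use assms in \<open>auto elim!: dvdE\<close>)
    finally show ?thesis .
  qed
  show ?thesis
  proof (cases "w = 1")
    case False
    have "w ^ Q = cis (2 * pi * of_int c)" using assms by (simp add: w_def Complex.DeMoivre)
    also have "\<dots> = 1" by (rule cis_2pi_int) simp
    finally show ?thesis using False w1 sum by (simp add: geometric_sum)
  qed (use sum w1 in simp)
qed

lemma L2_mult_integrable:
  assumes f: "f \<in> L2 M" and h: "h \<in> L2 M"
  shows "integrable M (\<lambda>x. f x * cnj (h x))"
proof (rule Bochner_Integration.integrable_bound)
  show "integrable M (\<lambda>x. (cmod (f x))\<^sup>2 + (cmod (h x))\<^sup>2)" using f h by (simp add: L2_def)
  show "(\<lambda>x. f x * cnj (h x)) \<in> borel_measurable M" using f h by (auto simp: L2_def)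
  show "AE x in M. norm (f x * cnj (h x)) \<le> norm ((cmod (f x))\<^sup>2 + (cmod (h x))\<^sup>2)"
  proof (rule AE_I2)
    fix x
    have "2 * cmod (f x) * cmod (h x) \<le> (cmod (f x))\<^sup>2 + (cmod (h x))\<^sup>2" by (rule sum_squares_bound)
    moreover have "0 \<le> cmod (f x) * cmod (h x)" by simp
    ultimately have "cmod (f x) * cmod (h x) \<le> (cmod (f x))\<^sup>2 + (cmod (h x))\<^sup>2" by linarith
    then show "norm (f x * cnj (h x)) \<le> norm ((cmod (f x))\<^sup>2 + (cmod (h x))\<^sup>2)" by (simp add: norm_mult)
  qed
qed

context unimodular_lattice
begin

lemma dual_add: "x \<in> dual_lattice L \<Longrightarrow> y \<in> dual_lattice L \<Longrightarrow> x + y \<in> dual_lattice L"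
  by (auto simp: dual_lattice_def inner_add_left)

lemma dual_diff: "x \<in> dual_lattice L \<Longrightarrow> y \<in> dual_lattice L \<Longrightarrow> x - y \<in> dual_lattice L"
  by (auto simp: dual_lattice_def inner_diff_left)

lemma dual_zero: "0 \<in> dual_lattice L"
  by (auto simp: dual_lattice_def)

lemma dual_scaleR_int: "x \<in> dual_lattice L \<Longrightarrow> of_int m *\<^sub>R x \<in> dual_lattice L"
  by (auto simp: dual_lattice_def)

lemma dual_scaleR: "x \<in> dual_lattice L \<Longrightarrow> real m *\<^sub>R x \<in> dual_lattice L"
  using dual_scaleR_int[of x "int m"] by simp

lemma dual_sum: "(\<And>i. i \<in> I \<Longrightarrow> f i \<in> dual_lattice L) \<Longrightarrow> sum f I \<in> dual_lattice L"
  by (induction I rule: infinite_finite_induct) (auto simp: dual_zero intro: dual_add)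

lemma dual_dvd:
  assumes "m dvd m'" "real m *\<^sub>R y \<in> dual_lattice L"
  shows "real m' *\<^sub>R y \<in> dual_lattice L"
proof -
  obtain j where "m' = m * j" using assms(1) by (auto elim: dvdE)
  then show ?thesis using dual_scaleR[OF assms(2), of j] by (simp add: mult.commute)
qed

text \<open>The rows of the inverse of the transposed basis matrix are the dual basis, whose inner
  products with a vector are its lattice coordinates. Only integrality and the divisibility
  criterion are passed on.\<close>

lemma dual_basis_exists:
  "\<exists>D :: real ^ 'n ^ 'n. \<forall>x\<in>L. (\<forall>i. D $ i \<bullet> x \<in> \<int>) \<and> (\<forall>Q>0. x \<in> multiples Q L \<longleftrightarrow> (\<forall>i. \<exists>m :: int. D $ i \<bullet> x = real Q * of_int m))"
proof -
  have "invertible (transpose B)" using unimodular by (auto simp: invertible_det_nz det_transpose)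
  then obtain D where D: "D ** transpose B = mat 1" unfolding invertible_def by blast
  have Dc: "D $ i \<bullet> combination B c = c $ i" for i c
  proof -
    have "D *v combination B c = c" unfolding combination_eq by (simp only: matrix_vector_mul_assoc D matrix_vector_mul_lid)
    then show ?thesis by (metis matrix_vector_mul_component)
  qed
  have int: "D $ i \<bullet> x \<in> \<int>" if "x \<in> L" for i x using that by (auto simp: L_eq Dc)
  have "x \<in> multiples Q L \<longleftrightarrow> (\<forall>i. \<exists>m :: int. D $ i \<bullet> x = real Q * of_int m)" if x: "x \<in> L" and "Q > 0" for x Q
  proof
    assume "x \<in> multiples Q L"
    then obtain y where "y \<in> L" "x = real Q *\<^sub>R y" by (auto simp: multiples_def)
    then show "\<forall>i. \<exists>m :: int. D $ i \<bullet> x = real Q * of_int m" using int[of y] by (auto elim!: Ints_cases)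
  next
    assume "\<forall>i. \<exists>m :: int. D $ i \<bullet> x = real Q * of_int m"
    then obtain m :: "'n \<Rightarrow> int" where m: "\<And>i. D $ i \<bullet> x = real Q * of_int (m i)" by metis
    obtain c where c: "x = combination B c" using x by (auto simp: L_eq)
    define d :: "real ^ 'n" where "d = (\<chi> i. of_int (m i))"
    have "c = real Q *\<^sub>R d" using m by (simp add: c Dc d_def vec_eq_iff)
    then have "x = real Q *\<^sub>R combination B d" by (simp add: c linear_scale[OF linear_combination])
    moreover have "combination B d \<in> L" by (auto simp: L_eq d_def)
    ultimately show "x \<in> multiples Q L" by (auto simp: multiples_def)
  qed
  then show ?thesis using int by blast
qed

text \<open>Finite Fourier analysis on the quotient of \<open>L\<close> by
  \<open>multiples Q L\<close>. The frequencies \<open>Y j\<close> have coordinates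
  \<open>j i / Q\<close> in the dual basis, so the sum of exponentials factors into one geometric
  sum per coordinate.\<close>

lemma multiples_indicator_fourier:
  assumes "Q > 0"
  shows "\<exists>J (Y :: ('n \<Rightarrow> nat) \<Rightarrow> real ^ 'n). finite J \<and> (\<forall>j\<in>J. real Q *\<^sub>R Y j \<in> dual_lattice L) \<and>
    (\<forall>x\<in>L. (\<Sum>j\<in>J. cis (2 * pi * (Y j \<bullet> x))) = of_nat Q ^ CARD('n) * of_bool (x \<in> multiples Q L))"
proof -
  obtain D :: "real ^ 'n ^ 'n" where D: "\<And>x i. x \<in> L \<Longrightarrow> D $ i \<bullet> x \<in> \<int>"
    "\<And>x Q. x \<in> L \<Longrightarrow> Q > 0 \<Longrightarrow> x \<in> multiples Q L \<longleftrightarrow> (\<forall>i. \<exists>m :: int. D $ i \<bullet> x = real Q * of_int m)"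
    using dual_basis_exists by metis
  define J :: "('n \<Rightarrow> nat) set" where "J = UNIV \<rightarrow>\<^sub>E {..<Q}"
  define Y :: "('n \<Rightarrow> nat) \<Rightarrow> real ^ 'n" where "Y j = (\<Sum>i\<in>UNIV. (real (j i) / real Q) *\<^sub>R D $ i)" for j
  have "real Q *\<^sub>R Y j \<in> dual_lattice L" for j
  proof -
    have "real Q *\<^sub>R Y j = (\<Sum>i\<in>UNIV. real (j i) *\<^sub>R D $ i)" using assms by (simp add: Y_def scaleR_sum_right)
    also have "\<dots> \<in> dual_lattice L" using D(1) by (intro dual_sum dual_scaleR) (simp add: dual_lattice_def)
    finally show ?thesis .
  qed
  moreover have "(\<Sum>j\<in>J. cis (2 * pi * (Y j \<bullet> x))) = of_nat Q ^ CARD('n) * of_bool (x \<in> multiples Q L)" if x: "x \<in> L" for x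
  proof -
    have "\<exists>c :: 'n \<Rightarrow> int. \<forall>i. D $ i \<bullet> x = of_int (c i)" using D(1)[OF x] by (meson Ints_cases)
    then obtain c :: "'n \<Rightarrow> int" where c: "\<And>i. D $ i \<bullet> x = of_int (c i)" by blast
    have "(\<Sum>j\<in>J. cis (2 * pi * (Y j \<bullet> x))) = (\<Sum>j\<in>J. \<Prod>i\<in>UNIV. cis (2 * pi * (real (j i) / real Q * of_int (c i))))"
      by (simp add: Y_def inner_sum_left c sum_distrib_left cis_sum)
    also have "\<dots> = (\<Prod>i\<in>UNIV. \<Sum>a<Q. cis (2 * pi * (real a / real Q * of_int (c i))))"
      unfolding J_def by (rule prod_sum_PiE[symmetric]) auto
    also have "\<dots> = (\<Prod>i\<in>UNIV. if int Q dvd c i then of_nat Q else 0)" by (simp only: geometric_sum_cis[OF assms])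
    also have "\<dots> = of_nat Q ^ CARD('n) * of_bool (\<forall>i. int Q dvd c i)"
    proof (cases "\<forall>i. int Q dvd c i")
      case False
      then have "(\<Prod>i\<in>UNIV. if int Q dvd c i then of_nat Q else (0 :: complex)) = 0" by (intro prod_zero) auto
      then show ?thesis using False by simp
    qed simp
    also have "(\<forall>i. int Q dvd c i) \<longleftrightarrow> x \<in> multiples Q L"
    proof -
      have "(\<exists>m. real_of_int (c i) = real Q * of_int m) \<longleftrightarrow> int Q dvd c i" for i
      proof -
        have "real_of_int (c i) = real Q * of_int m \<longleftrightarrow> c i = int Q * m" for m
          by (metis of_int_eq_iff of_int_mult of_int_of_nat_eq)
        then show ?thesis by (simp add: dvd_def)
      qed
      then show ?thesis using D(2)[OF x assms] by (simp add: c)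
    qed
    finally show ?thesis .
  qed
  moreover have "finite J" unfolding J_def by (intro finite_PiE) auto
  ultimately show ?thesis by blast
qed

end

context kfree_lattice
begin

section \<open>Characters of the Kronecker group\<close>

definition modulus :: "nat \<Rightarrow> nat" where
  "modulus N = (\<Prod>p\<in>primes_below N. p ^ k)"

text \<open>The \<open>y\<close> whose exponential on the lattice is periodic modulo some
  \<open>modulus N\<close>, hence extends continuously to the Kronecker group. Periodicity is the
  convenient form for characters; \<open>frequencies_eq\<close> translates it into
  denominators.\<close>

definition frequencies :: "(real ^ 'n) set" where
  "frequencies = {y. \<exists>N. real (modulus N) *\<^sub>R y \<in> dual_lattice L}"

definition level :: "real ^ 'n \<Rightarrow> nat" where
  "level y = (LEAST N. real (modulus N) *\<^sub>R y \<in> dual_lattice L)"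

definition representative :: "nat \<Rightarrow> (nat \<Rightarrow> (real ^ 'n) set) \<Rightarrow> real ^ 'n" where
  "representative N g = (SOME x. x \<in> L \<and> (\<forall>p\<in>primes_below N. g p = coset (p ^ k) x))"

text \<open>The extension of the exponential from the embedded lattice: it is evaluated at a lattice
  point with the same residues below \<open>level y\<close>. Taking the least admissible level makes
  the function depend on \<open>y\<close> alone.\<close>

definition character :: "real ^ 'n \<Rightarrow> (nat \<Rightarrow> (real ^ 'n) set) \<Rightarrow> complex" where
  "character y g = cis (2 * pi * (y \<bullet> representative (level y) g))"

lemma modulus_pos: "modulus N > 0"
  unfolding modulus_def by (intro prod_pos) (auto simp: prime_gt_0_nat)

lemma modulus_dvd: "N \<le> M \<Longrightarrow> modulus N dvd modulus M"
  unfolding modulus_def by (rule prod_dvd_prod_subset[OF finite_primes_below]) auto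

lemma multiples_modulus: "x \<in> L \<Longrightarrow> x \<in> multiples (modulus N) L \<longleftrightarrow> (\<forall>p\<in>primes_below N. x \<in> multiples (p ^ k) L)"
  unfolding modulus_def by (subst multiples_prod[OF finite_primes_below coprime_prime_powers]) auto

lemma dual_level:
  assumes "y \<in> frequencies" "level y \<le> N"
  shows "real (modulus N) *\<^sub>R y \<in> dual_lattice L"
proof -
  have "real (modulus (level y)) *\<^sub>R y \<in> dual_lattice L"
    using assms(1) unfolding frequencies_def level_def by (auto intro: LeastI)
  then show ?thesis using dual_dvd[OF modulus_dvd[OF assms(2)]] by blast
qed

lemma level_le: "real (modulus N) *\<^sub>R y \<in> dual_lattice L \<Longrightarrow> level y \<le> N"
  unfolding level_def by (rule Least_le)

text \<open>Two lattice points with the same residues below the level differ by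
  \<open>modulus (level y)\<close> times a lattice point, with which \<open>y\<close> has integral
  inner product. Any level from \<open>level y\<close> on may therefore be used.\<close>

lemma character_eq:
  assumes y: "y \<in> frequencies" "level y \<le> N" and x: "x \<in> L" "\<forall>p\<in>primes_below N. g p = coset (p ^ k) x"
  shows "character y g = cis (2 * pi * (y \<bullet> x))"
proof -
  define z where "z = representative (level y) g"
  have "z \<in> L \<and> (\<forall>p\<in>primes_below (level y). g p = coset (p ^ k) z)"
  proof -
    have "x \<in> L \<and> (\<forall>p\<in>primes_below (level y). g p = coset (p ^ k) x)" using x y(2) by auto
    then show ?thesis unfolding z_def representative_def by (rule someI)
  qed
  then have z: "z \<in> L" "\<forall>p\<in>primes_below (level y). coset (p ^ k) x = coset (p ^ k) z" using x y(2) by auto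
  then have "x - z \<in> multiples (modulus (level y)) L"
    using diff_in[OF x(1) z(1)] by (simp add: multiples_modulus coset_eq_iff)
  then obtain u where u: "u \<in> L" "x - z = real (modulus (level y)) *\<^sub>R u" by (auto simp: multiples_def)
  have "y \<bullet> (x - z) = (real (modulus (level y)) *\<^sub>R y) \<bullet> u" unfolding u(2) by simp
  also have "\<dots> \<in> \<int>" using dual_level[OF y(1) order_refl] u(1) by (simp add: dual_lattice_def)
  finally have "cis (2 * pi * (y \<bullet> (x - z))) = 1" by (rule cis_2pi_int)
  then have "cis (2 * pi * (y \<bullet> x)) = cis (2 * pi * (y \<bullet> z))"
    by (simp add: inner_diff_right right_diff_distrib cis_divide[symmetric])
  then show ?thesis by (simp add: character_def z_def)
qed

lemma character_shift:
  assumes "y \<in> frequencies" "t \<in> L" "g \<in> residues"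
  shows "character y (shift t g) = cis (2 * pi * (y \<bullet> t)) * character y g"
proof -
  obtain x where x: "x \<in> L" "\<forall>p\<in>primes_below (level y). g p = coset (p ^ k) x"
    using embed_dense[OF assms(3), of "level y"] by blast
  have "character y g = cis (2 * pi * (y \<bullet> x))" by (rule character_eq[OF assms(1) order_refl x])
  moreover have "character y (shift t g) = cis (2 * pi * (y \<bullet> (x + t)))"
    using x assms(2) by (intro character_eq[OF assms(1) order_refl]) (auto simp: shift_def translate_coset intro: add_in)
  ultimately show ?thesis by (simp add: inner_add_right distrib_left cis_mult[symmetric])
qed

lemma norm_character: "norm (character y g) = 1"
  by (simp add: character_def)

text \<open>Equality holds on all of \<open>residues\<close>, not merely almost everywhere. The
  orthonormal basis is a set of functions, and equivalent frequencies must give one and the same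
  member.\<close>

lemma character_cong:
  assumes "y \<in> frequencies" "y - y' \<in> dual_lattice L" "g \<in> residues"
  shows "character y g = character y' g"
proof -
  have iff: "real (modulus N) *\<^sub>R y \<in> dual_lattice L \<longleftrightarrow> real (modulus N) *\<^sub>R y' \<in> dual_lattice L" for N
  proof -
    have "real (modulus N) *\<^sub>R (y - y') \<in> dual_lattice L" using dual_scaleR[OF assms(2)] .
    from dual_add[OF _ this, of "real (modulus N) *\<^sub>R y'"] dual_diff[OF _ this, of "real (modulus N) *\<^sub>R y"]
    show ?thesis by (auto simp: scaleR_diff_right)
  qed
  then have "level y' = level y" "y' \<in> frequencies" using assms(1) by (auto simp: level_def frequencies_def)
  obtain x where x: "x \<in> L" "\<forall>p\<in>primes_below (level y). g p = coset (p ^ k) x"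
    using embed_dense[OF assms(3), of "level y"] by blast
  have "cis (2 * pi * ((y - y') \<bullet> x)) = 1" using assms(2) x(1) by (intro cis_2pi_int) (simp add: dual_lattice_def)
  then have "cis (2 * pi * (y \<bullet> x)) = cis (2 * pi * (y' \<bullet> x))"
    by (simp add: inner_diff_left right_diff_distrib cis_divide[symmetric])
  then show ?thesis
    using character_eq[OF assms(1) order_refl x] character_eq[OF \<open>y' \<in> frequencies\<close> _ x] \<open>level y' = level y\<close> by simp
qed

lemma measurable_character: "character y \<in> borel_measurable product_measure"
proof -
  have "representative N (label N g) = representative N g" for N g
  proof -
    have "(\<forall>p\<in>primes_below N. label N g p = coset (p ^ k) x) \<longleftrightarrow> (\<forall>p\<in>primes_below N. g p = coset (p ^ k) x)" for x
      by (simp add: label_def)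
    then show ?thesis by (simp add: representative_def)
  qed
  then have "character y = (\<lambda>g. cis (2 * pi * (y \<bullet> representative (level y) (label (level y) g))))"
    by (simp add: character_def fun_eq_iff)
  moreover have "label N \<in> measurable product_measure (count_space UNIV)" for N
    using kronecker.measurable_label by (simp add: measurable_cong_sets[OF sets_product_measure refl])
  ultimately show ?thesis
    using measurable_compose[of "label (level y)" product_measure "count_space UNIV" "\<lambda>v. cis (2 * pi * (y \<bullet> representative (level y) v))" borel]
    by simp
qed

text \<open>The indicator of a single label is a translate of the indicator of
  \<open>multiples (modulus N) L\<close>, whose expansion is known; linear combination over labels
  gives every function of \<open>label N\<close>. The same finite set of characters serves all
  \<open>h\<close>.\<close>

lemma label_indicator_fourier:
  "\<exists>J (Y :: ('n \<Rightarrow> nat) \<Rightarrow> real ^ 'n). finite J \<and> Y ` J \<subseteq> frequencies \<and>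
    (\<forall>h :: _ \<Rightarrow> complex. \<exists>a. \<forall>g\<in>residues. h (label N g) = (\<Sum>j\<in>J. a j * character (Y j) g))"
proof -
  obtain J and Y :: "('n \<Rightarrow> nat) \<Rightarrow> real ^ 'n" where J: "finite J" "\<And>j. j \<in> J \<Longrightarrow> real (modulus N) *\<^sub>R Y j \<in> dual_lattice L"
    and sum: "\<And>x. x \<in> L \<Longrightarrow> (\<Sum>j\<in>J. cis (2 * pi * (Y j \<bullet> x))) = of_nat (modulus N) ^ CARD('n) * of_bool (x \<in> multiples (modulus N) L)"
    using multiples_indicator_fourier[OF modulus_pos[of N]] by blast
  have Yf: "Y j \<in> frequencies" if "j \<in> J" for j using J(2)[OF that] by (auto simp: frequencies_def)
  define q where "q = (of_nat (modulus N) ^ CARD('n) :: complex)"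
  have q: "q \<noteq> 0" using modulus_pos[of N] by (simp add: q_def)
  have "\<exists>c. \<forall>g\<in>residues. of_bool (label N g = v) = (\<Sum>j\<in>J. c j * character (Y j) g)" if v: "v \<in> label N ` residues" for v
  proof -
    obtain w where w: "w \<in> residues" "v = label N w" using v by auto
    obtain z where z: "z \<in> L" "\<forall>p\<in>primes_below N. w p = coset (p ^ k) z" using embed_dense[OF w(1), of N] by blast
    have *: "of_bool (label N g = v) = (\<Sum>j\<in>J. (cis (- (2 * pi * (Y j \<bullet> z))) / q) * character (Y j) g)" if g: "g \<in> residues" for g
    proof -
      obtain x where x: "x \<in> L" "\<forall>p\<in>primes_below N. g p = coset (p ^ k) x" using embed_dense[OF g, of N] by blast
      have "label N g = v \<longleftrightarrow> x - z \<in> multiples (modulus N) L"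
        using x z diff_in[OF x(1) z(1)] by (simp add: w(2) label_eq_iff multiples_modulus coset_eq_iff)
      then have "of_bool (label N g = v) = (\<Sum>j\<in>J. cis (2 * pi * (Y j \<bullet> (x - z)))) / q"
        using sum[OF diff_in[OF x(1) z(1)]] q by (simp add: q_def)
      also have "\<dots> = (\<Sum>j\<in>J. (cis (- (2 * pi * (Y j \<bullet> z))) / q) * character (Y j) g)"
        unfolding sum_divide_distrib
      proof (rule sum.cong[OF refl])
        fix j assume j: "j \<in> J"
        have "character (Y j) g = cis (2 * pi * (Y j \<bullet> x))"
          by (rule character_eq[OF Yf[OF j] level_le[OF J(2)[OF j]] x])
        then show "cis (2 * pi * (Y j \<bullet> (x - z))) / q = (cis (- (2 * pi * (Y j \<bullet> z))) / q) * character (Y j) g"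
          by (simp add: cis_mult inner_diff_right right_diff_distrib add.commute)
      qed
      finally show ?thesis .
    qed
    show ?thesis
      by (intro exI[of _ "\<lambda>j. cis (- (2 * pi * (Y j \<bullet> z))) / q"] ballI) (rule *)
  qed
  then have "\<forall>v\<in>label N ` residues. \<exists>c. \<forall>g\<in>residues. of_bool (label N g = v) = (\<Sum>j\<in>J. c j * character (Y j) g)"
    by blast
  from bchoice[OF this] obtain c where
    c: "\<forall>v\<in>label N ` residues. \<forall>g\<in>residues. of_bool (label N g = v) = (\<Sum>j\<in>J. c v j * character (Y j) g)" ..
  have h: "h (label N g) = (\<Sum>j\<in>J. (\<Sum>v\<in>label N ` residues. h v * c v j) * character (Y j) g)" if g: "g \<in> residues" for h g
  proof -
    have "h (label N g) = (\<Sum>v\<in>label N ` residues. h v * of_bool (label N g = v))"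
    proof -
      have "(\<Sum>v\<in>label N ` residues. h v * of_bool (label N g = v)) = (\<Sum>v\<in>{label N g}. h v)"
        using g finite_label_residues by (intro sum.mono_neutral_cong_right) auto
      then show ?thesis by simp
    qed
    also have "\<dots> = (\<Sum>v\<in>label N ` residues. \<Sum>j\<in>J. h v * c v j * character (Y j) g)"
    proof (rule sum.cong[OF refl])
      fix v assume "v \<in> label N ` residues"
      then have "of_bool (label N g = v) = (\<Sum>j\<in>J. c v j * character (Y j) g)" using c g by blast
      then show "h v * of_bool (label N g = v) = (\<Sum>j\<in>J. h v * c v j * character (Y j) g)"
        by (simp only: sum_distrib_left mult.assoc)
    qed
    also have "\<dots> = (\<Sum>j\<in>J. \<Sum>v\<in>label N ` residues. h v * c v j * character (Y j) g)" by (rule sum.swap)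
    finally show ?thesis by (simp add: sum_distrib_right)
  qed
  show ?thesis
  proof (intro exI[of _ J] exI[of _ Y] conjI allI)
    fix h :: "_ \<Rightarrow> complex"
    show "\<exists>a. \<forall>g\<in>residues. h (label N g) = (\<Sum>j\<in>J. a j * character (Y j) g)"
      by (intro exI[of _ "\<lambda>j. \<Sum>v\<in>label N ` residues. h v * c v j"] ballI) (rule h)
  qed (use J(1) Yf in auto)
qed

section \<open>Eigenfunctions on the hull\<close>

definition eigenfunction :: "real ^ 'n \<Rightarrow> (real ^ 'n) set \<Rightarrow> complex" where
  "eigenfunction y X = character y (recover X)"

lemma measurable_eigenfunction [measurable]: "eigenfunction y \<in> borel_measurable hull_measure"
  unfolding eigenfunction_def[abs_def] by (rule measurable_compose[OF measurable_recover measurable_character])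

lemma norm_eigenfunction: "norm (eigenfunction y X) = 1"
  by (simp add: eigenfunction_def norm_character)

lemma eigenfunction_L2: "eigenfunction y \<in> L2 hull_measure"
proof -
  interpret prob_space hull_measure by (rule prob_space_hull_measure)
  show ?thesis by (simp add: L2_def norm_eigenfunction)
qed

lemma eigenfunction_translate:
  assumes "y \<in> frequencies" "t \<in> L"
  shows "AE X in hull_measure. eigenfunction y (translate t X) = cis (2 * pi * (y \<bullet> t)) * eigenfunction y X"
  using AE_faithful
  by (rule AE_mp) (auto intro!: AE_I2 simp: eigenfunction_def translate_faithful(2)[OF assms(2)] character_shift[OF assms recover_in])

lemma is_eigenfunction_eigenfunction:
  assumes "y \<in> frequencies"
  shows "is_eigenfunction L translate hull_measure y (eigenfunction y)"
proof -
  interpret prob_space hull_measure by (rule prob_space_hull_measure)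
  have "eigenfunction y X \<noteq> 0" for X using norm_eigenfunction[of y X] by auto
  then show ?thesis
    unfolding is_eigenfunction_def using eigenfunction_L2 eigenfunction_translate[OF assms] AE_False by simp
qed

text \<open>Invariance of the measure leaves the inner product unchanged under translation by
  \<open>t\<close>, while the eigenvalue equations multiply it by \<open>w\<close>; for suitable
  \<open>t\<close> this factor is not 1.\<close>

lemma eigenfunctions_orthogonal:
  assumes f: "f \<in> borel_measurable hull_measure" "\<forall>t\<in>L. AE X in hull_measure. f (translate t X) = cis (2 * pi * (y \<bullet> t)) * f X"
    and h: "h \<in> borel_measurable hull_measure" "\<forall>t\<in>L. AE X in hull_measure. h (translate t X) = cis (2 * pi * (y' \<bullet> t)) * h X"
    and ne: "y - y' \<notin> dual_lattice L"
  shows "L2_inner hull_measure f h = 0"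
proof -
  obtain t where t: "t \<in> L" "(y - y') \<bullet> t \<notin> \<int>" using ne by (auto simp: dual_lattice_def)
  define w where "w = cis (2 * pi * ((y - y') \<bullet> t))"
  have w: "w \<noteq> 1" using t(2) by (simp add: w_def cis_2pi_eq_1_iff)
  have [measurable]: "(\<lambda>X. f X * cnj (h X)) \<in> borel_measurable hull_measure" using f(1) h(1) by measurable
  have "L2_inner hull_measure f h = (\<integral>X. f X * cnj (h X) \<partial>distr hull_measure hull_measure (translate t))"
    by (simp add: L2_inner_def distr_translate[OF t(1)])
  also have "\<dots> = (\<integral>X. f (translate t X) * cnj (h (translate t X)) \<partial>hull_measure)"
    by (rule integral_distr[OF measurable_translate[OF t(1)]]) measurable
  also have "\<dots> = (\<integral>X. w * (f X * cnj (h X)) \<partial>hull_measure)"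
  proof (rule integral_cong_AE)
    have [measurable]: "(\<lambda>X. f (translate t X)) \<in> borel_measurable hull_measure" "(\<lambda>X. h (translate t X)) \<in> borel_measurable hull_measure"
      using measurable_compose[OF measurable_translate[OF t(1)]] f(1) h(1) by blast+
    show "(\<lambda>X. f (translate t X) * cnj (h (translate t X))) \<in> borel_measurable hull_measure" by measurable
    show "(\<lambda>X. w * (f X * cnj (h X))) \<in> borel_measurable hull_measure" by measurable
    have "AE X in hull_measure. f (translate t X) = cis (2 * pi * (y \<bullet> t)) * f X" using f(2) t(1) by blast
    moreover have "AE X in hull_measure. h (translate t X) = cis (2 * pi * (y' \<bullet> t)) * h X" using h(2) t(1) by blast
    ultimately show "AE X in hull_measure. f (translate t X) * cnj (h (translate t X)) = w * (f X * cnj (h X))"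
    proof eventually_elim
      case (elim X)
      have "cis (2 * pi * (y \<bullet> t)) * cnj (cis (2 * pi * (y' \<bullet> t))) = w"
        by (simp add: w_def cis_cnj cis_mult inner_diff_left right_diff_distrib)
      then show ?case unfolding elim by (simp add: mult_ac)
    qed
  qed
  also have "\<dots> = w * L2_inner hull_measure f h" by (simp add: L2_inner_def)
  finally have "(1 - w) * L2_inner hull_measure f h = 0" by (simp add: left_diff_distrib)
  then show ?thesis using w by simp
qed

lemma L2_inner_eigenfunction:
  assumes "y \<in> frequencies" "y' \<in> frequencies"
  shows "L2_inner hull_measure (eigenfunction y) (eigenfunction y') = of_bool (eigenfunction y = eigenfunction y')"
proof (cases "y - y' \<in> dual_lattice L")
  case True
  interpret prob_space hull_measure by (rule prob_space_hull_measure)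
  have eq: "eigenfunction y = eigenfunction y'"
    using character_cong[OF assms(1) True recover_in] by (auto simp: eigenfunction_def)
  have "eigenfunction y X * cnj (eigenfunction y X) = 1" for X
    by (simp add: complex_norm_square[symmetric] norm_eigenfunction)
  then show ?thesis unfolding eq[symmetric] by (simp add: L2_inner_def prob_space)
next
  case False
  have 0: "L2_inner hull_measure (eigenfunction y) (eigenfunction y') = 0"
    using eigenfunction_translate assms False by (intro eigenfunctions_orthogonal[where y = y and y' = y']) auto
  have "eigenfunction y \<noteq> eigenfunction y'"
  proof
    interpret prob_space hull_measure by (rule prob_space_hull_measure)
    assume eq: "eigenfunction y = eigenfunction y'"
    have "eigenfunction y X * cnj (eigenfunction y X) = 1" for X
      by (simp add: complex_norm_square[symmetric] norm_eigenfunction)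
    then have "L2_inner hull_measure (eigenfunction y) (eigenfunction y) = 1" by (simp add: L2_inner_def prob_space)
    then show False using 0 eq by simp
  qed
  then show ?thesis using 0 by simp
qed

lemma eigenfunctions_dense:
  assumes f: "f \<in> L2 hull_measure" and "e > 0"
  shows "\<exists>A c. finite A \<and> A \<subseteq> eigenfunction ` frequencies \<and>
    (\<integral>X. (cmod (f X - (\<Sum>u\<in>A. c u * u X)))\<^sup>2 \<partial>hull_measure) < e"
proof -
  have f_meas [measurable]: "f \<in> borel_measurable hull_measure" and f_int: "integrable hull_measure (\<lambda>X. (cmod (f X))\<^sup>2)"
    using f by (auto simp: L2_def)
  have fs [measurable]: "(\<lambda>g. f (sifted g)) \<in> borel_measurable product_measure"
    by (rule measurable_compose[OF sifted_measure_preserving f_meas])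
  have "integrable product_measure (\<lambda>g. (cmod (f (sifted g)))\<^sup>2)"
    using f_int by (intro integrable_distr[OF sifted_measure_preserving]) (simp add: hull_measure_eq[symmetric])
  then have "(\<lambda>g. f (sifted g)) \<in> L2 product_measure" using fs by (simp add: L2_def)
  from kronecker.approximate_L2[OF prob_space_product_measure sets_product_measure this \<open>e > 0\<close>]
  obtain N h where h: "(\<integral>g. (cmod (f (sifted g) - h (label N g)))\<^sup>2 \<partial>product_measure) < e" by blast
  obtain J and Y :: "('n \<Rightarrow> nat) \<Rightarrow> real ^ 'n" where J: "finite J" "Y ` J \<subseteq> frequencies"
    and all: "\<forall>h :: _ \<Rightarrow> complex. \<exists>a. \<forall>g\<in>residues. h (label N g) = (\<Sum>j\<in>J. a j * character (Y j) g)"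
    using label_indicator_fourier[of N] by (elim exE conjE)
  from spec[OF all, of h] obtain a where a: "\<forall>g\<in>residues. h (label N g) = (\<Sum>j\<in>J. a j * character (Y j) g)" ..
  \<comment> \<open>The approximation is indexed by \<open>j\<close>, the basis by functions;
    coefficients of indices that give the same function are therefore collected in
    \<open>c\<close>.\<close>
  define A where "A = (\<lambda>j. eigenfunction (Y j)) ` J"
  define c where "c u = (\<Sum>j\<in>{j \<in> J. eigenfunction (Y j) = u}. a j)" for u
  have s: "(\<Sum>u\<in>A. c u * u X) = (\<Sum>j\<in>J. a j * eigenfunction (Y j) X)" for X
  proof -
    have "(\<Sum>j\<in>J. a j * eigenfunction (Y j) X) = (\<Sum>u\<in>A. \<Sum>j\<in>{j \<in> J. eigenfunction (Y j) = u}. a j * eigenfunction (Y j) X)"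
      unfolding A_def by (rule sum.image_gen[OF J(1)])
    also have "\<dots> = (\<Sum>u\<in>A. c u * u X)"
      unfolding c_def sum_distrib_right by (intro sum.cong refl) auto
    finally show ?thesis by simp
  qed
  have "(\<integral>X. (cmod (f X - (\<Sum>u\<in>A. c u * u X)))\<^sup>2 \<partial>hull_measure)
      = (\<integral>g. (cmod (f (sifted g) - (\<Sum>j\<in>J. a j * eigenfunction (Y j) (sifted g))))\<^sup>2 \<partial>product_measure)"
    unfolding s by (subst hull_measure_eq, rule integral_distr[OF sifted_measure_preserving]) measurable
  also have "\<dots> = (\<integral>g. (cmod (f (sifted g) - h (label N g)))\<^sup>2 \<partial>product_measure)"
  proof (rule integral_cong_AE)
    have [measurable]: "(\<lambda>g. eigenfunction y (sifted g)) \<in> borel_measurable product_measure" for y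
      by (rule measurable_compose[OF sifted_measure_preserving measurable_eigenfunction])
    show "(\<lambda>g. (cmod (f (sifted g) - (\<Sum>j\<in>J. a j * eigenfunction (Y j) (sifted g))))\<^sup>2) \<in> borel_measurable product_measure" by measurable
    have [measurable]: "(\<lambda>g. h (label N g)) \<in> borel_measurable product_measure"
      using measurable_compose[OF kronecker.measurable_label, of h borel] by (simp add: measurable_cong_sets[OF sets_product_measure refl])
    show "(\<lambda>g. (cmod (f (sifted g) - h (label N g)))\<^sup>2) \<in> borel_measurable product_measure" by measurable
    show "AE g in product_measure. (cmod (f (sifted g) - (\<Sum>j\<in>J. a j * eigenfunction (Y j) (sifted g))))\<^sup>2 = (cmod (f (sifted g) - h (label N g)))\<^sup>2"
      using AE_recoverable
    proof eventually_elim
      case (elim g)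
      then have "g \<in> residues" by (simp add: recoverable_def)
      then show ?case using a elim by (simp add: eigenfunction_def recover_sifted)
    qed
  qed
  also have "\<dots> < e" by (rule h)
  finally show ?thesis using J unfolding A_def by (intro exI[of _ A] exI[of _ c]) (auto simp: A_def)
qed

theorem pure_point_hull: "pure_point_spectrum L translate hull_measure"
  unfolding pure_point_spectrum_def
proof (intro exI[of _ "eigenfunction ` frequencies"] conjI ballI)
  show "orthonormal_basis hull_measure (eigenfunction ` frequencies)"
    unfolding orthonormal_basis_def
    using eigenfunction_L2 L2_inner_eigenfunction eigenfunctions_dense by auto
  fix u assume "u \<in> eigenfunction ` frequencies"
  then show "\<exists>y. is_eigenfunction L translate hull_measure y u" using is_eigenfunction_eigenfunction by blast
qed

text \<open>An eigenfunction for some other \<open>y\<close> would be orthogonal to all the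
  functions \<open>eigenfunction y'\<close>, whose span is dense, and so vanish almost
  everywhere.\<close>

theorem spectrum_hull: "dynamical_spectrum L translate hull_measure = frequencies"
proof (intro equalityI subsetI)
  fix y assume "y \<in> frequencies"
  then show "y \<in> dynamical_spectrum L translate hull_measure"
    using is_eigenfunction_eigenfunction by (auto simp: dynamical_spectrum_def)
next
  fix y assume "y \<in> dynamical_spectrum L translate hull_measure"
  then obtain f where f: "f \<in> L2 hull_measure" "\<not> (AE X in hull_measure. f X = 0)"
    "\<forall>t\<in>L. AE X in hull_measure. f (translate t X) = cis (2 * pi * (y \<bullet> t)) * f X"
    by (auto simp: dynamical_spectrum_def is_eigenfunction_def)
  have f_meas [measurable]: "f \<in> borel_measurable hull_measure" and f_int: "integrable hull_measure (\<lambda>X. (cmod (f X))\<^sup>2)"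
    using f(1) by (auto simp: L2_def)
  show "y \<in> frequencies"
  proof (rule ccontr)
    assume y: "y \<notin> frequencies"
    have orth: "L2_inner hull_measure f (eigenfunction y') = 0" if y': "y' \<in> frequencies" for y'
    proof (rule eigenfunctions_orthogonal[OF f_meas f(3)])
      show "y - y' \<notin> dual_lattice L"
      proof
        assume d: "y - y' \<in> dual_lattice L"
        have "real (modulus (level y')) *\<^sub>R y' + real (modulus (level y')) *\<^sub>R (y - y') \<in> dual_lattice L"
          by (intro dual_add dual_level[OF y' order_refl] dual_scaleR d)
        then have "y \<in> frequencies" by (auto simp: frequencies_def scaleR_diff_right)
        then show False using y by simp
      qed
    qed (use eigenfunction_translate[OF y'] in auto)
    \<comment> \<open>For \<open>s\<close> in the span, orthogonality makes the squared distance
      from \<open>f\<close> to \<open>s\<close> the sum of both squared norms; a good approximation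
      thus bounds the norm of \<open>f\<close>.\<close>
    have "(\<integral>X. (cmod (f X))\<^sup>2 \<partial>hull_measure) \<le> 0 + e" if "e > 0" for e
    proof -
      obtain A c where A: "finite A" "A \<subseteq> eigenfunction ` frequencies"
        "(\<integral>X. (cmod (f X - (\<Sum>u\<in>A. c u * u X)))\<^sup>2 \<partial>hull_measure) < e"
        using eigenfunctions_dense[OF f(1) \<open>e > 0\<close>] by blast
      define s where "s X = (\<Sum>u\<in>A. c u * u X)" for X
      have uL: "u \<in> L2 hull_measure" if "u \<in> A" for u using A(2) that eigenfunction_L2 by auto
      have s_meas [measurable]: "s \<in> borel_measurable hull_measure"
        unfolding s_def[abs_def] using uL by (intro borel_measurable_sum borel_measurable_times) (auto simp: L2_def)
      have s_bound: "cmod (s X) \<le> (\<Sum>u\<in>A. cmod (c u))" for X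
        unfolding s_def using A(2) by (intro sum_norm_le) (auto simp: norm_mult norm_eigenfunction)
      interpret prob_space hull_measure by (rule prob_space_hull_measure)
      have s_int: "integrable hull_measure (\<lambda>X. (cmod (s X))\<^sup>2)"
        using s_bound by (intro integrable_const_bound[where B = "(\<Sum>u\<in>A. cmod (c u))\<^sup>2"]) (auto intro!: AE_I2 power_mono)
      have fu_int: "integrable hull_measure (\<lambda>X. f X * cnj (u X))" if "u \<in> A" for u
        by (rule L2_mult_integrable[OF f(1) uL[OF that]])
      have fs_eq: "f X * cnj (s X) = (\<Sum>u\<in>A. cnj (c u) * (f X * cnj (u X)))" for X
        by (simp add: s_def sum_distrib_left mult_ac)
      have fs_int: "integrable hull_measure (\<lambda>X. f X * cnj (s X))"
        unfolding fs_eq using fu_int by (intro Bochner_Integration.integrable_sum integrable_mult_right) auto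
      have "(\<integral>X. f X * cnj (s X) \<partial>hull_measure) = (\<Sum>u\<in>A. cnj (c u) * L2_inner hull_measure f u)"
        unfolding fs_eq L2_inner_def using fu_int by (subst Bochner_Integration.integral_sum) auto
      also have "\<dots> = 0" using orth A(2) by (intro sum.neutral) auto
      finally have fs_0: "(\<integral>X. f X * cnj (s X) \<partial>hull_measure) = 0" .
      define r where "r X = Re (f X * cnj (s X))" for X
      have r: "integrable hull_measure r" "(\<integral>X. r X \<partial>hull_measure) = 0"
        unfolding r_def[abs_def] by (simp_all only: integrable_Re[OF fs_int] integral_Re[OF fs_int] fs_0 zero_complex.sel)
      have expand: "(cmod (f X - s X))\<^sup>2 = (cmod (f X))\<^sup>2 + (cmod (s X))\<^sup>2 - 2 * r X" for X
        unfolding cmod_power2 r_def by (simp add: power2_eq_square algebra_simps)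
      have "(\<integral>X. (cmod (f X - s X))\<^sup>2 \<partial>hull_measure) = (\<integral>X. (cmod (f X))\<^sup>2 \<partial>hull_measure) + (\<integral>X. (cmod (s X))\<^sup>2 \<partial>hull_measure)"
        unfolding expand using f_int s_int r by simp
      moreover have "0 \<le> (\<integral>X. (cmod (s X))\<^sup>2 \<partial>hull_measure)" by simp
      ultimately show ?thesis using A(3) unfolding s_def[symmetric] by linarith
    qed
    then have "(\<integral>X. (cmod (f X))\<^sup>2 \<partial>hull_measure) \<le> 0" by (rule field_le_epsilon)
    moreover have "(\<integral>X. (cmod (f X))\<^sup>2 \<partial>hull_measure) \<ge> 0" by simp
    ultimately have "(\<integral>X. (cmod (f X))\<^sup>2 \<partial>hull_measure) = 0" by simp
    then have "AE X in hull_measure. (cmod (f X))\<^sup>2 = 0"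
      using integral_nonneg_eq_0_iff_AE[OF f_int] by simp
    then show False using f(2) by simp
  qed
qed

section \<open>Denominators of the frequencies\<close>

lemma rational_span_iff:
  "y \<in> rational_span (dual_lattice L) \<longleftrightarrow> (\<exists>m>0. real m *\<^sub>R y \<in> dual_lattice L)"
proof
  assume "y \<in> rational_span (dual_lattice L)"
  then obtain A and q :: "_ \<Rightarrow> rat" where A: "finite A" "A \<subseteq> dual_lattice L" "y = (\<Sum>u\<in>A. of_rat (q u) *\<^sub>R u)"
    by (auto simp: rational_span_def)
  have "\<exists>m>0. real m *\<^sub>R (\<Sum>u\<in>A. of_rat (q u) *\<^sub>R u) \<in> dual_lattice L"
    using A(1,2)
  proof (induction A rule: finite_induct)
    case empty
    then show ?case by (intro exI[of _ 1]) (simp add: dual_zero)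
  next
    case (insert u A)
    then obtain m where m: "m > 0" "real m *\<^sub>R (\<Sum>u\<in>A. of_rat (q u) *\<^sub>R u) \<in> dual_lattice L" by auto
    obtain a b where ab: "quotient_of (q u) = (a, b)" by fastforce
    then have b: "b > 0" "q u = of_int a / of_int b" using quotient_of_denom_pos quotient_of_div by blast+
    define b' where "b' = nat b"
    have b': "b' > 0" "of_rat (q u) = real_of_int a / real b'" using b by (auto simp: b'_def of_rat_divide)
    have "real b' *\<^sub>R (of_rat (q u) *\<^sub>R u) = of_int a *\<^sub>R u" using b' by simp
    moreover have "u \<in> dual_lattice L" using insert by auto
    ultimately have 1: "real b' *\<^sub>R (of_rat (q u) *\<^sub>R u) \<in> dual_lattice L" using dual_scaleR_int by metis
    have "real (m * b') *\<^sub>R (\<Sum>u\<in>insert u A. of_rat (q u) *\<^sub>R u) \<in> dual_lattice L"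
      using dual_add[OF dual_dvd[OF _ 1, of "m * b'"] dual_dvd[OF _ m(2), of "m * b'"]] insert(1,2)
      by (simp add: scaleR_add_right)
    then show ?case using m(1) b'(1) by (intro exI[of _ "m * b'"]) simp
  qed
  then show "\<exists>m>0. real m *\<^sub>R y \<in> dual_lattice L" by (simp add: A(3))
next
  assume "\<exists>m>0. real m *\<^sub>R y \<in> dual_lattice L"
  then obtain m where m: "m > 0" "real m *\<^sub>R y \<in> dual_lattice L" by blast
  have "y = (\<Sum>u\<in>{real m *\<^sub>R y}. of_rat (1 / of_nat m) *\<^sub>R u)" using m(1) by (simp add: of_rat_divide)
  then show "y \<in> rational_span (dual_lattice L)"
    unfolding rational_span_def using m(2) by (intro CollectI exI[of _ "{real m *\<^sub>R y}"] exI[of _ "\<lambda>_. 1 / of_nat m"]) auto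
qed

lemma den_works:
  assumes "\<exists>m>0. real m *\<^sub>R y \<in> dual_lattice L"
  shows "den L y > 0" "real (den L y) *\<^sub>R y \<in> dual_lattice L"
proof -
  have "den L y > 0 \<and> real (den L y) *\<^sub>R y \<in> dual_lattice L" unfolding den_def by (rule LeastI_ex[OF assms])
  then show "den L y > 0" "real (den L y) *\<^sub>R y \<in> dual_lattice L" by auto
qed

text \<open>The integers that carry \<open>y\<close> into the dual lattice form an ideal, generated
  by its least positive element; division with remainder shows this. The existence clause secures
  that \<open>den\<close> is not the default value of an empty minimum.\<close>

lemma den_dvd_iff:
  assumes "m > 0"
  shows "real m *\<^sub>R y \<in> dual_lattice L \<longleftrightarrow> (\<exists>m>0. real m *\<^sub>R y \<in> dual_lattice L) \<and> den L y dvd m"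
proof
  assume m: "real m *\<^sub>R y \<in> dual_lattice L"
  then have ex: "\<exists>m>0. real m *\<^sub>R y \<in> dual_lattice L" using assms by blast
  note d = den_works[OF ex]
  have "real (m mod den L y) *\<^sub>R y = real m *\<^sub>R y - real (m div den L y) *\<^sub>R (real (den L y) *\<^sub>R y)"
  proof -
    have "real m = real (m div den L y) * real (den L y) + real (m mod den L y)"
      by (metis div_mult_mod_eq of_nat_add of_nat_mult)
    then show ?thesis by (simp add: scaleR_left_distrib)
  qed
  also have "\<dots> \<in> dual_lattice L" by (intro dual_diff m dual_scaleR d)
  finally have "real (m mod den L y) *\<^sub>R y \<in> dual_lattice L" .
  moreover have "m mod den L y < den L y" using d by simp
  ultimately have "m mod den L y = 0" unfolding den_def using not_less_Least by (metis (mono_tags, lifting) gr0I)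
  then show "(\<exists>m>0. real m *\<^sub>R y \<in> dual_lattice L) \<and> den L y dvd m" using ex by auto
next
  assume "(\<exists>m>0. real m *\<^sub>R y \<in> dual_lattice L) \<and> den L y dvd m"
  then show "real m *\<^sub>R y \<in> dual_lattice L" using dual_dvd den_works by blast
qed

lemma frequencies_eq: "frequencies = {y \<in> rational_span (dual_lattice L). power_free (k + 1) (den L y)}"
proof (intro equalityI subsetI)
  fix y assume "y \<in> frequencies"
  then obtain N where N: "real (modulus N) *\<^sub>R y \<in> dual_lattice L" by (auto simp: frequencies_def)
  then have ex: "\<exists>m>0. real m *\<^sub>R y \<in> dual_lattice L" and dvd: "den L y dvd modulus N"
    using den_dvd_iff[OF modulus_pos[of N], of y] by auto
  have "\<not> q ^ (k + 1) dvd den L y" if q: "prime q" for q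
  proof
    assume "q ^ (k + 1) dvd den L y"
    then have "q ^ (k + 1) dvd modulus N" using dvd dvd_trans by blast
    then have "k + 1 \<le> multiplicity q (modulus N)" using q modulus_pos[of N] by (intro multiplicity_geI) auto
    also have "\<dots> \<le> k" unfolding modulus_def using q finite_primes_below by (subst multiplicity_prod_prime_powers) auto
    finally show False by simp
  qed
  then show "y \<in> {y \<in> rational_span (dual_lattice L). power_free (k + 1) (den L y)}"
    using ex den_works(1)[OF ex] by (simp add: rational_span_iff power_free_def)
next
  fix y assume y: "y \<in> {y \<in> rational_span (dual_lattice L). power_free (k + 1) (den L y)}"
  then have ex: "\<exists>m>0. real m *\<^sub>R y \<in> dual_lattice L" by (simp add: rational_span_iff)
  define d where "d = den L y"
  have d: "d > 0" "\<And>p. prime p \<Longrightarrow> \<not> p ^ (k + 1) dvd d" using y by (auto simp: power_free_def d_def)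
  \<comment> \<open>A prime dividing \<open>d\<close> is at most \<open>d\<close>, so it is among
    the primes below \<open>Suc d\<close> and occurs there with exponent \<open>k\<close>.\<close>
  have "d dvd modulus (Suc d)"
  proof (rule multiplicity_le_imp_dvd)
    fix p :: nat assume p: "prime p"
    show "multiplicity p d \<le> multiplicity p (modulus (Suc d))"
    proof (cases "p dvd d")
      case True
      then have "p < Suc d" using d(1) by (simp add: dvd_imp_le less_Suc_eq_le)
      then have "multiplicity p (modulus (Suc d)) = k"
        unfolding modulus_def using p finite_primes_below by (subst multiplicity_prod_prime_powers) auto
      moreover have "multiplicity p d < k + 1" using d(2)[OF p] by (intro multiplicity_lessI) (use p d(1) in auto)
      ultimately show ?thesis by simp
    qed (simp add: not_dvd_imp_multiplicity_0)
  qed (use d modulus_pos[of "Suc d"] in auto)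
  then show "y \<in> frequencies"
    using den_dvd_iff[OF modulus_pos[of "Suc d"], of y] ex by (auto simp: frequencies_def d_def)
qed

end

section \<open>The Fourier-Bohr spectrum\<close>

context unimodular_lattice
begin

text \<open>Substituting \<open>z = m x\<close> replaces \<open>y\<close> by \<open>m y\<close> and
  the radius by \<open>R / m\<close>; the ratio of the volumes is the denominator.\<close>

lemma has_mean_multiples_exponential:
  assumes "m > 0"
  shows "has_mean (\<lambda>z. of_bool (z \<in> multiples m L) * cis (2 * pi * (y \<bullet> z)))
    (of_bool (real m *\<^sub>R y \<in> dual_lattice L) / of_nat m ^ CARD('n))"
proof -
  define a where "a x = cis (2 * pi * ((real m *\<^sub>R y) \<bullet> x))" for x
  have "(\<Sum>z\<in>L \<inter> ball 0 R. of_bool (z \<in> multiples m L) * cis (2 * pi * (y \<bullet> z))) = (\<Sum>x\<in>L \<inter> ball 0 (R / real m). a x)" for R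
  proof -
    have "(\<Sum>z\<in>L \<inter> ball 0 R. of_bool (z \<in> multiples m L) * cis (2 * pi * (y \<bullet> z)))
        = (\<Sum>z\<in>(\<lambda>x. real m *\<^sub>R x) ` (L \<inter> ball 0 (R / real m)). cis (2 * pi * (y \<bullet> z)))"
    proof (rule sum.mono_neutral_cong_right[OF finite_ball])
      show "(\<lambda>x. real m *\<^sub>R x) ` (L \<inter> ball 0 (R / real m)) \<subseteq> L \<inter> ball 0 R"
        using assms by (auto simp: pos_less_divide_eq mult.commute intro: scaleR_in)
      have in_image: "z \<in> (\<lambda>x. real m *\<^sub>R x) ` (L \<inter> ball 0 (R / real m))" if z: "z \<in> multiples m L" "norm z < R" for z
      proof -
        obtain x where "x \<in> L" "z = real m *\<^sub>R x" using z by (auto simp: multiples_def)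
        then show ?thesis using z assms by (auto simp: pos_less_divide_eq mult.commute)
      qed
      then show "\<forall>z\<in>L \<inter> ball 0 R - (\<lambda>x. real m *\<^sub>R x) ` (L \<inter> ball 0 (R / real m)). of_bool (z \<in> multiples m L) * cis (2 * pi * (y \<bullet> z)) = 0"
        by auto
    qed (auto simp: multiples_def)
    also have "\<dots> = (\<Sum>x\<in>L \<inter> ball 0 (R / real m). a x)"
      using assms by (subst sum.reindex) (auto simp: inj_on_def a_def)
    finally show ?thesis .
  qed
  moreover have "((\<lambda>R. (\<Sum>x\<in>L \<inter> ball 0 (R / real m). a x) / of_real (ball_vol TYPE('n) R)) \<longlongrightarrow>
      of_bool (real m *\<^sub>R y \<in> dual_lattice L) / of_nat m ^ CARD('n)) at_top"
  proof -
    have "has_mean a (of_bool (real m *\<^sub>R y \<in> dual_lattice L))"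
      using has_mean_exponential[of "real m *\<^sub>R y"] by (simp add: a_def[abs_def] of_bool_def)
    moreover have "filterlim (\<lambda>R. R / real m) at_top at_top"
      unfolding filterlim_at_top
    proof
      fix Z
      show "\<forall>\<^sub>F R in at_top. Z \<le> R / real m"
        using eventually_ge_at_top[of "Z * real m"]
        by eventually_elim (use assms in \<open>simp add: pos_le_divide_eq\<close>)
    qed
    ultimately have "((\<lambda>R. (\<Sum>x\<in>L \<inter> ball 0 (R / real m). a x) / of_real (ball_vol TYPE('n) (R / real m))) \<longlongrightarrow>
        of_bool (real m *\<^sub>R y \<in> dual_lattice L)) at_top"
      unfolding has_mean_def by (rule filterlim_compose)
    from tendsto_divide[OF this tendsto_const, of "of_nat m ^ CARD('n)"]
    have "((\<lambda>R. (\<Sum>x\<in>L \<inter> ball 0 (R / real m). a x) / of_real (ball_vol TYPE('n) (R / real m)) / of_nat m ^ CARD('n)) \<longlongrightarrow>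
        of_bool (real m *\<^sub>R y \<in> dual_lattice L) / of_nat m ^ CARD('n)) at_top" using assms by simp
    moreover have "of_real (ball_vol TYPE('n) (R / real m)) * of_nat m ^ CARD('n) = (of_real (ball_vol TYPE('n) R) :: complex)" for R
      using assms by (simp add: ball_vol_def power_divide)
    ultimately show ?thesis by (simp add: divide_divide_eq_left)
  qed
  ultimately show ?thesis by (simp add: has_mean_def)
qed

end

context kfree_lattice
begin

definition pair_frequency :: "real ^ 'n \<Rightarrow> real" where
  "pair_frequency z = measure product_measure {g \<in> residues. 0 \<in> sifted g \<and> z \<in> sifted g}"

text \<open>Counting pairs with both ends in the ball differs from counting left ends only by points
  in a boundary shell, and the left ends are the occurrences of a two-point pattern.\<close>

lemma autocorrelation_eq:
  assumes z: "z \<in> L"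
  shows "autocorrelation (kfree_points L k) z = pair_frequency z"
proof -
  define V where "V = kfree_points L k"
  have VL: "V \<subseteq> L" by (auto simp: V_def kfree_points_def)
  define Y where "Y = {v \<in> L. v \<in> V \<and> v + z \<in> V}"
  have dens: "has_density Y (pair_frequency z)"
  proof -
    have F: "finite {0, z}" "{0, z} \<subseteq> L" using z zero_in by auto
    have "(\<integral>g. of_bool (0 \<in> sifted g \<inter> {0, z} \<and> z \<in> sifted g \<inter> {0, z}) \<partial>product_measure) = complex_of_real (pair_frequency z)"
    proof -
      have "(0 \<in> sifted g \<inter> {0, z} \<and> z \<in> sifted g \<inter> {0, z}) \<longleftrightarrow> sifted g \<inter> {0, z} = {0, z}" for g by auto
      moreover have "{g \<in> residues. sifted g \<inter> {0, z} = {0, z}} = {g \<in> residues. 0 \<in> sifted g \<and> z \<in> sifted g}" by auto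
      ultimately show ?thesis using integral_pattern[OF F(1), of "{0, z}"] by (simp add: pair_frequency_def)
    qed
    \<comment> \<open>\<open>t\<close> and \<open>t + z\<close> both lie in \<open>V\<close> exactly
      when \<open>V - t\<close> contains 0 and \<open>z\<close>; hence the residues of
      \<open>- t\<close>.\<close>
    then have "has_mean (\<lambda>t. of_bool (0 \<in> sifted (embed (- t)) \<inter> {0, z} \<and> z \<in> sifted (embed (- t)) \<inter> {0, z})) (pair_frequency z)"
      using has_mean_minus[OF has_mean_pattern[OF F, of "\<lambda>P. of_bool (0 \<in> P \<and> z \<in> P)"]] by simp
    moreover have "(0 \<in> sifted (embed (- t)) \<inter> {0, z} \<and> z \<in> sifted (embed (- t)) \<inter> {0, z}) \<longleftrightarrow> t \<in> Y" if "t \<in> L" for t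
      unfolding translate_kfree_points[OF minus_in[OF that], symmetric] using that
      by (simp add: mem_translate Y_def V_def add.commute)
    ultimately have "has_mean (\<lambda>t. of_bool (t \<in> Y)) (pair_frequency z)"
      by (subst (asm) has_mean_cong[where b = "\<lambda>t. of_bool (t \<in> Y)"]) auto
    then show ?thesis by (subst has_density_iff) (auto simp: Y_def)
  qed
  define c where "c R = real (card {(u, v). u \<in> V \<inter> ball 0 R \<and> v \<in> V \<inter> ball 0 R \<and> u - v = z})" for R
  have c_eq: "c R = card {v \<in> Y. v \<in> ball 0 R \<and> v + z \<in> ball 0 R}" for R
  proof -
    have "bij_betw snd {(u, v). u \<in> V \<inter> ball 0 R \<and> v \<in> V \<inter> ball 0 R \<and> u - v = z} {v \<in> Y. v \<in> ball 0 R \<and> v + z \<in> ball 0 R}"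
      by (rule bij_betwI[where g = "\<lambda>v. (v + z, v)"]) (use VL in \<open>auto simp: Y_def algebra_simps\<close>)
    then show ?thesis by (simp add: c_def bij_betw_same_card)
  qed
  have bound: "\<bar>c R - card (Y \<inter> ball 0 R)\<bar> \<le> real (card (L \<inter> ball 0 (R + norm z))) - card (L \<inter> ball 0 (R - norm z))" for R
  proof -
    define A where "A = {v \<in> Y. v \<in> ball 0 R \<and> v + z \<in> ball 0 R}"
    have AY: "A \<subseteq> Y \<inter> ball 0 R" by (auto simp: A_def)
    have fin: "finite (Y \<inter> ball 0 R)" by (rule finite_subset[OF _ finite_ball[of 0 R]]) (auto simp: Y_def)
    have sub: "L \<inter> ball 0 (R - norm z) \<subseteq> L \<inter> ball 0 (R + norm z)"
      using subset_ball[of "R - norm z" "R + norm z" 0] by auto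
    have "c R = card A" by (simp only: c_eq A_def)
    then have "\<bar>c R - card (Y \<inter> ball 0 R)\<bar> = real (card (Y \<inter> ball 0 R - A))"
      using card_Diff_subset[OF finite_subset[OF AY fin] AY] card_mono[OF fin AY]
      by (simp add: of_nat_diff)
    also have "card (Y \<inter> ball 0 R - A) \<le> card (L \<inter> ball 0 (R + norm z) - L \<inter> ball 0 (R - norm z))"
    proof (rule card_mono)
      show "Y \<inter> ball 0 R - A \<subseteq> L \<inter> ball 0 (R + norm z) - L \<inter> ball 0 (R - norm z)"
      proof
        fix v assume v: "v \<in> Y \<inter> ball 0 R - A"
        then have "norm v < R" "\<not> norm (v + z) < R" "v \<in> L" by (auto simp: A_def Y_def)
        moreover have "norm (v + z) \<le> norm v + norm z" by (rule norm_triangle_ineq)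
        moreover have "norm z \<ge> 0" by simp
        ultimately have "norm v < R + norm z" "\<not> norm v < R - norm z" by linarith+
        then show "v \<in> L \<inter> ball 0 (R + norm z) - L \<inter> ball 0 (R - norm z)" using \<open>v \<in> L\<close> by simp
      qed
    qed (use finite_ball in auto)
    also have "real (card (L \<inter> ball 0 (R + norm z) - L \<inter> ball 0 (R - norm z))) = real (card (L \<inter> ball 0 (R + norm z))) - card (L \<inter> ball 0 (R - norm z))"
      using card_Diff_subset[OF finite_ball sub] card_mono[OF finite_ball sub] by (simp add: of_nat_diff)
    finally show ?thesis by simp
  qed
  have "((\<lambda>R. (c R - card (Y \<inter> ball 0 R)) / ball_vol TYPE('n) R) \<longlongrightarrow> 0) at_top"
  proof (rule Lim_null_comparison[OF _ boundary_limit[of "norm z"]])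
    show "\<forall>\<^sub>F R in at_top. norm ((c R - card (Y \<inter> ball 0 R)) / ball_vol TYPE('n) R)
        \<le> (real (card (L \<inter> ball 0 (R + norm z))) - card (L \<inter> ball 0 (R - norm z))) / ball_vol TYPE('n) R"
      using eventually_gt_at_top[of 0]
    proof eventually_elim
      case (elim R)
      then show ?case using bound[of R] vol_pos[of R] by (auto intro!: divide_right_mono)
    qed
  qed simp
  from tendsto_add[OF this dens[unfolded has_density_def]]
  have "((\<lambda>R. c R / ball_vol TYPE('n) R) \<longlongrightarrow> pair_frequency z) at_top" by (simp add: diff_divide_distrib)
  then show ?thesis
    unfolding autocorrelation_def c_def V_def by (intro tendsto_Lim) auto
qed

definition pair_frequency_below :: "nat \<Rightarrow> real ^ 'n \<Rightarrow> real" where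
  "pair_frequency_below N z = measure product_measure {g \<in> residues. 0 \<in> sifted_below N g \<and> z \<in> sifted_below N g}"

lemma prime_weight:
  assumes "prime p"
  shows "weight p = 1 / real (card (cosets (p ^ k)))" "weight p > 0" "weight p \<le> 1 / (real p)\<^sup>2" "2 * weight p \<le> 1" "weight p < 1"
proof -
  have p: "p > 0" "real p \<ge> 2" using assms prime_gt_0_nat prime_ge_2_nat[OF assms] by auto
  show "weight p = 1 / real (card (cosets (p ^ k)))" using p by (simp add: weight_def card_cosets)
  show "weight p > 0" using p(1) by (rule weight_pos)
  show le: "weight p \<le> 1 / (real p)\<^sup>2" by (rule weight_le)
  have "(2 :: real)\<^sup>2 \<le> (real p)\<^sup>2" using p by (intro power_mono) auto
  then have "1 / (real p)\<^sup>2 \<le> 1 / 4" using p by (intro divide_left_mono) auto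
  then show "2 * weight p \<le> 1" "weight p < 1" using le by linarith+
qed

text \<open>At \<open>p\<close> the removed coset must differ from those of 0 and \<open>z\<close>,
  which coincide exactly when \<open>z\<close> is a multiple of \<open>p ^ k\<close>; the
  coordinates are independent. The indicator is kept as a separate summand so that the product
  expands over sets of primes.\<close>

lemma pair_frequency_below_eq:
  assumes z: "z \<in> L"
  shows "pair_frequency_below N z = (\<Prod>p\<in>primes_below N. weight p * of_bool (z \<in> multiples (p ^ k) L) + (1 - 2 * weight p))"
proof -
  interpret product_prob_space "\<lambda>p. uniform_count_measure (cosets (max 1 p ^ k))" "{p. prime p}"
    by (rule product_prob_space)
  have max1: "max 1 p = p" if "prime p" for p :: nat using that prime_ge_1_nat by (simp add: max_def)
  define X where "X p = cosets (p ^ k) - {coset (p ^ k) 0, coset (p ^ k) z}" for p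
  have "{g \<in> residues. 0 \<in> sifted_below N g \<and> z \<in> sifted_below N g} = {g \<in> residues. \<forall>p\<in>primes_below N. g p \<in> X p}"
    using z zero_in residuesD by (auto simp: sifted_below_def X_def mem_residue_iff)
  also have "\<dots> = emb {p. prime p} (primes_below N) (\<Pi>\<^sub>E p\<in>primes_below N. X p)"
    using space_product_measure by (auto simp: prod_emb_def product_measure_def space_PiM PiE_iff)
  finally have eq: "{g \<in> residues. 0 \<in> sifted_below N g \<and> z \<in> sifted_below N g} =
      emb {p. prime p} (primes_below N) (\<Pi>\<^sub>E p\<in>primes_below N. X p)" .
  have "pair_frequency_below N z = (\<Prod>p\<in>primes_below N. measure (uniform_count_measure (cosets (max 1 p ^ k))) (X p))"
    unfolding pair_frequency_below_def product_measure_def eq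
    by (rule measure_PiM_emb) (use max1 finite_primes_below in \<open>auto simp: sets_uniform_count_measure X_def\<close>)
  also have "\<dots> = (\<Prod>p\<in>primes_below N. weight p * of_bool (z \<in> multiples (p ^ k) L) + (1 - 2 * weight p))"
  proof (rule prod.cong[OF refl])
    fix p assume "p \<in> primes_below N"
    then have p: "prime p" by simp
    have fin: "finite (cosets (p ^ k))" using p by (intro finite_cosets) (simp add: prime_gt_0_nat)
    define M where "M = real (card (cosets (p ^ k)))"
    have M: "M > 0" "weight p = 1 / M" using prime_weight(1,2)[OF p] by (auto simp: M_def)
    have sub: "{coset (p ^ k) 0, coset (p ^ k) z} \<subseteq> cosets (p ^ k)" using z zero_in by (auto intro: coset_in_cosets)
    have "measure (uniform_count_measure (cosets (max 1 p ^ k))) (X p) = card (X p) / M"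
      unfolding max1[OF p] using fin by (simp add: measure_uniform_count_measure X_def M_def)
    also have "real (card (X p)) = M - card {coset (p ^ k) 0, coset (p ^ k) z}"
      unfolding X_def M_def using fin sub card_mono[OF fin sub] by (subst card_Diff_subset) (auto simp: of_nat_diff)
    also have "real (card {coset (p ^ k) 0, coset (p ^ k) z}) = 2 - of_bool (z \<in> multiples (p ^ k) L)"
    proof -
      have "coset (p ^ k) z = coset (p ^ k) 0 \<longleftrightarrow> z \<in> multiples (p ^ k) L" by (simp add: coset_eq_iff)
      then show ?thesis by (cases "coset (p ^ k) z = coset (p ^ k) 0") auto
    qed
    also have "(M - (2 - of_bool (z \<in> multiples (p ^ k) L))) / M = weight p * of_bool (z \<in> multiples (p ^ k) L) + (1 - 2 * weight p)"
      using M by (simp add: field_simps)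
    finally show "measure (uniform_count_measure (cosets (max 1 p ^ k))) (X p) = weight p * of_bool (z \<in> multiples (p ^ k) L) + (1 - 2 * weight p)" .
  qed
  finally show ?thesis .
qed

lemma pair_frequency_diff:
  assumes z: "z \<in> L"
  shows "\<bar>pair_frequency z - pair_frequency_below N z\<bar> \<le> 2 * tail N"
proof -
  interpret prob_space product_measure by (rule prob_space_product_measure)
  define A where "A = {g \<in> residues. 0 \<in> sifted g \<and> z \<in> sifted g}"
  define C where "C = {g \<in> residues. 0 \<in> sifted_below N g \<and> z \<in> sifted_below N g}"
  have F: "finite {0, z}" "{0, z} \<subseteq> L" using z zero_in by auto
  have A: "A \<in> sets product_measure"
  proof -
    have "A = {g \<in> residues. sifted g \<inter> {0, z} = {0, z}}" by (auto simp: A_def)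
    then show ?thesis using pattern_in_sets[OF F(1)] by simp
  qed
  have C: "C \<in> sets product_measure"
  proof -
    have "C = kronecker.cells N {w. 0 \<in> sifted_below N w \<and> z \<in> sifted_below N w}"
      by (auto simp: C_def kronecker.cells_def topspace_kronecker_topology sifted_below_label)
    then show ?thesis using kronecker.cells_in_sets by (simp add: sets_product_measure)
  qed
  have AC: "A \<subseteq> C" by (auto simp: A_def C_def sifted_def sifted_below_def)
  have "C - A \<subseteq> late N {0, z}"
  proof
    fix g assume g: "g \<in> C - A"
    show "g \<in> late N {0, z}"
    proof (rule ccontr)
      assume "g \<notin> late N {0, z}"
      then have "sifted g \<inter> {0, z} = sifted_below N g \<inter> {0, z}" using g by (intro sifted_eq_sifted_below) (auto simp: C_def)
      then show False using g by (auto simp: A_def C_def)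
    qed
  qed
  then have "measure product_measure (C - A) \<le> measure product_measure (late N {0, z})"
    using late_in_sets[OF F(1)] by (intro finite_measure_mono)
  also have "\<dots> \<le> card {0, z} * tail N" by (rule measure_late_le[OF F])
  also have "\<dots> \<le> 2 * tail N" using tail_nonneg card_insert_le_m1[of 2 "{z}" 0] by (intro mult_right_mono) auto
  finally have "measure product_measure (C - A) \<le> 2 * tail N" .
  moreover have "measure product_measure (C - A) = measure product_measure C - measure product_measure A"
    using A C AC by (intro finite_measure_Diff)
  moreover have "measure product_measure (C - A) \<ge> 0" by simp
  ultimately show ?thesis by (simp add: pair_frequency_def pair_frequency_below_def A_def[symmetric] C_def[symmetric])
qed

text \<open>The Fourier-Bohr coefficient at level \<open>N\<close>, expanded over sets
  \<open>S\<close> of primes. Each prime of \<open>S\<close> contributes its weight twice: once as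
  coefficient of the indicator in the pair frequency, once as density of the multiples of
  \<open>p ^ k\<close>.\<close>

definition amplitude_below :: "nat \<Rightarrow> real ^ 'n \<Rightarrow> real" where
  "amplitude_below N y = (\<Sum>S\<in>Pow (primes_below N). of_bool (real (\<Prod>p\<in>S. p ^ k) *\<^sub>R y \<in> dual_lattice L) *
     ((\<Prod>p\<in>S. (weight p)\<^sup>2) * (\<Prod>p\<in>primes_below N - S. 1 - 2 * weight p)))"

text \<open>In the expansion over \<open>S\<close>, the Chinese remainder theorem merges the
  indicators at the primes of \<open>S\<close> into that of one sublattice, whose mean against an
  exponential is known.\<close>

lemma has_mean_pair_frequency_below:
  "has_mean (\<lambda>z. of_real (pair_frequency_below N z) * cis (2 * pi * (y \<bullet> z))) (amplitude_below N y)"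
proof -
  define m where "m S = (\<Prod>p\<in>S. p ^ k)" for S :: "nat set"
  define b where "b S = (\<Prod>p\<in>S. weight p) * (\<Prod>p\<in>primes_below N - S. 1 - 2 * weight p)" for S
  have m_pos: "m S > 0" if "S \<subseteq> primes_below N" for S
    unfolding m_def using that by (intro prod_pos) (auto simp: prime_gt_0_nat)
  have expand: "pair_frequency_below N z = (\<Sum>S\<in>Pow (primes_below N). b S * of_bool (z \<in> multiples (m S) L))" if z: "z \<in> L" for z
  proof -
    have "(\<Prod>p\<in>S. weight p * of_bool (z \<in> multiples (p ^ k) L)) = (\<Prod>p\<in>S. weight p) * of_bool (z \<in> multiples (m S) L)"
      if S: "S \<subseteq> primes_below N" for S
    proof -
      have fin: "finite S" using S finite_primes_below finite_subset by blast
      have "z \<in> multiples (m S) L \<longleftrightarrow> (\<forall>p\<in>S. z \<in> multiples (p ^ k) L)"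
        unfolding m_def using S z by (subst multiples_prod[OF fin coprime_prime_powers]) auto
      moreover have "(\<Prod>p\<in>S. of_bool (z \<in> multiples (p ^ k) L)) = (of_bool (\<forall>p\<in>S. z \<in> multiples (p ^ k) L) :: real)"
        using fin by (induction S rule: finite_induct) auto
      ultimately show ?thesis by (simp add: prod.distrib)
    qed
    then show ?thesis
      unfolding pair_frequency_below_eq[OF z] prod_add[OF finite_primes_below]
      by (intro sum.cong refl) (auto simp: b_def)
  qed
  have "has_mean (\<lambda>z. \<Sum>S\<in>Pow (primes_below N). of_real (b S) * (of_bool (z \<in> multiples (m S) L) * cis (2 * pi * (y \<bullet> z))))
      (\<Sum>S\<in>Pow (primes_below N). of_real (b S) * (of_bool (real (m S) *\<^sub>R y \<in> dual_lattice L) / of_nat (m S) ^ CARD('n)))"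
    using finite_primes_below m_pos
    by (intro has_mean_sum has_mean_cmult has_mean_multiples_exponential) (simp_all only: finite_Pow_iff Pow_iff)
  also have "(\<Sum>S\<in>Pow (primes_below N). of_real (b S) * (of_bool (real (m S) *\<^sub>R y \<in> dual_lattice L) / of_nat (m S) ^ CARD('n)))
      = complex_of_real (amplitude_below N y)"
  proof -
    have "of_real (b S) * (of_bool (real (m S) *\<^sub>R y \<in> dual_lattice L) / of_nat (m S) ^ CARD('n)) =
        complex_of_real (of_bool (real (m S) *\<^sub>R y \<in> dual_lattice L) * ((\<Prod>p\<in>S. (weight p)\<^sup>2) * (\<Prod>p\<in>primes_below N - S. 1 - 2 * weight p)))" for S
    proof -
      have "1 / of_nat (m S) ^ CARD('n) = complex_of_real (\<Prod>p\<in>S. weight p)"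
        by (simp add: m_def weight_def prod_dividef prod_power_distrib)
      then have "c / of_nat (m S) ^ CARD('n) = c * complex_of_real (\<Prod>p\<in>S. weight p)" for c
        by (metis mult.right_neutral times_divide_eq_right)
      then show ?thesis by (simp only:) (simp add: b_def power2_eq_square prod.distrib mult_ac)
    qed
    then show ?thesis unfolding amplitude_below_def m_def[symmetric] of_real_sum by (intro sum.cong refl)
  qed
  finally have mean: "has_mean (\<lambda>z. \<Sum>S\<in>Pow (primes_below N). of_real (b S) * (of_bool (z \<in> multiples (m S) L) * cis (2 * pi * (y \<bullet> z))))
      (amplitude_below N y)" .
  have eq: "of_real (pair_frequency_below N z) * cis (2 * pi * (y \<bullet> z)) =
      (\<Sum>S\<in>Pow (primes_below N). of_real (b S) * (of_bool (z \<in> multiples (m S) L) * cis (2 * pi * (y \<bullet> z))))" if "z \<in> L" for z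
    unfolding expand[OF that] of_real_sum sum_distrib_right by (intro sum.cong refl) simp
  show ?thesis using mean by (simp only: has_mean_cong[OF eq])
qed

text \<open>The truncation error \<open>2 * tail N\<close> is uniform in \<open>z\<close>; the
  further factor 2 bounds the number of lattice points by the volume.\<close>

lemma has_mean_pair_frequency:
  assumes "(\<lambda>N. amplitude_below N y) \<longlonglongrightarrow> a"
  shows "has_mean (\<lambda>z. of_real (pair_frequency z) * cis (2 * pi * (y \<bullet> z))) a"
proof (rule has_mean_approximation[OF has_mean_pair_frequency_below])
  show "(\<lambda>N. complex_of_real (amplitude_below N y)) \<longlonglongrightarrow> complex_of_real a" using assms by (rule tendsto_of_real)
  show "(\<lambda>N. 2 * (2 * tail N)) \<longlonglongrightarrow> 0"
    using tendsto_mult_left[OF tendsto_mult_left[OF tail_limit, of 2], of 2] by simp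
  fix N
  have "((\<lambda>R. card (L \<inter> ball 0 R) / ball_vol TYPE('n) R) \<longlongrightarrow> 1) at_top"
    using card_ball_limit[of 1 0 0] by simp
  then have "\<forall>\<^sub>F R in at_top. card (L \<inter> ball 0 R) / ball_vol TYPE('n) R < 2" by (rule order_tendstoD) simp
  then show "\<forall>\<^sub>F R in at_top. (\<Sum>z\<in>L \<inter> ball 0 R. cmod (of_real (pair_frequency z) * cis (2 * pi * (y \<bullet> z)) - of_real (pair_frequency_below N z) * cis (2 * pi * (y \<bullet> z)))) / ball_vol TYPE('n) R \<le> 2 * (2 * tail N)"
    using eventually_gt_at_top[of 0]
  proof eventually_elim
    case (elim R)
    have "cmod (of_real (pair_frequency z) * cis (2 * pi * (y \<bullet> z)) - of_real (pair_frequency_below N z) * cis (2 * pi * (y \<bullet> z))) \<le> 2 * tail N"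
      if "z \<in> L" for z
      using pair_frequency_diff[OF that, of N]
      by (simp add: left_diff_distrib[symmetric] norm_mult of_real_diff[symmetric] del: of_real_diff)
    then have "(\<Sum>z\<in>L \<inter> ball 0 R. cmod (of_real (pair_frequency z) * cis (2 * pi * (y \<bullet> z)) - of_real (pair_frequency_below N z) * cis (2 * pi * (y \<bullet> z)))) \<le> (\<Sum>z\<in>L \<inter> ball 0 R. 2 * tail N)"
      by (intro sum_mono) auto
    then have "(\<Sum>z\<in>L \<inter> ball 0 R. cmod (of_real (pair_frequency z) * cis (2 * pi * (y \<bullet> z)) - of_real (pair_frequency_below N z) * cis (2 * pi * (y \<bullet> z)))) / ball_vol TYPE('n) R \<le> (\<Sum>z\<in>L \<inter> ball 0 R. 2 * tail N) / ball_vol TYPE('n) R"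
      using vol_nonneg[of R] elim by (intro divide_right_mono) auto
    also have "\<dots> = card (L \<inter> ball 0 R) / ball_vol TYPE('n) R * (2 * tail N)" by simp
    also have "\<dots> \<le> 2 * (2 * tail N)" using elim tail_nonneg by (intro mult_right_mono) auto
    finally show ?case .
  qed
qed

lemma amplitude_below_eq_0:
  assumes "y \<notin> frequencies"
  shows "amplitude_below N y = 0"
proof -
  have "real (\<Prod>p\<in>S. p ^ k) *\<^sub>R y \<notin> dual_lattice L" if S: "S \<subseteq> primes_below N" for S
  proof
    assume "real (\<Prod>p\<in>S. p ^ k) *\<^sub>R y \<in> dual_lattice L"
    moreover have "(\<Prod>p\<in>S. p ^ k) dvd modulus N"
      unfolding modulus_def by (rule prod_dvd_prod_subset[OF finite_primes_below S])
    ultimately have "real (modulus N) *\<^sub>R y \<in> dual_lattice L" using dual_dvd by blast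
    then show False using assms by (auto simp: frequencies_def)
  qed
  then show ?thesis unfolding amplitude_below_def by (intro sum.neutral) auto
qed

text \<open>The bound is the telescoping product of \<open>1 - 1 / m\<^sup>2\<close> over
  \<open>2 \<le> m < N\<close>. Every factor of the left side dominates the corresponding one, and
  the integers that are not prime or lie in \<open>S\<close> contribute 1.\<close>

lemma prod_one_minus_weight_ge:
  assumes "N \<ge> 2"
  shows "(\<Prod>p\<in>primes_below N - S. 1 - weight p) \<ge> real N / (2 * (real N - 1))"
  using assms
proof (induction N rule: nat_induct_at_least)
  case base
  have no_primes: "primes_below 2 = {}" by (auto dest!: prime_ge_2_nat)
  show ?case unfolding no_primes by simp
next
  case (Suc N)
  have N: "real N \<ge> 2" using Suc by simp
  have ge: "real (Suc N) / (2 * (real (Suc N) - 1)) \<le> real N / (2 * (real N - 1)) * (1 - 1 / (real N)\<^sup>2)"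
    using N by (simp add: field_simps power2_eq_square)
  have ge0: "real N / (2 * (real N - 1)) \<ge> 0" using N by simp
  show ?case
  proof (cases "prime N \<and> N \<notin> S")
    case True
    have "primes_below (Suc N) - S = insert N (primes_below N - S)" using True by (auto simp: less_Suc_eq)
    then have eq: "(\<Prod>p\<in>primes_below (Suc N) - S. 1 - weight p) = (1 - weight N) * (\<Prod>p\<in>primes_below N - S. 1 - weight p)"
      using finite_primes_below[of N] by simp
    have le: "1 - 1 / (real N)\<^sup>2 \<le> 1 - weight N" using weight_le by simp
    have "1 \<le> (real N)\<^sup>2" using N by (intro one_le_power) simp
    then have "0 \<le> 1 - 1 / (real N)\<^sup>2" using N by simp
    from order_trans[OF ge mult_mono'[OF Suc.IH le ge0 this]]
    show ?thesis unfolding eq by (simp only: mult.commute)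
  next
    case False
    then have "primes_below (Suc N) - S = primes_below N - S" by (auto simp: less_Suc_eq)
    moreover have "real N / (2 * (real N - 1)) * (1 - 1 / (real N)\<^sup>2) \<le> real N / (2 * (real N - 1)) * 1"
      using ge0 by (intro mult_left_mono) auto
    ultimately show ?thesis using ge Suc.IH by simp
  qed
qed

text \<open>For \<open>y\<close> with \<open>(k + 1)\<close>-free denominator \<open>d\<close>, the divisor condition on \<open>S\<close> in
  \<^term>\<open>amplitude_below N y\<close> says that \<open>S\<close> contains the primes dividing \<open>d\<close>, so that the sum
  factorises.\<close>

lemma amplitude_limit:
  assumes y: "y \<in> frequencies"
  obtains a where "a > 0" "(\<lambda>N. amplitude_below N y) \<longlonglongrightarrow> a"
proof -
  define d where "d = den L y"
  have ex: "\<exists>m>0. real m *\<^sub>R y \<in> dual_lattice L" and free: "power_free (k + 1) d"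
    using y by (auto simp: frequencies_eq rational_span_iff d_def)
  have d: "d > 0" using den_works(1)[OF ex] by (simp add: d_def)
  define S0 where "S0 = {p. prime p \<and> p dvd d}"
  have S0: "finite S0" "S0 \<subseteq> primes_below (Suc d)"
  proof -
    show "S0 \<subseteq> primes_below (Suc d)" using d by (auto simp: S0_def less_Suc_eq_le dvd_imp_le)
    then show "finite S0" using finite_primes_below finite_subset by blast
  qed
  have dual_iff: "real (\<Prod>p\<in>S. p ^ k) *\<^sub>R y \<in> dual_lattice L \<longleftrightarrow> S0 \<subseteq> S" if S: "S \<subseteq> primes_below N" for S N
  proof -
    have fin: "finite S" using S finite_primes_below finite_subset by blast
    have pos: "(\<Prod>p\<in>S. p ^ k) > 0" using S by (intro prod_pos) (auto simp: prime_gt_0_nat)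
    have "d dvd (\<Prod>p\<in>S. p ^ k) \<longleftrightarrow> S0 \<subseteq> S"
    proof
      assume dvd: "d dvd (\<Prod>p\<in>S. p ^ k)"
      show "S0 \<subseteq> S"
      proof
        fix q assume "q \<in> S0"
        then have q: "prime q" "q dvd (\<Prod>p\<in>S. p ^ k)" using dvd by (auto simp: S0_def intro: dvd_trans)
        then have "\<exists>p\<in>S. q dvd p ^ k" using prime_dvd_prod_iff[OF fin q(1), of "\<lambda>p. p ^ k"] by simp
        then obtain p where p: "p \<in> S" "q dvd p ^ k" by blast
        then have "q dvd p" using prime_dvd_power q(1) by blast
        then have "q = p" using q(1) p(1) S primes_dvd_imp_eq by auto
        then show "q \<in> S" using p by simp
      qed
    next
      assume sub: "S0 \<subseteq> S"
      show "d dvd (\<Prod>p\<in>S. p ^ k)"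
      proof (rule multiplicity_le_imp_dvd)
        fix p :: nat assume p: "prime p"
        show "multiplicity p d \<le> multiplicity p (\<Prod>p\<in>S. p ^ k)"
        proof (cases "p dvd d")
          case True
          then have "p \<in> S" using p sub by (auto simp: S0_def)
          then have "multiplicity p (\<Prod>p\<in>S. p ^ k) = k"
            using multiplicity_prod_prime_powers[where f = "\<lambda>_. k", OF fin _ p] S by auto
          moreover have "multiplicity p d < k + 1" using free p d by (intro multiplicity_lessI) (auto simp: power_free_def)
          ultimately show ?thesis by simp
        qed (simp add: not_dvd_imp_multiplicity_0)
      qed (use d in auto)
    qed
    then show ?thesis using den_dvd_iff[OF pos, of y] ex by (simp add: d_def)
  qed
  define r where "r N = (\<Prod>p\<in>primes_below N - S0. 1 - weight p)" for N
  have factor: "amplitude_below N y = (\<Prod>p\<in>S0. (weight p)\<^sup>2) * (r N)\<^sup>2" if N: "N \<ge> Suc d" for N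
  proof -
    have S0N: "S0 \<subseteq> primes_below N" using S0(2) N by auto
    \<comment> \<open>The zero at primes of \<open>S0\<close> cancels every \<open>S\<close> that
      omits one of them, so the divisor condition is built into the factors and the sum over all
      subsets becomes a product.\<close>
    define b where "b p = (if p \<in> S0 then 0 else 1 - 2 * weight p)" for p
    have "amplitude_below N y = (\<Sum>S\<in>Pow (primes_below N). (\<Prod>p\<in>S. (weight p)\<^sup>2) * (\<Prod>p\<in>primes_below N - S. b p))"
      unfolding amplitude_below_def
    proof (rule sum.cong[OF refl])
      fix S assume "S \<in> Pow (primes_below N)"
      then have S: "S \<subseteq> primes_below N" by simp
      show "of_bool (real (\<Prod>p\<in>S. p ^ k) *\<^sub>R y \<in> dual_lattice L) * ((\<Prod>p\<in>S. (weight p)\<^sup>2) * (\<Prod>p\<in>primes_below N - S. 1 - 2 * weight p))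
          = (\<Prod>p\<in>S. (weight p)\<^sup>2) * (\<Prod>p\<in>primes_below N - S. b p)"
      proof (cases "S0 \<subseteq> S")
        case True
        then have "(\<Prod>p\<in>primes_below N - S. b p) = (\<Prod>p\<in>primes_below N - S. 1 - 2 * weight p)"
          by (intro prod.cong) (auto simp: b_def)
        then show ?thesis using dual_iff[OF S] True by simp
      next
        case False
        then obtain q where "q \<in> S0" "q \<notin> S" by blast
        then have "(\<Prod>p\<in>primes_below N - S. b p) = 0"
          using S0N finite_primes_below by (intro prod_zero) (auto simp: b_def)
        then show ?thesis using dual_iff[OF S] False by simp
      qed
    qed
    also have "\<dots> = (\<Prod>p\<in>primes_below N. (weight p)\<^sup>2 + b p)" by (rule prod_add[OF finite_primes_below, symmetric])
    also have "\<dots> = (\<Prod>p\<in>primes_below N - S0. (weight p)\<^sup>2 + b p) * (\<Prod>p\<in>S0. (weight p)\<^sup>2 + b p)"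
      by (rule prod.subset_diff[OF S0N finite_primes_below])
    also have "(\<Prod>p\<in>S0. (weight p)\<^sup>2 + b p) = (\<Prod>p\<in>S0. (weight p)\<^sup>2)" by (rule prod.cong) (auto simp: b_def)
    \<comment> \<open>Away from \<open>S0\<close> the two contributions combine to a perfect square,
      \<open>w\<^sup>2 + (1 - 2 w) = (1 - w)\<^sup>2\<close>.\<close>
    also have "(\<Prod>p\<in>primes_below N - S0. (weight p)\<^sup>2 + b p) = (\<Prod>p\<in>primes_below N - S0. (1 - weight p)\<^sup>2)"
      by (rule prod.cong) (auto simp: b_def power2_eq_square algebra_simps)
    also have "\<dots> = (r N)\<^sup>2" by (simp add: r_def prod_power_distrib)
    finally show ?thesis by simp
  qed
  have r_ge: "r N \<ge> 1 / 2" if "N \<ge> 2" for N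
  proof -
    have "1 / 2 \<le> real N / (2 * (real N - 1))" using that by (simp add: field_simps)
    from order_trans[OF this prod_one_minus_weight_ge[OF that, of S0]] show ?thesis unfolding r_def .
  qed
  have w: "0 \<le> 1 - weight p \<and> 1 - weight p \<le> 1" if "prime p" for p
    using prime_weight(2,5)[OF that] by simp
  have "decseq r"
  proof (rule decseq_SucI)
    fix N
    have sub: "primes_below N - S0 \<subseteq> primes_below (Suc N) - S0" by auto
    have "r (Suc N) = (\<Prod>p\<in>(primes_below (Suc N) - S0) - (primes_below N - S0). 1 - weight p) * r N"
      unfolding r_def using finite_primes_below[of "Suc N"] by (intro prod.subset_diff[OF sub]) simp
    also have "\<dots> \<le> 1 * r N"
      using w unfolding r_def by (intro mult_right_mono prod_le_1 prod_nonneg) auto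
    finally show "r (Suc N) \<le> r N" by simp
  qed
  moreover have "0 \<le> r N" for N unfolding r_def using w by (intro prod_nonneg) auto
  ultimately obtain l where l: "r \<longlonglongrightarrow> l" using decseq_convergent[of r 0] by blast
  \<comment> \<open>The uniform lower bound survives in the limit and keeps the infinite product
    away from zero.\<close>
  have "l \<ge> 1 / 2" using l by (rule LIMSEQ_le_const) (use r_ge in blast)
  moreover have "(\<Prod>p\<in>S0. (weight p)\<^sup>2) > 0" using prime_weight(2) by (intro prod_pos zero_less_power) (auto simp: S0_def)
  ultimately have pos: "(\<Prod>p\<in>S0. (weight p)\<^sup>2) * l\<^sup>2 > 0" by simp
  have "(\<lambda>N. (\<Prod>p\<in>S0. (weight p)\<^sup>2) * (r N)\<^sup>2) \<longlonglongrightarrow> (\<Prod>p\<in>S0. (weight p)\<^sup>2) * l\<^sup>2"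
    by (intro tendsto_intros l)
  moreover have "\<forall>\<^sub>F N in sequentially. (\<Prod>p\<in>S0. (weight p)\<^sup>2) * (r N)\<^sup>2 = amplitude_below N y"
    using eventually_ge_at_top[of "Suc d"] by eventually_elim (simp add: factor)
  ultimately have "(\<lambda>N. amplitude_below N y) \<longlonglongrightarrow> (\<Prod>p\<in>S0. (weight p)\<^sup>2) * l\<^sup>2" by (rule Lim_transform_eventually)
  then show ?thesis using that pos by blast
qed

theorem fourier_bohr: "fourier_bohr_spectrum L (autocorrelation (kfree_points L k)) = frequencies"
proof -
  \<comment> \<open>The spectrum is defined with exponentials of the opposite sign;
    \<open>frequencies\<close> is symmetric, so \<open>- y\<close> may replace
    \<open>y\<close>.\<close>
  have iff: "has_mean (\<lambda>z. of_real (autocorrelation (kfree_points L k) z) * cis (- 2 * pi * (y \<bullet> z))) a \<longleftrightarrow>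
      has_mean (\<lambda>z. of_real (pair_frequency z) * cis (2 * pi * ((- y) \<bullet> z))) a" for y a
    by (rule has_mean_cong) (simp add: autocorrelation_eq)
  have neg: "- y \<in> frequencies \<longleftrightarrow> y \<in> frequencies" for y
  proof -
    have "- u \<in> dual_lattice L \<longleftrightarrow> u \<in> dual_lattice L" for u
      using dual_scaleR_int[of u "-1"] dual_scaleR_int[of "- u" "-1"] by auto
    then show ?thesis by (simp add: frequencies_def)
  qed
  have main: "(\<exists>a. a \<noteq> 0 \<and> has_mean (\<lambda>z. of_real (pair_frequency z) * cis (2 * pi * (y \<bullet> z))) a) \<longleftrightarrow> y \<in> frequencies" for y
  proof
    assume "y \<in> frequencies"
    then obtain a where "a > 0" "(\<lambda>N. amplitude_below N y) \<longlonglongrightarrow> a" by (rule amplitude_limit)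
    then have "complex_of_real a \<noteq> 0" "has_mean (\<lambda>z. of_real (pair_frequency z) * cis (2 * pi * (y \<bullet> z))) a"
      using has_mean_pair_frequency by auto
    then show "\<exists>a. a \<noteq> 0 \<and> has_mean (\<lambda>z. of_real (pair_frequency z) * cis (2 * pi * (y \<bullet> z))) a" by blast
  next
    assume "\<exists>a. a \<noteq> 0 \<and> has_mean (\<lambda>z. of_real (pair_frequency z) * cis (2 * pi * (y \<bullet> z))) a"
    then obtain a where a: "a \<noteq> 0" "has_mean (\<lambda>z. of_real (pair_frequency z) * cis (2 * pi * (y \<bullet> z))) a" by blast
    show "y \<in> frequencies"
    proof (rule ccontr)
      assume "y \<notin> frequencies"
      then have "has_mean (\<lambda>z. of_real (pair_frequency z) * cis (2 * pi * (y \<bullet> z))) (complex_of_real 0)"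
        by (intro has_mean_pair_frequency) (simp add: amplitude_below_eq_0)
      then show False using a has_mean_unique by fastforce
    qed
  qed
  have "y \<in> fourier_bohr_spectrum L (autocorrelation (kfree_points L k)) \<longleftrightarrow> y \<in> frequencies" for y
    unfolding fourier_bohr_spectrum_def mem_Collect_eq has_mean_def[symmetric] iff main neg ..
  then show ?thesis by blast
qed

end

theorem theorem7:
  fixes L :: "(real ^ 'n) set" and B :: "real ^ 'n ^ 'n" and k :: nat
    and V :: "(real ^ 'n) set" and \<nu> :: "(real ^ 'n) set measure"
  assumes "k \<ge> 1" and "\<not> (CARD('n) = 1 \<and> k = 1)"
    and "lattice_basis L B" and "\<bar>det B\<bar> = 1"
    and "V = kfree_points L k"
    and "\<nu> = frequency_measure L V"
  shows
    "is_frequency_measure L V \<nu> \<and>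
     (\<forall>f :: (real ^ 'n) set \<Rightarrow> complex. continuous_map (hull_topology L V) euclidean f \<longrightarrow>
       ((\<lambda>R. (\<Sum>x\<in>L \<inter> ball 0 R. f (translate x V)) / of_real (ball_vol TYPE('n) R))
          \<longlongrightarrow> (\<integral>X. f X \<partial>\<nu>)) at_top) \<and>
     ergodic_action L translate \<nu> \<and>
     measure_entropy L translate \<nu> = 0 \<and>
     pure_point_spectrum L translate \<nu> \<and>
     dynamical_spectrum L translate \<nu> =
       {y \<in> rational_span (dual_lattice L). power_free (k + 1) (den L y)} \<and>
     fourier_bohr_spectrum L (autocorrelation V) =
       {y \<in> rational_span (dual_lattice L). power_free (k + 1) (den L y)} \<and>
     metrically_isomorphic L (kronecker_action L k) (kronecker_measure L k) translate \<nu>"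
proof -
  interpret kfree_lattice L B k
    using assms(1-4) by unfold_locales
  have \<nu>: "\<nu> = hull_measure" using assms(5,6) by (simp add: frequency_measure_eq)
  show ?thesis
    unfolding \<nu> assms(5) frequencies_eq[symmetric]
    using frequency_hull_measure equidistribution[unfolded has_mean_def] ergodic_hull entropy_hull
      pure_point_hull spectrum_hull fourier_bohr kronecker_isomorphic
    by blast
qed

end
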